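(* Let $G=([n]\cup[n]',E)$ be a monotone graph with at least one perfect matching. Then for every $\varepsilon\in(0,1)$ the switch Markov chain on the perfect matchings of $G$ has mixing time $T_{\mathrm{mix}}(\varepsilon)<8n^6(n\ln n+2\ln\varepsilon^{-1})$. This is $O(n^7\log n)$ whenever $\ln\varepsilon^{-1}=O(n\log n)$.
   Context: A bipartite graph $([n]\cup[n]',E)$, with $[n]=\{1,\dots,n\}$ and $[n]'=\{1',\dots,n'\}$, is monotone if, after permuting the parts, every $\mathcal N(i)$ is an interval $[\alpha'_i,\beta'_i]$ of consecutive elements of $[n]'$ with $\alpha'_i\le\alpha'_j$ and $\beta'_i\le\beta'_j$ for $i<j$. A perfect matching is identified with a permutation $\pi$ of $[n]$ with edges $(i,\pi'_i)$. The switch chain has state space $\Omega$, the set of perfect matchings. At each step it chooses $i,j\in[n]$ uniformly at random. If $i\neq j$ and $(i,\pi'_j),(j,\pi'_i)\in E$, it replaces $(i,\pi'_i),(j,\pi'_j)$ by $(i,\pi'_j),(j,\pi'_i)$; otherwise it stays. Its stationary distribution $\mu$ is uniform on $\Omega$. The mixing time is $T_{\mathrm{mix}}(\varepsilon)=\max_{x\in\Omega}\min\{t:\max_{S\subseteq\Omega}|P^t(x,S)-\mu(S)|\le\varepsilon\}$, where $P^t$ is the $t$-step transition kernel. *)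

theory Defs
  imports "HOL-Probability.Probability" "HOL-Library.Landau_Symbols"
    "HOL-Library.Extended_Nat" "HOL-Library.Extended_Real" "HOL-Combinatorics.Permutations"
begin

text \<open>
  A bipartite graph with parts \<open>[n]\<close> and \<open>[n]'\<close> is given by its edge set
  \<open>E \<subseteq> {1..n} \<times> {1..n}\<close>, where the pair \<open>(i, j)\<close> stands for the edge
  between \<open>i\<close> and \<open>j'\<close>.
\<close>

definition bipartite_graph :: "nat \<Rightarrow> (nat \<times> nat) set \<Rightarrow> bool" where
  "bipartite_graph n E \<longleftrightarrow> E \<subseteq> {1..n} \<times> {1..n}"

definition neighbours :: "(nat \<times> nat) set \<Rightarrow> nat \<Rightarrow> nat set" where
  "neighbours E i = {j. (i, j) \<in> E}"

text \<open>
  The permutations \<open>\<sigma>\<close> and \<open>\<tau>\<close> reorder the two parts: position \<open>i\<close> of the first part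
  holds the vertex \<open>\<sigma> i\<close>, and position \<open>j\<close> of the second part holds the vertex \<open>(\<tau> j)'\<close>.
  Intervals with \<open>\<alpha> i > \<beta> i\<close> are empty, so isolated vertices are admitted; a graph with
  a perfect matching has none.
\<close>

definition monotone_graph :: "nat \<Rightarrow> (nat \<times> nat) set \<Rightarrow> bool" where
  "monotone_graph n E \<longleftrightarrow> bipartite_graph n E \<and>
    (\<exists>\<sigma> \<tau>. \<sigma> permutes {1..n} \<and> \<tau> permutes {1..n} \<and>
      (\<exists>\<alpha> \<beta> :: nat \<Rightarrow> nat.
        (\<forall>i\<in>{1..n}. {j\<in>{1..n}. \<tau> j \<in> neighbours E (\<sigma> i)} = {\<alpha> i..\<beta> i}) \<and>
        (\<forall>i\<in>{1..n}. \<forall>j\<in>{1..n}. i < j \<longrightarrow> \<alpha> i \<le> \<alpha> j \<and> \<beta> i \<le> \<beta> j)))"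

definition perfect_matchings :: "nat \<Rightarrow> (nat \<times> nat) set \<Rightarrow> (nat \<Rightarrow> nat) set" where
  "perfect_matchings n E = {\<pi>. \<pi> permutes {1..n} \<and> (\<forall>i\<in>{1..n}. (i, \<pi> i) \<in> E)}"

definition switch :: "(nat \<times> nat) set \<Rightarrow> nat \<Rightarrow> nat \<Rightarrow> (nat \<Rightarrow> nat) \<Rightarrow> (nat \<Rightarrow> nat)" where
  "switch E i j \<pi> =
    (if i \<noteq> j \<and> (i, \<pi> j) \<in> E \<and> (j, \<pi> i) \<in> E then \<pi>(i := \<pi> j, j := \<pi> i) else \<pi>)"

definition switch_step :: "nat \<Rightarrow> (nat \<times> nat) set \<Rightarrow> (nat \<Rightarrow> nat) \<Rightarrow> (nat \<Rightarrow> nat) pmf" where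
  "switch_step n E \<pi> = map_pmf (\<lambda>(i, j). switch E i j \<pi>) (pmf_of_set ({1..n} \<times> {1..n}))"

primrec switch_steps ::
  "nat \<Rightarrow> (nat \<times> nat) set \<Rightarrow> nat \<Rightarrow> (nat \<Rightarrow> nat) \<Rightarrow> (nat \<Rightarrow> nat) pmf" where
  "switch_steps n E 0 \<pi> = return_pmf \<pi>"
| "switch_steps n E (Suc t) \<pi> = bind_pmf (switch_steps n E t \<pi>) (switch_step n E)"

definition switch_stationary :: "nat \<Rightarrow> (nat \<times> nat) set \<Rightarrow> (nat \<Rightarrow> nat) pmf" where
  "switch_stationary n E = pmf_of_set (perfect_matchings n E)"

definition switch_distance :: "nat \<Rightarrow> (nat \<times> nat) set \<Rightarrow> nat \<Rightarrow> (nat \<Rightarrow> nat) \<Rightarrow> real" where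
  "switch_distance n E t x =
    (MAX S\<in>Pow (perfect_matchings n E).
      \<bar>measure_pmf.prob (switch_steps n E t x) S - measure_pmf.prob (switch_stationary n E) S\<bar>)"

text \<open>
  The minimum over \<open>t\<close> is taken in the extended naturals, where it is \<open>\<infinity>\<close> if the distance
  never drops to \<open>\<epsilon>\<close>; a finite upper bound on the mixing time thus asserts convergence.
\<close>

definition mixing_time :: "nat \<Rightarrow> (nat \<times> nat) set \<Rightarrow> real \<Rightarrow> enat" where
  "mixing_time n E \<epsilon> =
    (MAX x\<in>perfect_matchings n E. INF t\<in>{t. switch_distance n E t x \<le> \<epsilon>}. enat t)"

end

theory Submission
  imports Defs
begin

text \<open>
  The chain acts through the involutions that exchange the partners of \<open>i\<close> and \<open>j\<close>, and the pairs
  \<open>(i, i)\<close> make it lazy with probability \<open>1 / n\<close>; so the mixing time follows from a Poincare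
  inequality with constant \<open>8 n\<^sup>6\<close>, which comes from canonical paths.

  Order the vertices of both parts by height. Monotonicity enters only through the fact that an edge
  stays an edge when one of its ends is moved within its part towards the height of the other end.
  To get from \<open>x\<close> to \<open>y\<close>, switch the cycles of their symmetric difference one by one. On a single
  cycle, two walkers climb from the lowest to the highest vertex along the two sides, always at a
  common height (the mountain climbing problem, solved by a parity argument). Behind the walkers the
  cycle carries \<open>y\<close>, ahead of them \<open>x\<close>, and one extra edge between the walkers completes the matching;
  the complement is a matching of the same shape. Together with the two extra edges and two bits, the
  complement determines \<open>x\<close> and \<open>y\<close>, so at most \<open>4 n\<^sup>2 |\<Omega>|\<close> pairs use a given state, and no path is
  longer than \<open>n\<^sup>2\<close>.
\<close>

section \<open>Mountain climbing\<close>

text \<open>The complement has to be a matching of the graph as well, otherwise counting by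
  complements would not be a count over the state space. A climbing state therefore needs two gap
  edges, one in the matching and one in the complement. A hop supplies only one of them: the vertex
  passed over has a height between the ends of the other walker's edge, so that edge can be shrunk
  to end in it. If only the gap of the complement is an edge, the state is skipped and the path
  waits at the last valid one; the complement has not changed since, and at most two switches catch
  up later. The matching between these two switches need not be encoded, so only one end of each
  step is required to be, which doubles the number of pairs per step to 8 n^2 |\<Omega>|. Length: a
  cycle with L vertices and its peak at position T takes fewer than T (L - T) \<le> L^2 / 4 steps,
  and over disjoint cycles these squares add up to at most (2 n)^2 / 4 = n^2. As a switch is chosen
  with probability 1 / n^2, the constant 8 n^6 is the product of 8 n^2, n^2 and n^2.\<close>

text \<open>A walk of least length repeats no state. On the grid of climbing states this bounds the
  length by the number of cells; on matchings it makes the steps of a path distinct.\<close>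

lemma relpowp_shortest_path:
  assumes "(R ^^ l) a b"
  obtains l' p where "l' \<le> l" "p 0 = a" "p l' = b" "\<And>i. i < l' \<Longrightarrow> R (p i) (p (Suc i))"
    "inj_on p {..l'}"
proof -
  define k where "k = (LEAST k. (R ^^ k) a b)"
  have k: "(R ^^ k) a b" and min: "\<And>j. (R ^^ j) a b \<Longrightarrow> k \<le> j"
    unfolding k_def using assms by (auto intro: LeastI Least_le)
  obtain p where p: "p 0 = a" "p k = b" "\<And>i. i < k \<Longrightarrow> R (p i) (p (Suc i))"
    using k unfolding relpowp_fun_conv by blast
  have "p i \<noteq> p j" if "i < j" "j \<le> k" for i j
  proof
    assume eq: "p i = p j"
    have "(R ^^ i) a (p i)"
      unfolding relpowp_fun_conv using p that by (intro exI[of _ p]) auto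
    moreover have "(R ^^ (k - j)) (p j) b"
      unfolding relpowp_fun_conv using p that
      by (intro exI[of _ "\<lambda>r. p (j + r)"]) auto
    ultimately have "(R ^^ (i + (k - j))) a b"
      unfolding relpowp_add eq by blast
    with min[of "i + (k - j)"] that show False by simp
  qed
  then have "inj_on p {..k}"
    by (intro linorder_inj_onI) auto
  with p min[OF assms] show thesis by (intro that[of k p]) auto
qed

text \<open>Handshake lemma: related pairs occur in both orders, and there are no loops.\<close>

lemma even_sum_degrees:
  assumes "finite C" "symp r" "irreflp r"
  shows "even (\<Sum>v\<in>C. card {u \<in> C. r v u})"
proof -
  have "(\<Sum>v\<in>C. card {u \<in> C. r v u}) = card (SIGMA v:C. {u \<in> C. r v u})"
    using assms(1) by simp
  also have "even \<dots>"
    using assms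
  proof (induction C rule: finite_induct)
    case (insert a C)
    let ?N = "{u \<in> C. r a u}"
    have "(SIGMA v:insert a C. {u \<in> insert a C. r v u}) =
        (SIGMA v:C. {u \<in> C. r v u}) \<union> (({a} \<times> ?N) \<union> (?N \<times> {a}))"
      using insert.prems by (auto simp: symp_def irreflp_def)
    moreover have "card \<dots> = card (SIGMA v:C. {u \<in> C. r v u}) + card (({a} \<times> ?N) \<union> (?N \<times> {a}))"
      using insert.hyps by (subst card_Un_disjoint) auto
    moreover have "card (({a} \<times> ?N) \<union> (?N \<times> {a})) = 2 * card ?N"
    proof (subst card_Un_disjoint)
      show "{a} \<times> ?N \<inter> ?N \<times> {a} = {}" using insert.hyps by blast
    qed (use insert.hyps in \<open>simp_all add: card_cartesian_product\<close>)
    moreover have "even (card (SIGMA v:C. {u \<in> C. r v u}))"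
      using insert.IH insert.prems by blast
    ultimately show ?case by simp
  qed simp
  finally show ?thesis .
qed

section \<open>Parity of the moves of two climbers\<close>

definition between :: "nat \<Rightarrow> nat \<Rightarrow> nat \<Rightarrow> bool" where
  "between a b c \<longleftrightarrow> a < b \<and> b < c \<or> c < b \<and> b < a"

lemma between_xor: "b \<noteq> a \<Longrightarrow> b \<noteq> c \<Longrightarrow> between a b c \<longleftrightarrow> (a < b) \<noteq> (c < b)"
  by (auto simp: between_def)

text \<open>The sum counts the ends of the segments \<open>{a, b}\<close> and \<open>{c, d}\<close>
  that lie strictly inside the other one. Without common ends this is 0 for disjoint and 2 for
  overlapping or nested segments. If they share only their bottom or only their top, exactly one of
  the remaining ends is inside; if they share both, none is.\<close>

lemma odd_betweens:
  assumes "a \<noteq> b" "c \<noteq> d" "a \<noteq> d" "b \<noteq> c"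
    and "a = c \<or> b = d \<Longrightarrow> a < b \<and> c < d"
  shows "odd (of_bool (between c b d) + of_bool (between c a d) + of_bool (between a d b) +
    of_bool (between a c b) :: nat) \<longleftrightarrow> (a = c) \<noteq> (b = d)"
proof -
  have "odd (of_bool p + of_bool q + of_bool r + of_bool s :: nat) \<longleftrightarrow> p = (q = (\<not> (r = s)))"
    for p q r s by (cases p; cases q; cases r; cases s) simp_all
  moreover have "between c b d = (between c a d = (\<not> (between a d b = between a c b))) \<longleftrightarrow>
      (a = c) \<noteq> (b = d)"
  proof (cases "a = c \<or> b = d")
    case True
    then have "a < b" "c < d" using assms(5) by auto
    with True show ?thesis
      by (cases b d rule: linorder_cases; cases a c rule: linorder_cases) (simp_all add: between_def)
  next
    case False
    then show ?thesis using assms(1-4)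
      by (cases "a < c"; cases "b < d"; cases "a < d"; cases "b < c")
        (simp_all add: between_xor not_less order.order_iff_strict)
  qed
  ultimately show ?thesis by simp
qed

text \<open>
  Two climbers at equal height: \<open>(s, t)\<close> says that they are on the \<open>s\<close>-th edge of the first slope
  and the \<open>t\<close>-th edge of the second; a hop is the passage of one of them over a vertex.
\<close>

inductive hop :: "(nat \<Rightarrow> nat) \<Rightarrow> (nat \<Rightarrow> nat) \<Rightarrow> nat \<Rightarrow> nat \<Rightarrow> nat \<times> nat \<Rightarrow> nat \<times> nat \<Rightarrow> bool"
  for h k M N where
  "Suc s < M \<Longrightarrow> t < N \<Longrightarrow> between (k t) (h (Suc s)) (k (Suc t)) \<Longrightarrow> hop h k M N (s, t) (Suc s, t)"
| "Suc s < M \<Longrightarrow> t < N \<Longrightarrow> between (k t) (h (Suc s)) (k (Suc t)) \<Longrightarrow> hop h k M N (Suc s, t) (s, t)"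
| "s < M \<Longrightarrow> Suc t < N \<Longrightarrow> between (h s) (k (Suc t)) (h (Suc s)) \<Longrightarrow> hop h k M N (s, t) (s, Suc t)"
| "s < M \<Longrightarrow> Suc t < N \<Longrightarrow> between (h s) (k (Suc t)) (h (Suc s)) \<Longrightarrow> hop h k M N (s, Suc t) (s, t)"

lemma hop_sym: "symp (hop h k M N)"
  by (auto simp: symp_def elim!: hop.cases intro: hop.intros)

lemma hop_irrefl: "irreflp (hop h k M N)"
  by (auto simp: irreflp_def elim: hop.cases)

text \<open>With truncated subtraction the neighbours \<open>(s - 1, t)\<close> and
  \<open>(s, t - 1)\<close> coincide at the origin; for this reason \<open>b \<noteq> d\<close> is
  assumed under both guards only.\<close>

lemma card_guarded_quadruple:
  assumes "a \<noteq> b" "a \<noteq> c" "a \<noteq> d" "b \<noteq> c" "Q \<and> S \<Longrightarrow> b \<noteq> d" "c \<noteq> d"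
  shows "card {u. (P \<and> u = a) \<or> (Q \<and> u = b) \<or> (R \<and> u = c) \<or> (S \<and> u = d)} =
    of_bool P + of_bool Q + of_bool R + of_bool S"
proof -
  have "{u. (P \<and> u = a) \<or> (Q \<and> u = b) \<or> (R \<and> u = c) \<or> (S \<and> u = d)} =
      (if P then {a} else {}) \<union> (if Q then {b} else {}) \<union> (if R then {c} else {}) \<union> (if S then {d} else {})"
    by auto
  then show ?thesis
    using assms by (cases P; cases Q; cases R; cases S) simp_all
qed

lemma hop_degree:
  assumes "s < M" "t < N"
  shows "card {u. hop h k M N (s, t) u} =
    of_bool (Suc s < M \<and> between (k t) (h (Suc s)) (k (Suc t))) +
    of_bool (s > 0 \<and> between (k t) (h s) (k (Suc t))) +
    of_bool (Suc t < N \<and> between (h s) (k (Suc t)) (h (Suc s))) +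
    of_bool (t > 0 \<and> between (h s) (k t) (h (Suc s)))"
    (is "_ = of_bool ?a + of_bool ?b + of_bool ?c + of_bool ?d")
proof -
  have "hop h k M N (s, t) u \<longleftrightarrow>
      (?a \<and> u = (Suc s, t)) \<or> (?b \<and> u = (s - 1, t)) \<or> (?c \<and> u = (s, Suc t)) \<or> (?d \<and> u = (s, t - 1))" for u
    using assms unfolding hop.simps[of h k M N "(s, t)" u]
    by (cases s; cases t) (simp_all, blast+)
  then have "{u. hop h k M N (s, t) u} =
      {u. (?a \<and> u = (Suc s, t)) \<or> (?b \<and> u = (s - 1, t)) \<or> (?c \<and> u = (s, Suc t)) \<or> (?d \<and> u = (s, t - 1))}"
    by (simp only:)
  then show ?thesis
    by (simp only:, intro card_guarded_quadruple) auto
qed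

text \<open>Only the corners \<open>(0, 0)\<close> and \<open>(M - 1, N - 1)\<close> of the grid can
  have odd degree. By the handshake lemma, the component of the first corner contains the
  second.\<close>

lemma mountain_climbing:
  fixes h k :: "nat \<Rightarrow> nat"
  assumes pos: "M > 0" "N > 0"
    and bot: "k 0 = h 0" and top: "k N = h M" and "h 0 < h M"
    and h_int: "\<And>s. 0 < s \<Longrightarrow> s < M \<Longrightarrow> h 0 < h s \<and> h s < h M"
    and k_int: "\<And>t. 0 < t \<Longrightarrow> t < N \<Longrightarrow> h 0 < k t \<and> k t < h M"
    and h_step: "\<And>s. s < M \<Longrightarrow> h s \<noteq> h (Suc s)"
    and k_step: "\<And>t. t < N \<Longrightarrow> k t \<noteq> k (Suc t)"
    and hk: "\<And>s t. 0 < s \<Longrightarrow> s < M \<Longrightarrow> 0 < t \<Longrightarrow> t < N \<Longrightarrow> h s \<noteq> k t"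
  obtains l p where "l < M * N" "p 0 = (0, 0)" "p l = (M - 1, N - 1)"
    "\<And>i. i < l \<Longrightarrow> hop h k M N (p i) (p (Suc i))"
proof -
  let ?H = "hop h k M N"
  define C where "C = {u. ?H\<^sup>*\<^sup>* (0, 0) u}"
  have C_grid: "C \<subseteq> {..<M} \<times> {..<N}"
  proof
    fix u assume "u \<in> C"
    then have "?H\<^sup>*\<^sup>* (0, 0) u" by (simp add: C_def)
    then show "u \<in> {..<M} \<times> {..<N}"
      by (induction) (use pos in \<open>auto elim!: hop.cases\<close>)
  qed
  then have fin: "finite C" by (rule finite_subset) simp
  have deg: "odd (card {u. ?H (s, t) u}) \<longleftrightarrow> (s = 0 \<and> t = 0) \<noteq> (Suc s = M \<and> Suc t = N)"
    if st: "s < M" "t < N" for s t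
  proof -
    have hi: "h s' \<le> h M \<and> h 0 \<le> h s'" if "s' \<le> M" for s'
      using h_int[of s'] \<open>h 0 < h M\<close> that by (cases "s' = 0 \<or> s' = M") auto
    have ki: "k t' \<le> h M \<and> h 0 \<le> k t'" if "t' \<le> N" for t'
      using k_int[of t'] \<open>h 0 < h M\<close> top bot that by (cases "t' = 0 \<or> t' = N") auto
    have hk': "h s' = k t' \<longleftrightarrow> (s' = 0 \<and> t' = 0) \<or> (s' = M \<and> t' = N)" if "s' \<le> M" "t' \<le> N" for s' t'
      using hk[of s' t'] h_int[of s'] k_int[of t'] \<open>h 0 < h M\<close> top bot that pos
      by (cases "s' = 0"; cases "s' = M"; cases "t' = 0"; cases "t' = N") auto
    define a b c d where "a = h s" and "b = h (Suc s)" and "c = k t" and "d = k (Suc t)"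
    have ab: "a \<noteq> b" "c \<noteq> d" using h_step k_step st by (auto simp: a_def b_def c_def d_def)
    \<comment> \<open>The range guards of \<open>hop_degree\<close> come for free: at either end of
      a slope the height is extremal, hence never strictly between two others.\<close>
    have ends: "Suc s < M \<and> between c b d \<longleftrightarrow> between c b d"
      "s > 0 \<and> between c a d \<longleftrightarrow> between c a d"
      "Suc t < N \<and> between a d b \<longleftrightarrow> between a d b"
      "t > 0 \<and> between a c b \<longleftrightarrow> between a c b"
      unfolding between_def a_def b_def c_def d_def
      using hi[of s] hi[of "Suc s"] ki[of t] ki[of "Suc t"] st top bot
      by (cases "Suc s = M"; cases "s = 0"; cases "Suc t = N"; cases "t = 0"; force)+
    have eqs: "a = c \<longleftrightarrow> s = 0 \<and> t = 0" "b = d \<longleftrightarrow> Suc s = M \<and> Suc t = N" "a \<noteq> d" "b \<noteq> c"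
      using st hk' by (auto simp: a_def b_def c_def d_def)
    have lt: "a < b \<and> c < d" if "a = c \<or> b = d"
      using that
    proof
      assume "a = c"
      then have "a = h 0" "c = h 0" using eqs(1) bot by (simp_all add: a_def c_def)
      then show ?thesis
        using ab hi[of "Suc s"] ki[of "Suc t"] st by (simp add: b_def d_def)
    next
      assume "b = d"
      then have "b = h M" "d = h M" using eqs(2) top by (simp_all add: b_def d_def)
      then show ?thesis
        using ab hi[of s] ki[of t] st by (simp add: a_def c_def)
    qed
    have "odd (of_bool (between c b d) + of_bool (between c a d) + of_bool (between a d b) +
        of_bool (between a c b) :: nat) \<longleftrightarrow> (a = c) \<noteq> (b = d)"
      using ab eqs(3,4) by (rule odd_betweens) (rule lt)
    then show ?thesis
      unfolding hop_degree[OF st] a_def[symmetric] b_def[symmetric] c_def[symmetric] d_def[symmetric]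
        ends eqs .
  qed
  have "(M - 1, N - 1) \<in> C"
  proof (cases "M = 1 \<and> N = 1")
    case True
    then show ?thesis by (simp add: C_def)
  next
    case False
    show ?thesis
    proof (rule ccontr)
      assume not: "(M - 1, N - 1) \<notin> C"
      have closed: "{u \<in> C. ?H v u} = {u. ?H v u}" if "v \<in> C" for v
        using that unfolding C_def by (auto intro: rtranclp.rtrancl_into_rtrancl)
      have odd: "odd (card {u. ?H v u}) \<longleftrightarrow> v = (0, 0)" if "v \<in> C" for v
      proof -
        obtain s t where v: "v = (s, t)" "s < M" "t < N" using C_grid \<open>v \<in> C\<close> by force
        have "\<not> (Suc s = M \<and> Suc t = N)" using not \<open>v \<in> C\<close> v by auto
        then show ?thesis using deg[OF v(2,3)] v(1) by simp
      qed
      have mem: "(0, 0) \<in> C" by (simp add: C_def)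
      have "even (\<Sum>v\<in>C. card {u \<in> C. ?H v u})"
        using even_sum_degrees[OF fin hop_sym hop_irrefl] .
      also have "(\<Sum>v\<in>C. card {u \<in> C. ?H v u}) = (\<Sum>v\<in>C. card {u. ?H v u})"
        using closed by simp
      also have "\<dots> = card {u. ?H (0, 0) u} + (\<Sum>v\<in>C - {(0, 0)}. card {u. ?H v u})"
        using fin mem by (simp add: sum.remove)
      finally have "even (card {u. ?H (0, 0) u} + (\<Sum>v\<in>C - {(0, 0)}. card {u. ?H v u}))" .
      moreover have "even (\<Sum>v\<in>C - {(0, 0)}. card {u. ?H v u})"
        by (rule dvd_sum) (use odd in auto)
      ultimately show False using odd[OF mem] by simp
    qed
  qed
  then obtain l0 where "(?H ^^ l0) (0, 0) (M - 1, N - 1)"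
    unfolding C_def by (auto dest: rtranclp_imp_relpowp)
  then obtain l p where p: "p 0 = (0, 0)" "p l = (M - 1, N - 1)"
    "\<And>i. i < l \<Longrightarrow> ?H (p i) (p (Suc i))" "inj_on p {..l}"
    using relpowp_shortest_path by metis
  have pC: "p i \<in> C" if "i \<le> l" for i
    using that
  proof (induction i)
    case 0
    then show ?case by (simp add: C_def p)
  next
    case (Suc i)
    then show ?case using p(3)[of i] unfolding C_def
      by (auto intro: rtranclp.rtrancl_into_rtrancl)
  qed
  have "Suc l = card (p ` {..l})" using p(4) by (simp add: card_image)
  also have "p ` {..l} \<subseteq> {..<M} \<times> {..<N}"
    using pC C_grid by blast
  then have "card (p ` {..l}) \<le> card ({..<M} \<times> {..<N})"
    by (intro card_mono) auto
  finally have "l < M * N" by (simp add: card_cartesian_product)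
  with p show thesis by (intro that)
qed

section \<open>Matchings and the encoding of canonical paths\<close>

text \<open>
  A matching is an involution on the naturals that flips parity: even and odd numbers are the
  vertices of the two parts, and the number itself is the height of the vertex. Outside the finite
  set \<open>V\<close> the involution is forced.
\<close>

locale matching_space =
  fixes A :: "nat \<Rightarrow> nat \<Rightarrow> bool" and V :: "nat set"
  assumes A_sym: "A p q \<Longrightarrow> A q p"
    and shrink: "A p q \<Longrightarrow> even r = even q \<Longrightarrow> between p r q \<Longrightarrow> A p r"
    and fin_V: "finite V"
    and outside: "A p q \<Longrightarrow> A p q' \<Longrightarrow> p \<notin> V \<Longrightarrow> q = q'"
begin

definition K :: "(nat \<Rightarrow> nat) set" where
  "K = {f. \<forall>v. f (f v) = v \<and> even (f v) \<noteq> even v \<and> A v (f v)}"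

text \<open>At most one switch apart: a matching is determined by its values on the even part, and
  \<open>i\<close>, \<open>j\<close> are the two vertices there whose partners may change.\<close>

definition adj :: "(nat \<Rightarrow> nat) \<Rightarrow> (nat \<Rightarrow> nat) \<Rightarrow> bool" where
  "adj f g \<longleftrightarrow> (\<exists>i j. \<forall>v. even v \<longrightarrow> v \<notin> {i, j} \<longrightarrow> f v = g v)"

lemma KD: "f \<in> K \<Longrightarrow> f (f v) = v" "f \<in> K \<Longrightarrow> even (f v) \<longleftrightarrow> odd v" "f \<in> K \<Longrightarrow> A v (f v)"
  by (auto simp: K_def)

lemma K_eq_iff: "f \<in> K \<Longrightarrow> f a = b \<longleftrightarrow> f b = a"
  using KD(1) by metis

lemma K_inj: "f \<in> K \<Longrightarrow> f a = f b \<longleftrightarrow> a = b"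
  using KD(1) by metis

lemma swap_in_K:
  assumes f: "f \<in> K" and "A a c" "A (f a) (f c)" "even a \<noteq> even c"
  shows "f(a := c, c := a, f a := f c, f c := f a) \<in> K" (is "?g \<in> K")
proof -
  have ne: "f a \<noteq> a" "f c \<noteq> c" "f a \<noteq> f c" "a \<noteq> c" if "f a \<noteq> c"
    using KD(1,2)[OF f] assms(4) that by metis+
  show ?thesis
  proof (cases "f a = c")
    case True
    then have "f c = a" using KD(1)[OF f] by metis
    with True have "?g = f" by auto
    then show ?thesis using f by simp
  next
    case False
    then have "f c \<noteq> a" using KD(1)[OF f] by metis
    note ne = ne[OF False]
    have "?g a = c" "?g c = a" "?g (f a) = f c" "?g (f c) = f a"
      using ne False \<open>f c \<noteq> a\<close> by simp_all
    moreover have "even (f a) \<noteq> even (f c)"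
      using assms(4) KD(2)[OF f] by simp
    moreover have "?g (?g v) = v \<and> even (?g v) \<noteq> even v \<and> A v (?g v)"
      if v: "v \<notin> {a, c, f a, f c}" for v
    proof -
      have "f v \<notin> {a, c, f a, f c}" using v KD(1)[OF f] by (metis insert_iff empty_iff)
      with v show ?thesis using KD[OF f, of v] by simp
    qed
    moreover have "A c a" "A (f c) (f a)" using assms(2,3) A_sym by blast+
    ultimately have "?g (?g v) = v \<and> even (?g v) \<noteq> even v \<and> A v (?g v)" for v
      using assms(2-4) by (cases "v \<in> {a, c, f a, f c}") (elim insertE, simp_all del: fun_upd_apply)
    then show ?thesis by (simp add: K_def)
  qed
qed

text \<open>
  \<open>z\<close> lies on the canonical path from \<open>x\<close> to \<open>y\<close> and \<open>w\<close> is its complement: the edges of \<open>z\<close> and \<open>w\<close> are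
  those of \<open>x\<close> and \<open>y\<close>, except that \<open>{p, z p}\<close> and \<open>{q, w q}\<close> replace \<open>{p, w q}\<close> and
  \<open>{q, z p}\<close>; \<open>t1\<close> and \<open>t2\<close> tell whether the latter two belong to \<open>x\<close>. The set \<open>D\<close> of the vertices
  already treated is the union of the components, in \<open>z\<close> and \<open>w\<close> without the new edges, that meet
  \<open>{..m}\<close>, where \<open>m\<close> is the least vertex of the cycle under treatment.
\<close>

inductive conn :: "(nat \<Rightarrow> nat) \<Rightarrow> (nat \<Rightarrow> nat) \<Rightarrow> nat \<Rightarrow> nat \<Rightarrow> nat \<Rightarrow> nat \<Rightarrow> bool"
  for z w p q where
  base: "conn z w p q v v"
| step_z: "conn z w p q r v \<Longrightarrow> v \<noteq> p \<Longrightarrow> v \<noteq> z p \<Longrightarrow> conn z w p q r (z v)"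
| step_w: "conn z w p q r v \<Longrightarrow> v \<noteq> q \<Longrightarrow> v \<noteq> w q \<Longrightarrow> conn z w p q r (w v)"

lemma conn_trans: "conn z w p q b c \<Longrightarrow> conn z w p q a b \<Longrightarrow> conn z w p q a c"
  by (induction rule: conn.induct) (auto intro: conn.intros)

lemma conn_sym:
  assumes "z \<in> K" "w \<in> K" "conn z w p q a b"
  shows "conn z w p q b a"
  using assms(3)
proof induction
  case (base v)
  show ?case by (rule conn.base)
next
  case (step_z r v)
  have "z v \<noteq> p" "z v \<noteq> z p"
    using step_z.hyps(2,3) KD(1)[OF assms(1)] by metis+
  then have "conn z w p q (z v) (z (z v))" by (intro conn.intros)
  then show ?case using step_z.IH conn_trans KD(1)[OF assms(1)] by metis
next
  case (step_w r v)
  have "w v \<noteq> q" "w v \<noteq> w q"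
    using step_w.hyps(2,3) KD(1)[OF assms(2)] by metis+
  then have "conn z w p q (w v) (w (w v))" by (intro conn.intros)
  then show ?case using step_w.IH conn_trans KD(1)[OF assms(2)] by metis
qed

definition decode :: "bool \<Rightarrow> bool \<Rightarrow> nat set \<Rightarrow> nat \<Rightarrow> nat \<Rightarrow> (nat \<Rightarrow> nat) \<Rightarrow> (nat \<Rightarrow> nat) \<Rightarrow> nat \<Rightarrow> nat" where
  "decode t1 t2 D p q z w v =
    (if t1 \<and> v = p then w q else if t1 \<and> v = w q then p
     else if t2 \<and> v = q then z p else if t2 \<and> v = z p then q
     else if v \<in> D then w v else z v)"

text \<open>The clause for \<open>t1 = t2\<close> makes the replaced edges disjoint when
  \<open>x\<close> or \<open>y\<close> contains both, so the order of the cases in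
  \<open>decode\<close> does not matter. The last two clauses say that each replaced edge leads from
  the component of \<open>m\<close> to a vertex outside \<open>D\<close>; stating this for both
  edges makes \<open>code\<close> invariant under renaming the extra edges by their other
  ends.\<close>

definition code where
  "code x y z w p q t1 t2 \<longleftrightarrow> (\<exists>D m.
    x = decode t1 t2 D p q z w \<and> y = decode (\<not> t2) (\<not> t1) D q p w z \<and>
    (t1 = t2 \<longrightarrow> p \<noteq> q \<and> z p \<noteq> w q) \<and>
    D = {v. \<exists>r\<le>m. conn z w p q r v} \<and> (\<forall>v. conn z w p q m v \<longrightarrow> m \<le> v) \<and>
    (conn z w p q m p \<and> w q \<notin> D \<or> conn z w p q m (w q) \<and> p \<notin> D) \<and>
    (conn z w p q m q \<and> z p \<notin> D \<or> conn z w p q m (z p) \<and> q \<notin> D))"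

definition main where
  "main x y z \<longleftrightarrow> (\<exists>w\<in>K. \<exists>p\<in>V. \<exists>q\<in>V. \<exists>t1 t2. even p \<and> even q \<and> code x y z w p q t1 t2)"

text \<open>It suffices to recover \<open>m\<close>. If \<open>m1 \<le> m2\<close>, then
  \<open>D1 \<subseteq> D2\<close>, so the end of \<open>{p, w q}\<close> outside \<open>D2\<close>
  is also outside \<open>D1\<close>. The other end is then joined both to \<open>m1\<close> and to
  \<open>m2\<close>, and each of them is the least vertex of their common component.\<close>

lemma code_inj:
  assumes zw: "z \<in> K" "w \<in> K"
    and "code x y z w p q t1 t2" "code x' y' z w p q t1 t2"
  shows "x = x' \<and> y = y'"
proof -
  let ?c = "conn z w p q"
  obtain D m where 1: "x = decode t1 t2 D p q z w" "y = decode (\<not> t2) (\<not> t1) D q p w z"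
    "D = {v. \<exists>r\<le>m. ?c r v}" "\<And>v. ?c m v \<Longrightarrow> m \<le> v" "?c m p \<and> w q \<notin> D \<or> ?c m (w q) \<and> p \<notin> D"
    using assms(3) unfolding code_def by blast
  obtain D' m' where 2: "x' = decode t1 t2 D' p q z w" "y' = decode (\<not> t2) (\<not> t1) D' q p w z"
    "D' = {v. \<exists>r\<le>m'. ?c r v}" "\<And>v. ?c m' v \<Longrightarrow> m' \<le> v" "?c m' p \<and> w q \<notin> D' \<or> ?c m' (w q) \<and> p \<notin> D'"
    using assms(4) unfolding code_def by blast
  have key: "m1 = m2" if "m1 \<le> m2"
      "D1 = {v. \<exists>r\<le>m1. ?c r v}" "\<And>v. ?c m1 v \<Longrightarrow> m1 \<le> v" "?c m1 p \<and> w q \<notin> D1 \<or> ?c m1 (w q) \<and> p \<notin> D1"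
      "D2 = {v. \<exists>r\<le>m2. ?c r v}" "\<And>v. ?c m2 v \<Longrightarrow> m2 \<le> v" "?c m2 p \<and> w q \<notin> D2 \<or> ?c m2 (w q) \<and> p \<notin> D2"
    for m1 m2 D1 D2
  proof -
    note prems = that
    have "D1 \<subseteq> D2" using that(1,2,5) by (auto intro: order_trans)
    moreover have "?c m1 u \<Longrightarrow> u \<in> D1" "?c m2 u \<Longrightarrow> u \<in> D2" for u using that(2,5) by auto
    ultimately obtain u where "?c m1 u" "?c m2 u" using prems(4,7) by blast
    then have "?c m1 m2" "?c m2 m1" using conn_sym[OF zw] conn_trans by blast+
    then show ?thesis using prems(3,6) by (intro antisym)
  qed
  have "m = m'"
  proof (cases "m \<le> m'")
    case True
    then show ?thesis using key[OF True 1(3) 1(4) 1(5) 2(3) 2(4) 2(5)] by blast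
  next
    case False
    then show ?thesis using key[OF _ 2(3) 2(4) 2(5) 1(3) 1(4) 1(5)] by simp
  qed
  then have "D = D'" by (simp only: 1(3) 2(3))
  then show ?thesis by (simp only: 1(1,2) 2(1,2))
qed

lemma if_chain_flip:
  assumes "a \<noteq> b" "c \<noteq> d" "t1 \<Longrightarrow> t2 \<Longrightarrow> a \<noteq> c \<and> a \<noteq> d \<and> b \<noteq> c \<and> b \<noteq> d"
  shows "(if t1 \<and> v = a then b else if t1 \<and> v = b then a
      else if t2 \<and> v = c then d else if t2 \<and> v = d then c else e) =
    (if t2 \<and> v = d then c else if t2 \<and> v = c then d
      else if t1 \<and> v = b then a else if t1 \<and> v = a then b else e)"
  using assms by (cases t1; cases t2; cases "v = a"; cases "v = b"; simp)

text \<open>Each extra edge may be named by its other end; the replaced edges then trade places, and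
  so do the bits. This lets \<open>main\<close> insist on even \<open>p\<close> and
  \<open>q\<close>, which leaves n^2 instead of (2 n)^2 choices.\<close>

lemma code_flip:
  assumes zw: "z \<in> K" "w \<in> K" and "even p = even q" and "code x y z w p q t1 t2"
  shows "code x y z w (z p) (w q) t2 t1"
proof -
  note zz = KD(1)[OF zw(1)] and ww = KD(1)[OF zw(2)]
  have conn_eq: "conn z w (z p) (w q) = conn z w p q"
  proof -
    have 1: "conn z w p q a b" if "conn z w (z p) (w q) a b" for a b
      using that by induction (simp_all add: zz ww conn.intros)
    have "conn z w (z p) (w q) a b" if "conn z w p q a b" for a b
      using that by induction (simp_all add: zz ww conn.intros)
    with 1 show ?thesis by blast
  qed
  obtain D m where 1: "x = decode t1 t2 D p q z w" "y = decode (\<not> t2) (\<not> t1) D q p w z"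
    "t1 = t2 \<longrightarrow> p \<noteq> q \<and> z p \<noteq> w q"
    "D = {v. \<exists>r\<le>m. conn z w p q r v}" "\<forall>v. conn z w p q m v \<longrightarrow> m \<le> v"
    "conn z w p q m p \<and> w q \<notin> D \<or> conn z w p q m (w q) \<and> p \<notin> D"
    "conn z w p q m q \<and> z p \<notin> D \<or> conn z w p q m (z p) \<and> q \<notin> D"
    using assms(4) unfolding code_def by blast
  have ne: "p \<noteq> z p" "q \<noteq> w q" "p \<noteq> w q" "q \<noteq> z p"
    using KD(2)[OF zw(1), of p] KD(2)[OF zw(2), of q] assms(3) by auto
  have "x = decode t2 t1 D (z p) (w q) z w"
    unfolding 1(1) decode_def zz ww by (intro ext if_chain_flip) (use 1(3) ne in auto)
  moreover have "y = decode (\<not> t1) (\<not> t2) D (w q) (z p) w z"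
    unfolding 1(2) decode_def zz ww by (intro ext if_chain_flip) (use 1(3) ne in auto)
  moreover have "t2 = t1 \<longrightarrow> z p \<noteq> w q \<and> z (z p) \<noteq> w (w q)"
    unfolding zz ww using 1(3) by blast
  moreover have "conn z w p q m (z p) \<and> w (w q) \<notin> D \<or> conn z w p q m (w (w q)) \<and> z p \<notin> D"
    unfolding ww using 1(7) by blast
  moreover have "conn z w p q m (w q) \<and> z (z p) \<notin> D \<or> conn z w p q m (z (z p)) \<and> w q \<notin> D"
    unfolding zz using 1(6) by blast
  ultimately show ?thesis
    unfolding code_def conn_eq using 1(4,5) by (intro exI[of _ D] exI[of _ m] conjI)
qed

end

section \<open>Switching a single cycle\<close>

text \<open>This is \<open>Z a b\<close> on the positions 1, ..., L of the cycle. Strictly between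
  \<open>a\<close> and \<open>b\<close> the even positions step up, along edges of \<open>x\<close>;
  elsewhere the odd ones do, along edges of \<open>y\<close>.\<close>

lemma exchange_involution:
  fixes a b i L :: nat
  assumes "odd a" "even b" "a < b" "b \<le> L" "0 < i" "i \<le> L"
  defines "f \<equiv> \<lambda>i. if i = a then b else if i = b then a
    else if even i = (a < i \<and> i < b) then Suc i else i - 1"
  shows "i = f (f i)"
proof -
  consider "i = a" | "i = b" | "i \<noteq> a" "i \<noteq> b" "a < i" "i < b" "even i" | "i \<noteq> a" "i \<noteq> b" "a < i" "i < b" "odd i"
    | "i \<noteq> b" "i < a \<or> b < i" "even i" | "i \<noteq> a" "i < a \<or> b < i" "odd i" by (metis nat_neq_iff)
  then show ?thesis
  proof cases
    case 3
    then have "f i = Suc i" "Suc i \<noteq> b" using assms by (auto simp: f_def)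
    then show ?thesis using 3 assms by (simp add: f_def)
  next
    case 4
    then have "f i = i - 1" by (simp add: f_def)
    moreover have "i - 1 \<noteq> a" "even (i - 1)" "i - 1 \<noteq> b" using 4 assms by auto
    moreover have "a < i - 1" "i - 1 < b" using 4 calculation by auto
    ultimately show ?thesis using assms by (simp add: f_def)
  next
    case 5
    then have "f i = i - 1" "i \<noteq> a" "0 < i" using assms by (auto simp: f_def)
    moreover have "i - 1 \<noteq> b" "odd (i - 1)" using 5 assms calculation by auto
    moreover have "\<not> (a < i - 1 \<and> i - 1 < b)" "i - 1 \<noteq> a" using 5 calculation assms(1,3) by auto
    ultimately show ?thesis by (simp add: f_def)
  next
    case 6
    then have "f i = Suc i" using assms by (auto simp: f_def)
    moreover have "Suc i \<noteq> a" "Suc i \<noteq> b" "\<not> (a < Suc i \<and> Suc i < b)" using 6 assms by auto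
    ultimately show ?thesis using 6 by (simp add: f_def)
  qed (use assms in \<open>auto simp: f_def\<close>)
qed

text \<open>\<open>w\<close> runs once around an alternating cycle, beginning at its lowest vertex
  with an edge of \<open>x\<close>. \<open>D0\<close> is what was treated earlier; its
  characterisation by closure and minimality is symmetric in \<open>x\<close> and \<open>y\<close>,
  as needed for \<open>reverse\<close>.\<close>

locale cycle_step = matching_space A V for A V +
  fixes x y w :: "nat \<Rightarrow> nat" and L :: nat and D0 :: "nat set"
  assumes xK: "x \<in> K" and yK: "y \<in> K"
    and L: "even L" "4 \<le> L"
    and w_x: "\<And>r. r < L \<Longrightarrow> even r \<Longrightarrow> x (w r) = w (Suc r)"
    and w_y: "\<And>r. r < L \<Longrightarrow> odd r \<Longrightarrow> y (w r) = w (Suc r)"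
    and w_L: "w L = w 0"
    and w_inj: "inj_on w {..<L}"
    and w_V: "\<And>r. r \<le> L \<Longrightarrow> w r \<in> V"
    and w_D0: "\<And>r. r \<le> L \<Longrightarrow> w r \<notin> D0"
    and D0_x: "\<And>v. v \<in> D0 \<Longrightarrow> x v \<in> D0" and D0_y: "\<And>v. v \<in> D0 \<Longrightarrow> y v \<in> D0"
    and D0_low: "\<And>v. v < w 0 \<Longrightarrow> v \<in> D0"
    and D0_least: "\<And>S. (\<And>v. v < w 0 \<Longrightarrow> v \<in> S) \<Longrightarrow> (\<And>v. v \<in> S \<Longrightarrow> x v \<in> S) \<Longrightarrow>
      (\<And>v. v \<in> S \<Longrightarrow> y v \<in> S) \<Longrightarrow> D0 \<subseteq> S"
begin

abbreviation "cyc \<equiv> w ` {..L}"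

lemma w_eq_iff:
  assumes "i \<le> L" "j \<le> L"
  shows "w i = w j \<longleftrightarrow> i = j \<or> i = 0 \<and> j = L \<or> i = L \<and> j = 0"
proof -
  have "w i = w j \<longleftrightarrow> i = j" if "i < L" "j < L" for i j
    using inj_onD[OF w_inj] that by blast
  from this[of i j] this[of i 0] this[of 0 j] show ?thesis
    using assms w_L L(2) by (cases "i = L"; cases "j = L") auto
qed

lemma w_x_odd: "r < L \<Longrightarrow> odd r \<Longrightarrow> x (w r) = w (r - 1)"
  using w_x[of "r - 1"] KD(1)[OF xK] by (metis Suc_pred' even_Suc less_imp_diff_less odd_pos)

lemma w_y_even: "0 < r \<Longrightarrow> r \<le> L \<Longrightarrow> even r \<Longrightarrow> y (w r) = w (r - 1)"
  using w_y[of "r - 1"] KD(1)[OF yK]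
  by (metis Suc_pred' diff_less even_Suc less_le_trans less_one)

lemma w_parity: "r \<le> L \<Longrightarrow> even (w r) \<longleftrightarrow> (even (w 0) \<longleftrightarrow> even r)"
proof (induction r)
  case (Suc r)
  have "w (Suc r) = (if even r then x (w r) else y (w r))"
    using Suc.prems w_x w_y by simp
  then have "even (w (Suc r)) \<longleftrightarrow> odd (w r)" using KD(2)[OF xK] KD(2)[OF yK] by simp
  then show ?case using Suc by auto
qed simp

text \<open>The lowest vertex has the two positions 0 and \<open>L\<close>. Position 0 suits
  \<open>W\<close> and position \<open>L\<close> suits \<open>Z\<close>; this lemma and the next
  choose one of them.\<close>

lemma cyc_lt: assumes "v \<in> cyc" obtains i where "i < L" "v = w i"
proof -
  obtain i where i: "i \<le> L" "v = w i" using assms by auto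
  show thesis
  proof (cases "i = L")
    case True
    then show thesis using that[of 0] i w_L L by simp
  qed (use that[of i] i in simp)
qed

lemma cyc_pos: assumes "v \<in> cyc" obtains i where "0 < i" "i \<le> L" "v = w i"
proof -
  obtain i where i: "i \<le> L" "v = w i" using assms by auto
  show thesis
  proof (cases "i = 0")
    case True
    then show thesis using that[of L] i w_L L by simp
  qed (use that[of i] i in simp)
qed

lemma cyc_x: assumes "v \<in> cyc" shows "x v \<in> cyc"
proof -
  obtain i where i: "i < L" "v = w i" using assms by (rule cyc_lt)
  then have "x v = w (Suc i) \<or> x v = w (i - 1)" using w_x w_x_odd by blast
  then show ?thesis using i by auto
qed

lemma cyc_y: assumes "v \<in> cyc" shows "y v \<in> cyc"
proof -
  obtain i where i: "0 < i" "i \<le> L" "v = w i" using assms by (rule cyc_pos)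
  then have "i < L \<and> y v = w (Suc i) \<or> y v = w (i - 1)"
    using w_y w_y_even L by (metis le_neq_implies_less)
  then show ?thesis using i by auto
qed

lemma D0_x_iff: "x v \<in> D0 \<longleftrightarrow> v \<in> D0" and D0_y_iff: "y v \<in> D0 \<longleftrightarrow> v \<in> D0"
  using D0_x D0_y KD(1)[OF xK] KD(1)[OF yK] by metis+

lemma cyc_x_iff: "x v \<in> cyc \<longleftrightarrow> v \<in> cyc" and cyc_y_iff: "y v \<in> cyc \<longleftrightarrow> v \<in> cyc"
  using cyc_x cyc_y KD(1)[OF xK] KD(1)[OF yK] by metis+

text \<open>Read backwards, the cycle begins with an edge of \<open>y\<close>. With \<open>x\<close>
  and \<open>y\<close> exchanged the complement \<open>W\<close> becomes a matching of the form
  \<open>Z\<close>, so the facts about \<open>Z\<close> carry over to it.\<close>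

lemma reverse: "cycle_step A V y x (\<lambda>r. w (L - r)) L D0"
proof unfold_locales
  show "y \<in> K" "x \<in> K" "even L" "4 \<le> L" by (fact yK xK L)+
  show "y (w (L - r)) = w (L - Suc r)" if "r < L" "even r" for r
    using w_y_even[of "L - r"] that L by simp
  show "x (w (L - r)) = w (L - Suc r)" if "r < L" "odd r" for r
    using w_x_odd[of "L - r"] odd_pos[of r] that L by simp
  show "w (L - L) = w (L - 0)" using w_L by simp
  show "inj_on (\<lambda>r. w (L - r)) {..<L}"
    by (rule inj_onI) (use w_eq_iff in \<open>auto simp: less_imp_diff_less\<close>)
  show "w (L - r) \<in> V" for r using w_V by simp
  show "w (L - r) \<notin> D0" for r using w_D0 by simp
  show "v \<in> D0 \<Longrightarrow> y v \<in> D0" "v \<in> D0 \<Longrightarrow> x v \<in> D0" for v using D0_x D0_y by blast+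
  show "v < w (L - 0) \<Longrightarrow> v \<in> D0" for v using D0_low w_L by simp
  show "D0 \<subseteq> S" if "\<And>v. v < w (L - 0) \<Longrightarrow> v \<in> S" "\<And>v. v \<in> S \<Longrightarrow> y v \<in> S" "\<And>v. v \<in> S \<Longrightarrow> x v \<in> S" for S
    using D0_least[of S] that w_L by simp
qed

text \<open>
  The matching in which the part of the cycle between \<open>w a\<close> and \<open>w b\<close> that contains \<open>w 0\<close> is already
  switched from \<open>x\<close> to \<open>y\<close>, the edge from \<open>w a\<close> to \<open>w b\<close> filling the gap; \<open>W\<close> is the complement.
\<close>

definition Z :: "nat \<Rightarrow> nat \<Rightarrow> nat \<Rightarrow> nat" where
  "Z a b v = (if v = w a then w b else if v = w b then w a
    else if v \<in> w ` {a<..<b} then x v else if v \<in> D0 \<union> cyc then y v else x v)"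

definition W :: "nat \<Rightarrow> nat \<Rightarrow> nat \<Rightarrow> nat" where
  "W c d v = (if v = w c then w d else if v = w d then w c
    else if v \<in> w ` {c<..<d} then y v else if v \<in> D0 \<union> cyc then x v else y v)"

lemma Z_w:
  assumes "odd a" "even b" "a < b" "b \<le> L" "0 < i" "i \<le> L"
  shows "Z a b (w i) = w (if i = a then b else if i = b then a
    else if even i = (a < i \<and> i < b) then Suc i else i - 1)"
proof -
  have "0 < a" using assms(1) by (rule odd_pos)
  have "i \<noteq> L \<or> \<not> (a < i \<and> i < b)" using assms by simp
  have eq: "w i = w j \<longleftrightarrow> i = j" if "0 < j" "j \<le> L" for j
    using w_eq_iff[of i j] assms that by auto
  have mem: "w i \<in> w ` {a<..<b} \<longleftrightarrow> a < i \<and> i < b"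
    using assms eq by (auto simp: image_iff)
  consider "i = a" | "i = b" | "i \<noteq> a" "i \<noteq> b" "a < i \<and> i < b" | "i \<noteq> a" "i \<noteq> b" "\<not> (a < i \<and> i < b)"
    by blast
  then show ?thesis
  proof cases
    case 1
    then show ?thesis by (simp add: Z_def)
  next
    case 2
    then show ?thesis using \<open>a < b\<close> by (simp add: Z_def)
  next
    case 3
    then have "Z a b (w i) = x (w i)" using assms \<open>0 < a\<close> by (simp add: Z_def eq mem)
    moreover have "i < L" using 3 assms by simp
    ultimately show ?thesis using 3 w_x[of i] w_x_odd[of i] by simp
  next
    case 4
    have "w i \<notin> w ` {a<..<b}" using 4(3) mem by blast
    then have "Z a b (w i) = y (w i)" using 4(1,2) assms \<open>0 < a\<close> by (simp add: Z_def eq)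
    moreover have "i < L" if "odd i" using that assms L by (cases "i = L") simp_all
    ultimately show ?thesis using 4 w_y[of i] w_y_even[of i] assms by auto
  qed
qed

lemma Z_out:
  assumes "v \<notin> cyc" "a \<le> L" "b \<le> L"
  shows "Z a b v = (if v \<in> D0 then y v else x v)"
proof -
  have "v \<noteq> w a" "v \<noteq> w b" "v \<notin> w ` {a<..<b}" using assms by auto
  then show ?thesis using assms by (simp add: Z_def)
qed

lemma Z_in_K:
  assumes ab: "odd a" "even b" "a < b" "b \<le> L" and "A (w a) (w b)"
  shows "Z a b \<in> K"
proof -
  have "Z a b (Z a b v) = v \<and> even (Z a b v) \<noteq> even v \<and> A v (Z a b v)" for v
  proof (cases "v \<in> cyc")
    case True
    then obtain i where i: "0 < i" "i \<le> L" "v = w i" by (rule cyc_pos)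
    define j where "j = (if i = a then b else if i = b then a
      else if even i = (a < i \<and> i < b) then Suc i else i - 1)"
    have v: "Z a b v = w j" using Z_w[OF ab i(1,2)] i(3) by (simp add: j_def)
    have j: "0 < j" "j \<le> L" "even j \<noteq> even i"
      using ab i L odd_pos[OF ab(1)] by (auto simp: j_def le_less split: if_splits)
    have "i = (if j = a then b else if j = b then a
      else if even j = (a < j \<and> j < b) then Suc j else j - 1)"
      using ab i(1,2) unfolding j_def by (rule exchange_involution)
    then have "Z a b (w j) = w i" using Z_w[OF ab j(1,2)] by simp
    moreover have "even (w j) \<noteq> even (w i)"
      using w_parity[OF i(2)] w_parity[OF j(2)] j(3) by auto
    moreover have "A v (Z a b v)"
      using KD(3)[OF xK] KD(3)[OF yK] assms(5) A_sym by (auto simp: Z_def)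
    ultimately show ?thesis using v i(3) by simp
  next
    case False
    define f where "f = (if v \<in> D0 then y else x)"
    have f: "f \<in> K" by (simp add: f_def xK yK)
    have v: "Z a b v = f v" using Z_out[OF False] ab by (simp add: f_def)
    have "f v \<notin> cyc" using False cyc_x_iff cyc_y_iff by (simp add: f_def)
    moreover have "f v \<in> D0 \<longleftrightarrow> v \<in> D0" using D0_x_iff D0_y_iff by (simp add: f_def)
    ultimately have "Z a b (f v) = f (f v)" using Z_out[of "f v" a b] ab by (simp add: f_def)
    then show ?thesis using v KD[OF f] by simp
  qed
  then show ?thesis by (simp add: K_def)
qed

lemma W_eq_reverse_Z:
  assumes "c < d" "d < L"
  shows "W c d = cycle_step.Z y x (\<lambda>r. w (L - r)) L D0 (L - d) (L - c)"
proof
  fix v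
  interpret rev: cycle_step A V y x "\<lambda>r. w (L - r)" L D0 by (rule reverse)
  have "(\<lambda>r. w (L - r)) ` {L - d<..<L - c} = w ` ((\<lambda>r. L - r) ` {L - d<..<L - c})"
    by (simp add: image_image)
  also have "(\<lambda>r. L - r) ` {L - d<..<L - c} = {c<..<d}"
  proof (intro equalityI subsetI)
    fix r assume "r \<in> {c<..<d}"
    then have "r = L - (L - r)" "L - r \<in> {L - d<..<L - c}" using assms by auto
    then show "r \<in> (\<lambda>r. L - r) ` {L - d<..<L - c}" by (rule image_eqI)
  qed (use assms in auto)
  finally have 1: "(\<lambda>r. w (L - r)) ` {L - d<..<L - c} = w ` {c<..<d}" .
  have "(\<lambda>r. w (L - r)) ` {..L} = w ` ((\<lambda>r. L - r) ` {..L})" by (simp add: image_image)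
  also have "(\<lambda>r. L - r) ` {..L} = {..L}"
  proof (intro equalityI subsetI)
    fix r assume "r \<in> {..L}"
    then have "r = L - (L - r)" "L - r \<in> {..L}" by auto
    then show "r \<in> (\<lambda>r. L - r) ` {..L}" by (rule image_eqI)
  qed auto
  finally have 2: "(\<lambda>r. w (L - r)) ` {..L} = cyc" .
  have "w c \<noteq> w d" using w_eq_iff[of c d] assms by auto
  then show "W c d v = rev.Z (L - d) (L - c) v"
    using assms by (simp add: W_def rev.Z_def 1 2)
qed

lemma W_in_K:
  assumes "even c" "odd d" "c < d" "d < L" "A (w c) (w d)"
  shows "W c d \<in> K"
proof -
  interpret rev: cycle_step A V y x "\<lambda>r. w (L - r)" L D0 by (rule reverse)
  show ?thesis
    unfolding W_eq_reverse_Z[OF assms(3,4)]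
    by (rule rev.Z_in_K) (use assms L A_sym in auto)
qed

lemma W_w:
  assumes "even c" "odd d" "c < d" "d < L" "i < L"
  shows "W c d (w i) = w (if i = c then d else if i = d then c
    else if odd i = (c < i \<and> i < d) then Suc i else i - 1)"
proof -
  interpret rev: cycle_step A V y x "\<lambda>r. w (L - r)" L D0 by (rule reverse)
  have "W c d (w (L - (L - i))) = w (L - (if L - i = L - d then L - c else if L - i = L - c then L - d
    else if even (L - i) = (L - d < L - i \<and> L - i < L - c) then Suc (L - i) else L - i - 1))"
    unfolding W_eq_reverse_Z[OF assms(3,4)]
    by (rule rev.Z_w) (use assms L in auto)
  also have "(L - (if L - i = L - d then L - c else if L - i = L - c then L - d
    else if even (L - i) = (L - d < L - i \<and> L - i < L - c) then Suc (L - i) else L - i - 1)) =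
    (if i = c then d else if i = d then c
    else if odd i = (c < i \<and> i < d) then Suc i else i - 1)"
  proof -
    consider "i = c" | "i = d" | "i \<noteq> c" "i \<noteq> d" by blast
    then show ?thesis
    proof cases
      case 3
      have "even (L - i) \<longleftrightarrow> even i" using assms L by simp
      moreover have "L - d < L - i \<longleftrightarrow> i < d" "L - i < L - c \<longleftrightarrow> c < i" "L - i \<noteq> L - c" "L - i \<noteq> L - d"
        using 3 assms by auto
      ultimately show ?thesis using assms 3 by auto
    qed (use assms in auto)
  qed
  finally show ?thesis using assms by simp
qed

lemma W_out:
  assumes "v \<notin> cyc" "c \<le> L" "d \<le> L"
  shows "W c d v = (if v \<in> D0 then x v else y v)"
proof -
  have "v \<noteq> w c" "v \<noteq> w d" "v \<notin> w ` {c<..<d}" using assms by auto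
  then show ?thesis using assms by (simp add: W_def)
qed

end

section \<open>Recovering \<open>x\<close> and \<open>y\<close> from a climbing state and its
  complement\<close>

text \<open>The conditional is \<open>decode\<close> with \<open>D\<close>, \<open>Z\<close> and
  \<open>W\<close> replaced by their action on positions; the right-hand side is the step along
  \<open>x\<close>. The four cases are the orders of \<open>a\<close>, \<open>c\<close> and of
  \<open>b\<close>, \<open>d\<close>.\<close>

lemma link_index_x:
  fixes a b c d i :: nat
  assumes "odd a" "even b" "even c" "odd d" "a = Suc c \<or> c = Suc a" "b = Suc d \<or> d = Suc b"
   "a < b" "a \<le> d" "c \<le> b" "c < d"
  shows "(if b < d \<and> i = b then d else if b < d \<and> i = d then b else if c < a \<and> i = c then a
    else if c < a \<and> i = a then c else if i \<le> min a c \<or> max b d \<le> i then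
    (if i = c then d else if i = d then c else if odd i = (c < i \<and> i < d) then Suc i else i - 1)
    else (if i = a then b else if i = b then a else if even i = (a < i \<and> i < b) then Suc i else i - 1)) =
    (if even i then Suc i else i - 1)"
  using assms by (elim disjE) (cases "even i"; simp; presburger)+

lemma link_index_y:
  fixes a b c d i :: nat
  assumes "odd a" "even b" "even c" "odd d" "a = Suc c \<or> c = Suc a" "b = Suc d \<or> d = Suc b"
   "a < b" "a \<le> d" "c \<le> b" "c < d"
  shows "(if \<not> c < a \<and> i = c then a else if \<not> c < a \<and> i = a then c else if \<not> b < d \<and> i = b then d
    else if \<not> b < d \<and> i = d then b else if i \<le> min a c \<or> max b d \<le> i then
    (if i = a then b else if i = b then a else if even i = (a < i \<and> i < b) then Suc i else i - 1)
    else (if i = c then d else if i = d then c else if odd i = (c < i \<and> i < d) then Suc i else i - 1)) =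
    (if odd i then Suc i else i - 1)"
  using assms by (elim disjE) (cases "even i"; simp; presburger)+

text \<open>A boundary position of the treated part other than \<open>a\<close> and \<open>b\<close>
  is \<open>c\<close> or \<open>d\<close>, and there the parity makes the step along
  \<open>y\<close> lead back into the treated part.\<close>

lemma link_index_closed_y:
  fixes a b c d i L :: nat
  assumes "odd a" "even b" "even c" "odd d" "even L" "a = Suc c \<or> c = Suc a" "b = Suc d \<or> d = Suc b"
    "a < b" "c < d" "b \<le> L" "d \<le> L" "0 < i" "i \<le> L" "i \<le> min a c \<or> max b d \<le> i" "i \<noteq> a" "i \<noteq> b"
  shows "(if even i then i - 1 else Suc i) \<le> min a c \<or>
    max b d \<le> (if even i then i - 1 else Suc i) \<and> (if even i then i - 1 else Suc i) \<le> L"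
proof (cases "even i")
  case True
  then have "i \<noteq> max b d" using assms(1-4,15,16) by (auto simp: max_def)
  then show ?thesis using True assms(13,14) by auto
next
  case False
  then have "i \<noteq> min a c" "i \<noteq> L" using assms(1-5,13,15,16) by (auto simp: min_def)
  then show ?thesis using False assms(13,14) by auto
qed

lemma link_index_closed_x:
  fixes a b c d i L :: nat
  assumes "odd a" "even b" "even c" "odd d" "even L" "a = Suc c \<or> c = Suc a" "b = Suc d \<or> d = Suc b"
    "a < b" "c < d" "b \<le> L" "d \<le> L" "0 < i" "i < L" "i \<le> min a c \<or> max b d \<le> i" "i \<noteq> c" "i \<noteq> d"
  shows "(if odd i then i - 1 else Suc i) \<le> min a c \<or>
    max b d \<le> (if odd i then i - 1 else Suc i) \<and> (if odd i then i - 1 else Suc i) \<le> L"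
proof (cases "odd i")
  case True
  then have "i \<noteq> max b d" using assms(1-4,15,16) by (auto simp: max_def)
  then show ?thesis using True assms(13,14) by auto
next
  case False
  then have "i \<noteq> min a c" "i \<noteq> L" using assms(1-5,13,15,16) by (auto simp: min_def)
  then show ?thesis using False assms(13,14) by auto
qed

text \<open>
  A state of the mountain climbing: the walker that started along \<open>x\<close> is on the edge \<open>{w a, w c}\<close>, the
  other one on \<open>{w b, w d}\<close>.
\<close>

locale cycle_link = cycle_step +
  fixes a b c d :: nat
  assumes parity: "odd a" "even b" "even c" "odd d"
    and ac: "a = Suc c \<or> c = Suc a" and bd: "b = Suc d \<or> d = Suc b"
    and le: "a \<le> b" "a \<le> d" "c \<le> b" "c \<le> d" and bL: "b \<le> L" and dL: "d \<le> L"
begin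

lemma bounds: "0 < a" "a < b" "c < d" "d < L"
proof -
  show "0 < a" using parity(1) by (rule odd_pos)
  show "a < b" using le(1) parity by (metis le_neq_implies_less)
  show "c < d" using le(4) parity by (metis le_neq_implies_less)
  have "d \<noteq> L" using parity(4) L(1) by blast
  then show "d < L" using dL by simp
qed

definition D :: "nat set" where
  "D = D0 \<union> w ` ({..min a c} \<union> {max b d..L})"

lemma w_eq: "0 < i \<Longrightarrow> i < L \<Longrightarrow> j \<le> L \<Longrightarrow> w i = w j \<longleftrightarrow> i = j"
  using w_eq_iff[of i j] by auto

lemma w_in_D: assumes "0 < i" "i < L" shows "w i \<in> D \<longleftrightarrow> i \<le> min a c \<or> max b d \<le> i"
proof
  assume "w i \<in> D"
  then obtain j where j: "w i = w j" "j \<le> min a c \<or> max b d \<le> j" "j \<le> L"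
    using w_D0[of i] assms le bounds by (auto simp: D_def)
  then show "i \<le> min a c \<or> max b d \<le> i" using w_eq assms by metis
qed (use assms in \<open>auto simp: D_def\<close>)

lemma D_out: "v \<notin> cyc \<Longrightarrow> v \<in> D \<longleftrightarrow> v \<in> D0"
  using le bounds bL by (auto simp: D_def)

lemma w0_in_D: "w 0 \<in> D"
  by (auto simp: D_def)

lemma Z_wb: "Z a b (w b) = w a" and W_wc: "W c d (w c) = w d"
proof -
  show "Z a b (w b) = w a"
    using Z_w[OF parity(1,2) bounds(2) bL, of b] bounds bL by simp
  show "W c d (w c) = w d"
    using W_w[OF parity(3,4) bounds(3,4), of c] bounds by simp
qed

lemma Z_w0: "Z a b (w 0) = (if b = L then w a else w (L - 1))"
  using Z_w[OF parity(1,2) bounds(2) bL, of L] bounds bL L w_L by auto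

lemma W_w0: "W c d (w 0) = (if c = 0 then w d else w 1)"
  using W_w[OF parity(3,4) bounds(3,4), of 0] bounds by auto

lemma w0_eq: "j \<le> L \<Longrightarrow> w 0 = w j \<longleftrightarrow> j = 0 \<or> j = L"
  using w_eq_iff[of 0 j] L by auto

text \<open>A step up from an even position is an edge of \<open>x\<close>. As \<open>b\<close> and
  \<open>c\<close> are even, \<open>{w b, w d}\<close> belongs to \<open>x\<close> iff
  \<open>b < d\<close>, and \<open>{w c, w a}\<close> iff \<open>c < a\<close>; these are the two
  bits.\<close>

lemma decode_x: "x = decode (b < d) (c < a) D (w b) (w c) (Z a b) (W c d)"
proof
  fix v
  show "x v = decode (b < d) (c < a) D (w b) (w c) (Z a b) (W c d) v"
  proof (cases "v \<in> cyc")
    case False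
    then have "v \<noteq> w a" "v \<noteq> w b" "v \<noteq> w c" "v \<noteq> w d" using bounds bL by auto
    then show ?thesis
      using False bounds bL by (simp add: decode_def Z_wb W_wc D_out Z_out W_out)
  next
    case True
    then obtain i where i: "i < L" "v = w i" by (rule cyc_lt)
    show ?thesis
    proof (cases "i = 0")
      case True
      \<comment> \<open>Position 0 is separate because \<open>Z_w\<close> describes this vertex at
        position \<open>L\<close>, while \<open>W_w\<close> describes it at position 0.\<close>
      have "x (w 0) = w 1" using w_x[of 0] L by simp
      moreover have "c = 0 \<Longrightarrow> w a = w 1" "c = 0 \<Longrightarrow> c < a" "b = L \<Longrightarrow> \<not> b < d" using ac bounds by auto
      ultimately show ?thesis
        using bounds bL True parity L by (simp add: i decode_def Z_wb W_wc w0_in_D w0_eq W_w0)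
    next
      case False
      then have 0: "0 < i" by simp
      have "decode (b < d) (c < a) D (w b) (w c) (Z a b) (W c d) (w i) =
          w (if b < d \<and> i = b then d else if b < d \<and> i = d then b else if c < a \<and> i = c then a
            else if c < a \<and> i = a then c else if i \<le> min a c \<or> max b d \<le> i then
            (if i = c then d else if i = d then c else if odd i = (c < i \<and> i < d) then Suc i else i - 1)
            else (if i = a then b else if i = b then a else if even i = (a < i \<and> i < b) then Suc i else i - 1))"
        unfolding decode_def Z_wb W_wc w_in_D[OF 0 i(1)]
          Z_w[OF parity(1,2) bounds(2) bL 0 less_imp_le[OF i(1)]] W_w[OF parity(3,4) bounds(3,4) i(1)]
          w_eq[OF 0 i(1) bL] w_eq[OF 0 i(1) dL] w_eq[OF 0 i(1) order_trans[OF le(1) bL]]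
          w_eq[OF 0 i(1) order_trans[OF le(3) bL]]
        by (simp only: if_distrib[of w])
      also have "\<dots> = w (if even i then Suc i else i - 1)"
        by (rule arg_cong[where f = w], rule link_index_x[OF parity(1,2,3,4) ac bd bounds(2) le(2,3) bounds(3)])
      also have "\<dots> = x (w i)" using w_x[OF i(1)] w_x_odd[OF i(1)] by simp
      finally show ?thesis using i by simp
    qed
  qed
qed

lemma decode_y: "y = decode (\<not> c < a) (\<not> b < d) D (w c) (w b) (W c d) (Z a b)"
proof
  fix v
  show "y v = decode (\<not> c < a) (\<not> b < d) D (w c) (w b) (W c d) (Z a b) v"
  proof (cases "v \<in> cyc")
    case False
    then have "v \<noteq> w a" "v \<noteq> w b" "v \<noteq> w c" "v \<noteq> w d" using bounds bL by auto
    then show ?thesis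
      using False bounds bL by (simp add: decode_def Z_wb W_wc D_out Z_out W_out)
  next
    case True
    then obtain i where i: "i < L" "v = w i" by (rule cyc_lt)
    show ?thesis
    proof (cases "i = 0")
      case True
      have "y (w 0) = w (L - 1)" using w_y_even[of L] w_L L by simp
      moreover have "c = 0 \<Longrightarrow> c < a" "b = L \<Longrightarrow> w d = w (L - 1)" "b = L \<Longrightarrow> \<not> b < d" using bd bounds by auto
      ultimately show ?thesis
        using bounds bL True parity L by (simp add: i decode_def Z_wb W_wc w0_in_D w0_eq Z_w0)
    next
      case False
      then have 0: "0 < i" by simp
      have "decode (\<not> c < a) (\<not> b < d) D (w c) (w b) (W c d) (Z a b) (w i) =
          w (if \<not> c < a \<and> i = c then a else if \<not> c < a \<and> i = a then c else if \<not> b < d \<and> i = b then d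
            else if \<not> b < d \<and> i = d then b else if i \<le> min a c \<or> max b d \<le> i then
            (if i = a then b else if i = b then a else if even i = (a < i \<and> i < b) then Suc i else i - 1)
            else (if i = c then d else if i = d then c else if odd i = (c < i \<and> i < d) then Suc i else i - 1))"
        unfolding decode_def Z_wb W_wc w_in_D[OF 0 i(1)]
          Z_w[OF parity(1,2) bounds(2) bL 0 less_imp_le[OF i(1)]] W_w[OF parity(3,4) bounds(3,4) i(1)]
          w_eq[OF 0 i(1) bL] w_eq[OF 0 i(1) dL] w_eq[OF 0 i(1) order_trans[OF le(1) bL]]
          w_eq[OF 0 i(1) order_trans[OF le(3) bL]]
        by (simp only: if_distrib[of w])
      also have "\<dots> = w (if odd i then Suc i else i - 1)"
        by (rule arg_cong[where f = w], rule link_index_y[OF parity(1,2,3,4) ac bd bounds(2) le(2,3) bounds(3)])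
      also have "\<dots> = y (w i)" using w_y[OF i(1)] w_y_even[OF 0 less_imp_le[OF i(1)]] by simp
      finally show ?thesis using i by simp
    qed
  qed
qed

abbreviation "link_conn \<equiv> conn (Z a b) (W c d) (w b) (w c)"

text \<open>The edges of \<open>W\<close> and \<open>Z\<close> alternate along this side of the
  cycle, and the deleted ones end in \<open>a\<close>, \<open>b\<close>, \<open>c\<close> and
  \<open>d\<close> only, so none is met before the walker.\<close>

lemma conn_up: "i \<le> min a c \<Longrightarrow> link_conn (w 0) (w i)"
proof (induction i)
  case 0
  show ?case by (rule conn.base)
next
  case (Suc i)
  then have i: "i < a" "i < c" "link_conn (w 0) (w i)" by simp_all
  have iL: "i < L" using i bounds by simp
  show ?case
  proof (cases "even i")
    case True
    have "w i \<noteq> w c" "w i \<noteq> W c d (w c)"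
      using i iL bounds w_eq_iff[of i c] w_eq_iff[of i d] by (simp_all add: W_wc)
    with i(3) have "link_conn (w 0) (W c d (w i))" by (rule conn.step_w)
    moreover have "W c d (w i) = w (Suc i)"
      using W_w[OF parity(3,4) bounds(3,4) iL] i True bounds by simp
    ultimately show ?thesis by simp
  next
    case False
    then have 0: "0 < i" by (rule odd_pos)
    have "w i \<noteq> w b" "w i \<noteq> Z a b (w b)"
      using i iL 0 bounds bL w_eq[of i b] w_eq[of i a] by (simp_all add: Z_wb)
    with i(3) have "link_conn (w 0) (Z a b (w i))" by (rule conn.step_z)
    moreover have "Z a b (w i) = w (Suc i)"
      using Z_w[OF parity(1,2) bounds(2) bL 0] iL i False bounds by simp
    ultimately show ?thesis by simp
  qed
qed

lemma conn_down: "i \<le> L - max b d \<Longrightarrow> link_conn (w 0) (w (L - i))"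
proof (induction i)
  case 0
  show ?case by (simp add: w_L conn.base)
next
  case (Suc i)
  define j where "j = L - i"
  have j: "b < j" "d < j" "j \<le> L" "link_conn (w 0) (w j)" "L - Suc i = j - 1" "0 < j"
    using Suc bounds by (simp_all add: j_def)
  show ?case
  proof (cases "even j")
    case True
    have "w j \<noteq> w b" "w j \<noteq> Z a b (w b)"
      using j bounds bL w_eq_iff[of j b] w_eq_iff[of j a] by (simp_all add: Z_wb)
    with j(4) have "link_conn (w 0) (Z a b (w j))" by (rule conn.step_z)
    moreover have "Z a b (w j) = w (j - 1)"
      using Z_w[OF parity(1,2) bounds(2) bL j(6) j(3)] j True bounds by simp
    ultimately show ?thesis using j by simp
  next
    case False
    then have "j \<noteq> L" using L by blast
    then have jL: "j < L" using j by simp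
    have "w j \<noteq> w c" "w j \<noteq> W c d (w c)"
      using j jL bounds w_eq[of j c] w_eq[of j d] by (simp_all add: W_wc)
    with j(4) have "link_conn (w 0) (W c d (w j))" by (rule conn.step_w)
    moreover have "W c d (w j) = w (j - 1)"
      using W_w[OF parity(3,4) bounds(3,4) jL] j False bounds by simp
    ultimately show ?thesis using j by simp
  qed
qed

lemma conn_far: "max b d \<le> i \<Longrightarrow> i \<le> L \<Longrightarrow> link_conn (w 0) (w i)"
  using conn_down[OF diff_le_mono2] by (metis diff_diff_cancel)

lemma D_cases:
  assumes "v \<in> D"
  obtains "v \<in> D0" | i where "v = w i" "0 < i" "i \<le> min a c \<or> max b d \<le> i" "i \<le> L"
proof -
  consider "v \<in> D0" | i where "v = w i" "i \<le> min a c" | i where "v = w i" "max b d \<le> i" "i \<le> L"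
    using assms by (auto simp: D_def)
  then show thesis
  proof cases
    case 1
    then show thesis by (rule that(1))
  next
    case 2
    show thesis
    proof (cases "i = 0")
      case True
      show thesis by (rule that(2)[of L]) (use 2 True w_L L bL dL in auto)
    next
      case False
      show thesis by (rule that(2)[of i]) (use 2 False bounds in auto)
    qed
  next
    case 3
    show thesis by (rule that(2)[of i]) (use 3 bounds in auto)
  qed
qed

lemma Z_D_closed: assumes "v \<in> D" "v \<noteq> w b" "v \<noteq> w a" shows "Z a b v \<in> D"
  using assms(1)
proof (cases rule: D_cases)
  case 1
  then have "v \<notin> cyc" using w_D0 by auto
  then show ?thesis using 1 Z_out[of v a b] bounds bL D0_y by (simp add: D_def)
next
  case (2 i)
  then have "i \<noteq> a" "i \<noteq> b" using assms by auto
  then have "Z a b v = w (if even i then i - 1 else Suc i)"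
    using Z_w[OF parity(1,2) bounds(2) bL 2(2,4)] 2(1,3) by auto
  moreover have "(if even i then i - 1 else Suc i) \<in> {..min a c} \<union> {max b d..L}"
    using link_index_closed_y[OF parity L(1) ac bd bounds(2,3) bL dL 2(2,4,3) \<open>i \<noteq> a\<close> \<open>i \<noteq> b\<close>]
    by (simp only: Un_iff atMost_iff atLeastAtMost_iff)
  ultimately show ?thesis unfolding D_def by auto
qed

lemma W_D_closed: assumes "v \<in> D" "v \<noteq> w c" "v \<noteq> w d" shows "W c d v \<in> D"
  using assms(1)
proof (cases rule: D_cases)
  case 1
  then have "v \<notin> cyc" using w_D0 by auto
  then show ?thesis using 1 W_out[of v c d] bounds bL D0_x by (simp add: D_def)
next
  case (2 i)
  show ?thesis
  proof (cases "i = L")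
    case True
    then have "c \<noteq> 0" using 2(1) assms(2) w_L by metis
    then have "W c d v = w 1" using W_w0 2 True w_L by simp
    then show ?thesis using \<open>c \<noteq> 0\<close> bounds by (auto simp: D_def)
  next
    case False
    then have "i < L" using 2 by simp
    have "i \<noteq> c" "i \<noteq> d" using 2 assms by auto
    then have "W c d v = w (if odd i then i - 1 else Suc i)"
      using W_w[OF parity(3,4) bounds(3,4) \<open>i < L\<close>] 2(1,3) by auto
    moreover have "(if odd i then i - 1 else Suc i) \<in> {..min a c} \<union> {max b d..L}"
      using link_index_closed_x[OF parity L(1) ac bd bounds(2,3) bL dL 2(2) \<open>i < L\<close> 2(3) \<open>i \<noteq> c\<close> \<open>i \<noteq> d\<close>]
      by (simp only: Un_iff atMost_iff atLeastAtMost_iff)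
    ultimately show ?thesis unfolding D_def by auto
  qed
qed

text \<open>On the earlier part \<open>Z\<close> is \<open>y\<close> and \<open>W\<close> is
  \<open>x\<close>, so the minimality of \<open>D0\<close> joins each of its vertices to one that is
  at most \<open>w 0\<close>. Conversely, \<open>D\<close> can be left only through the deleted
  edges.\<close>

lemma D_eq: "D = {v. \<exists>r\<le>w 0. link_conn r v}"
proof (intro equalityI subsetI)
  fix v assume "v \<in> {v. \<exists>r\<le>w 0. link_conn r v}"
  then obtain r where r: "r \<le> w 0" "link_conn r v" by blast
  from r(2,1) show "v \<in> D"
  proof induction
    case (base v)
    then show ?case using D0_low w0_in_D by (cases "v = w 0") (auto simp: D_def)
  next
    case (step_z r v)
    then show ?case using Z_D_closed Z_wb by metis
  next
    case (step_w r v)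
    then show ?case using W_D_closed W_wc by metis
  qed
next
  fix v assume "v \<in> D"
  then show "v \<in> {v. \<exists>r\<le>w 0. link_conn r v}"
  proof (cases rule: D_cases)
    case 1
    define S where "S = {v \<in> D0. \<exists>r\<le>w 0. link_conn r v}"
    have "D0 \<subseteq> S"
    proof (rule D0_least)
      show "v \<in> S" if "v < w 0" for v
        using that D0_low conn.base by (auto simp: S_def intro!: exI[of _ v])
    next
      fix v assume v: "v \<in> S"
      then obtain r where r: "r \<le> w 0" "link_conn r v" "v \<in> D0" by (auto simp: S_def)
      have ne: "v \<noteq> w i" if "i \<le> L" for i using r(3) w_D0 that by auto
      then have "v \<notin> cyc" by auto
      have "link_conn r (W c d v)"
        using r(2) by (rule conn.step_w) (use ne bounds in \<open>simp_all add: W_wc\<close>)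
      then show "x v \<in> S" using W_out[OF \<open>v \<notin> cyc\<close>] bounds r D0_x by (auto simp: S_def)
      have "link_conn r (Z a b v)"
        using r(2) by (rule conn.step_z) (use ne bounds bL in \<open>simp_all add: Z_wb\<close>)
      then show "y v \<in> S" using Z_out[OF \<open>v \<notin> cyc\<close>] bounds bL r D0_y by (auto simp: S_def)
    qed
    then show ?thesis using 1 by (auto simp: S_def)
  next
    case (2 i)
    then have "link_conn (w 0) v" using conn_up conn_far by blast
    then show ?thesis by blast
  qed
qed

lemma link_conn_ge: "link_conn (w 0) v \<Longrightarrow> w 0 \<le> v"
proof -
  assume "link_conn (w 0) v"
  then have "v \<in> cyc"
  proof (induction "w 0" v)
    case base
    show ?case by simp
  next
    case (step_z v)
    have "w a \<in> cyc" "w b \<in> cyc" using bounds bL by auto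
    then show ?case using cyc_x cyc_y step_z by (auto simp: Z_def)
  next
    case (step_w v)
    have "w c \<in> cyc" "w d \<in> cyc" using bounds by auto
    then show ?case using cyc_x cyc_y step_w by (auto simp: W_def)
  qed
  then have "v \<notin> D0" using w_D0 by auto
  then show "w 0 \<le> v" using D0_low not_less by blast
qed

text \<open>The end of a walker's edge nearer to the start, at \<open>min a c\<close> or
  \<open>max b d\<close>, is joined to \<open>w 0\<close>; the far end is untreated. Which of the
  two is the even position varies, hence the disjunctions in \<open>code\<close>.\<close>

lemma link_code: "code x y (Z a b) (W c d) (w b) (w c) (b < d) (c < a)"
proof -
  have "w (max a c) \<notin> D" "w (min b d) \<notin> D"
    using w_in_D[of "max a c"] w_in_D[of "min b d"] ac bd bounds le by auto
  moreover have "link_conn (w 0) (w (min a c))" "link_conn (w 0) (w (max b d))"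
    using conn_up conn_far bL dL by auto
  ultimately have
    "link_conn (w 0) (w b) \<and> w d \<notin> D \<or> link_conn (w 0) (w d) \<and> w b \<notin> D"
    "link_conn (w 0) (w c) \<and> w a \<notin> D \<or> link_conn (w 0) (w a) \<and> w c \<notin> D"
    using ac bd by (auto simp: max_def min_def)
  moreover have "w b \<noteq> w c \<and> w a \<noteq> w d" if "(b < d) = (c < a)"
    using that ac bd le bounds bL w_eq_iff[of b c] w_eq_iff[of a d] by auto
  ultimately show ?thesis
    unfolding code_def Z_wb W_wc using decode_x decode_y D_eq link_conn_ge
    by (intro exI[of _ D] exI[of _ "w 0"] conjI) blast+
qed

lemma link_main:
  assumes "A (w a) (w b)" "A (w c) (w d)"
  shows "main x y (Z a b)"
proof -
  have K: "Z a b \<in> K" "W c d \<in> K"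
    using Z_in_K[OF parity(1,2) bounds(2) bL] W_in_K[OF parity(3,4) bounds(3,4)] assms by auto
  have par: "even (w b) = even (w 0)" "even (w c) = even (w 0)" "even (w a) = odd (w 0)" "even (w d) = odd (w 0)"
    using w_parity[of a] w_parity[of b] w_parity[of c] w_parity[of d] parity bounds bL by auto
  have V: "w a \<in> V" "w b \<in> V" "w c \<in> V" "w d \<in> V" using w_V bounds bL by auto
  show ?thesis
  proof (cases "even (w 0)")
    case True
    then show ?thesis
      unfolding main_def using link_code K V par by blast
  next
    case False
    \<comment> \<open>\<open>w b\<close> and \<open>w c\<close> have the parity of
      \<open>w 0\<close>, so here the even ends of the extra edges are \<open>w a\<close> and
      \<open>w d\<close>.\<close>
    have "code x y (Z a b) (W c d) (w a) (w d) (c < a) (b < d)"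
      using code_flip[OF K _ link_code] par by (simp add: Z_wb W_wc)
    then show ?thesis
      unfolding main_def using False K V par by blast
  qed
qed

end

section \<open>Paths of switches along the climb\<close>

definition (in matching_space) path_step where
  "path_step x y z z' \<longleftrightarrow> z \<in> K \<and> z' \<in> K \<and> adj z z' \<and> (main x y z \<or> main x y z')"

lemma (in matching_space) adjI:
  assumes "\<And>v. v \<notin> {p, p', q, q'} \<Longrightarrow> f v = g v" "even p = even p'" "even q = even q'" "even p \<noteq> even q"
  shows "adj f g"
proof (cases "even p")
  case True
  have "f v = g v" if "even v" "v \<notin> {p, p'}" for v
    using assms(1)[of v] that True assms(3,4) by blast
  then show ?thesis unfolding adj_def by blast
next
  case False
  have "f v = g v" if "even v" "v \<notin> {q, q'}" for v
    using assms(1)[of v] that False assms(2) by blast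
  then show ?thesis unfolding adj_def by blast
qed

context cycle_step
begin

text \<open>In cell \<open>(s, t)\<close> the walkers are on the edges between the positions
  \<open>s\<close>, \<open>Suc s\<close> and between \<open>L - Suc t\<close>, \<open>L - t\<close>.
  The ends are sorted by parity: \<open>ai\<close> and \<open>di\<close> are odd, \<open>bi\<close>
  and \<open>ci\<close> are even.\<close>

definition ai where "ai s = (if even s then Suc s else s)" for s :: nat
definition ci where "ci s = (if even s then s else Suc s)" for s :: nat
definition bi where "bi t = (if even t then L - t else L - Suc t)"
definition di where "di t = (if even t then L - Suc t else L - t)"

lemma ai_le: "s < T \<Longrightarrow> ai s \<le> T"
  by (simp add: ai_def)

lemma bi_ge: "t < L - T \<Longrightarrow> T \<le> bi t"
  unfolding bi_def by (cases "even t"; simp; linarith)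

lemma link:
  assumes "s < T" "T < L" "t < L - T"
  shows "cycle_link A V x y w L D0 (ai s) (bi t) (ci s) (di t)"
proof unfold_locales
  have "L - t \<ge> Suc T" using assms by simp
  then show "odd (ai s)" "even (bi t)" "even (ci s)" "odd (di t)"
    "ai s = Suc (ci s) \<or> ci s = Suc (ai s)" "bi t = Suc (di t) \<or> di t = Suc (bi t)"
    "ai s \<le> bi t" "ai s \<le> di t" "ci s \<le> bi t" "ci s \<le> di t" "bi t \<le> L" "di t \<le> L"
    using assms L by (auto simp: ai_def bi_def ci_def di_def)
qed

lemma A_edge: "r < L \<Longrightarrow> A (w r) (w (Suc r))"
  using w_x[of r] w_y[of r] KD(3)[OF xK, of "w r"] KD(3)[OF yK, of "w r"] by (cases "even r") simp_all

lemma between_commute: "between p r q \<longleftrightarrow> between q r p"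
  by (auto simp: between_def)

lemma shrink_w:
  assumes "A (w i) (w j)" "i \<le> L" "j \<le> L" "r \<le> L" "even r = even j" "between (w i) (w r) (w j)"
  shows "A (w i) (w r)"
proof (rule shrink[OF assms(1) _ assms(6)])
  show "even (w r) = even (w j)"
    using w_parity[OF assms(3)] w_parity[OF assms(4)] assms(5) by blast
qed

text \<open>The vertex \<open>w (Suc s)\<close> passed over lies on the walker's edge before and
  after the hop, so it is the end that is kept. Shrinking the other walker's edge to it gives the
  gap edge of the matching if \<open>Suc s\<close> is odd, and that of the complement if it is
  even.\<close>

lemma hop_first:
  assumes "Suc s < T" "T < L" "t < L - T" "between (w (L - t)) (w (Suc s)) (w (L - Suc t))"
  shows "ai (Suc s) = ai s \<and> A (w (ai s)) (w (bi t)) \<or> ci (Suc s) = ci s \<and> A (w (ci s)) (w (di t))"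
proof -
  interpret cycle_link A V x y w L D0 "ai s" "bi t" "ci s" "di t"
    by (rule link) (use assms in auto)
  have bd: "A (w (bi t)) (w (di t))" "A (w (di t)) (w (bi t))"
    using bd A_edge[of "di t"] A_edge[of "bi t"] bounds dL A_sym by auto
  have bet: "between (w (bi t)) (w (Suc s)) (w (di t))" "between (w (di t)) (w (Suc s)) (w (bi t))"
    using assms(4) between_commute by (auto simp: bi_def di_def)
  show ?thesis
  proof (cases "even s")
    case True
    then have "A (w (bi t)) (w (ai s))"
      using bd(1) bet(1) assms parity bL dL by (intro shrink_w[OF bd(1)]) (auto simp: ai_def)
    then show ?thesis using True A_sym by (auto simp: ai_def)
  next
    case False
    then have "A (w (di t)) (w (ci s))"
      using bd(2) bet(2) assms parity bL dL by (intro shrink_w[OF bd(2)]) (auto simp: ci_def)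
    then show ?thesis using False A_sym by (auto simp: ci_def)
  qed
qed

lemma hop_second:
  assumes "s < T" "T < L" "Suc t < L - T" "between (w s) (w (L - Suc t)) (w (Suc s))"
  shows "bi (Suc t) = bi t \<and> A (w (ai s)) (w (bi t)) \<or> di (Suc t) = di t \<and> A (w (ci s)) (w (di t))"
proof -
  interpret cycle_link A V x y w L D0 "ai s" "bi t" "ci s" "di t"
    by (rule link) (use assms in auto)
  have ac: "A (w (ai s)) (w (ci s))" "A (w (ci s)) (w (ai s))"
    using ac A_edge[of "ai s"] A_edge[of "ci s"] bounds le A_sym by auto
  have bet: "between (w (ai s)) (w (L - Suc t)) (w (ci s))" "between (w (ci s)) (w (L - Suc t)) (w (ai s))"
    using assms(4) between_commute by (auto simp: ai_def ci_def)
  have aL: "ai s \<le> L" "ci s \<le> L" using bounds le by auto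
  show ?thesis
  proof (cases "even t")
    case True
    then have "A (w (ci s)) (w (di t))"
      using bet(2) assms parity aL by (intro shrink_w[OF ac(2)]) (auto simp: di_def)
    then show ?thesis using True by (auto simp: di_def)
  next
    case False
    then have "A (w (ai s)) (w (bi t))"
      using bet(1) assms parity aL by (intro shrink_w[OF ac(1)]) (auto simp: bi_def)
    then show ?thesis using False by (auto simp: bi_def)
  qed
qed

definition gap_z where "gap_z s t \<longleftrightarrow> A (w (ai s)) (w (bi t))"
definition gap_w where "gap_w s t \<longleftrightarrow> A (w (ci s)) (w (di t))"

text \<open>A hop leaves either \<open>Z\<close> or \<open>W\<close> unchanged, and the gap of the
  unchanged one is an edge of the graph. About the other gap it says nothing.\<close>

lemma hop_moves:
  assumes "hop w (\<lambda>t. w (L - t)) T (L - T) (s, t) (s', t')" "T < L"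
  shows "s < T \<and> t < L - T \<and> s' < T \<and> t' < L - T \<and>
    (ai s' = ai s \<and> bi t' = bi t \<and> gap_z s t \<or>
     ci s' = ci s \<and> di t' = di t \<and> gap_w s t \<and> (s' = s \<or> t' = t))"
  using assms(1)
proof cases
  case 1
  then show ?thesis using hop_first[of s T t] assms(2) by (auto simp: gap_z_def gap_w_def)
next
  case 2
  then show ?thesis using hop_first[of s' T t] assms(2) by (auto simp: gap_z_def gap_w_def)
next
  case 3
  then show ?thesis using hop_second[of s T t] assms(2) by (auto simp: gap_z_def gap_w_def)
next
  case 4
  then show ?thesis using hop_second[of s T t'] assms(2) by (auto simp: gap_z_def gap_w_def)
qed

lemma Z_cong:
  assumes ac: "a = Suc c \<or> c = Suc a" "a' = Suc c \<or> c = Suc a'"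
    and bd: "b = Suc d \<or> d = Suc b" "b' = Suc d \<or> d = Suc b'"
    and v: "v \<noteq> w a" "v \<noteq> w a'" "v \<noteq> w b" "v \<noteq> w b'" "a \<noteq> a' \<Longrightarrow> v \<noteq> w c" "b \<noteq> b' \<Longrightarrow> v \<noteq> w d"
  shows "Z a b v = Z a' b' v"
proof -
  have "v \<in> w ` {a<..<b} \<longleftrightarrow> v \<in> w ` {a'<..<b'}"
  proof -
    have "i \<in> {a'<..<b'}" if "i \<in> {a<..<b}" "v = w i" for i
    proof -
      have "i \<noteq> a'" "i \<noteq> b'" "a \<noteq> a' \<Longrightarrow> i \<noteq> c" "b \<noteq> b' \<Longrightarrow> i \<noteq> d" using that v by auto
      then show ?thesis using that(1) ac bd by (cases "a = a'"; cases "b = b'") auto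
    qed
    moreover have "i \<in> {a<..<b}" if "i \<in> {a'<..<b'}" "v = w i" for i
    proof -
      have "i \<noteq> a" "i \<noteq> b" "a \<noteq> a' \<Longrightarrow> i \<noteq> c" "b \<noteq> b' \<Longrightarrow> i \<noteq> d" using that v by auto
      then show ?thesis using that(1) ac bd by (cases "a = a'"; cases "b = b'") auto
    qed
    ultimately show ?thesis by blast
  qed
  then show ?thesis using v by (simp add: Z_def)
qed

text \<open>
  Two states that differ at both ends are joined through the matching that contains the edge from \<open>w c\<close>
  to \<open>w d\<close>, which need not be one of the states of the climb.
\<close>

lemma same_cell:
  assumes "cycle_link A V x y w L D0 a b c d" "cycle_link A V x y w L D0 a' b' c d"
    and T: "a \<le> T" "a' \<le> T" "T \<le> b" "T \<le> b'"
    and good: "A (w a) (w b)" "A (w a') (w b')" "A (w c) (w d)"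
    and main: "main x y (Z a b)" "main x y (Z a' b')"
  shows "\<exists>l \<le> (if a = a' \<or> b = b' then 1 else 2). (path_step x y ^^ l) (Z a b) (Z a' b')"
proof -
  interpret l1: cycle_link A V x y w L D0 a b c d by fact
  interpret l2: cycle_link A V x y w L D0 a' b' c d by fact
  have K: "Z a b \<in> K" "Z a' b' \<in> K"
    using Z_in_K l1.parity l1.bounds l1.bL l2.parity l2.bounds l2.bL good by blast+
  have par: "even (w a) = odd (w 0)" "even (w a') = odd (w 0)" "even (w b) = even (w 0)"
    "even (w b') = even (w 0)" "even (w c) = even (w 0)" "even (w d) = odd (w 0)"
    using w_parity[of a] w_parity[of a'] w_parity[of b] w_parity[of b'] w_parity[of c] w_parity[of d]
      l1.parity l2.parity l1.bounds l1.bL l2.bounds l2.bL by auto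
  note cong = Z_cong[OF l1.ac l2.ac l1.bd l2.bd]
  consider "a = a'" "b = b'" | "a \<noteq> a'" "b = b'" | "a = a'" "b \<noteq> b'" | "a \<noteq> a'" "b \<noteq> b'" by blast
  then show ?thesis
  proof cases
    case 1
    then show ?thesis by (intro exI[of _ 0]) simp
  next
    case 2
    have "adj (Z a b) (Z a' b')"
    proof (rule adjI[of "w c" "w b" "w a" "w a'"])
      show "Z a b v = Z a' b' v" if "v \<notin> {w c, w b, w a, w a'}" for v
        using cong[of v] that 2(2) by simp
    qed (use par in auto)
    then show ?thesis
      using K main 2 by (intro exI[of _ 1]) (simp add: path_step_def relpowp_1 del: One_nat_def relpowp.simps)
  next
    case 3
    have "adj (Z a b) (Z a' b')"
    proof (rule adjI[of "w d" "w a" "w b" "w b'"])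
      show "Z a b v = Z a' b' v" if "v \<notin> {w d, w a, w b, w b'}" for v
        using cong[of v] that 3(1) by simp
    qed (use par in auto)
    then show ?thesis
      using K main 3 by (intro exI[of _ 1]) (simp add: path_step_def relpowp_1 del: One_nat_def relpowp.simps)
  next
    case 4
    have a': "a' = (if c < a then c - 1 else Suc c)" "0 < c"
      using 4(1) l1.ac l2.ac l1.bounds l2.bounds by auto
    have b': "b' = (if b < d then Suc d else d - 1)" "0 < d"
      using 4(2) l1.bd l2.bd l1.bounds l2.bounds by auto
    \<comment> \<open>The two neighbours of \<open>c\<close> are \<open>c - 1\<close> and
      \<open>c + 1\<close>, so \<open>c + 1 \<le> T \<le> b\<close>; likewise
      \<open>a \<le> T \<le> d - 1\<close>. The peak \<open>T\<close> keeps the slopes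
      apart.\<close>
    have "c < b" "a < d"
      using 4 T l1.ac l2.ac l1.bd l2.bd by auto
    have Zc: "Z a b (w c) = w a'"
      using Z_w[OF l1.parity(1,2) l1.bounds(2) l1.bL a'(2)] a' \<open>c < b\<close> l1.ac l1.parity l1.le l1.bL
      by (auto simp: le_less)
    have Zd: "Z a b (w d) = w b'"
      using Z_w[OF l1.parity(1,2) l1.bounds(2) l1.bL b'(2) l1.dL] b' \<open>a < d\<close> l1.bd l1.parity l1.le
      by (auto simp: le_less)
    \<comment> \<open>In \<open>Z a b\<close> the partners of \<open>w c\<close> and
      \<open>w d\<close> are the ends of the new gap. The first switch turns these two edges into
      \<open>{w c, w d}\<close> and \<open>{w a', w b'}\<close>; the second trades
      \<open>{w c, w d}\<close> and \<open>{w a, w b}\<close> for the cycle edges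
      \<open>{w a, w c}\<close> and \<open>{w b, w d}\<close>.\<close>
    let ?z = "(Z a b)(w c := w d, w d := w c, w a' := w b', w b' := w a')"
    have z: "?z \<in> K"
      using swap_in_K[OF K(1), of "w c" "w d"] good par unfolding Zc Zd by blast
    have ne: "w a' \<noteq> w b'"
      using par by metis
    have "adj (Z a b) ?z"
      by (rule adjI[of "w c" "w b'" "w d" "w a'"]) (use par in auto)
    moreover have "adj ?z (Z a' b')"
    proof (rule adjI[of "w c" "w b" "w d" "w a"])
      fix v assume v: "v \<notin> {w c, w b, w d, w a}"
      consider "v = w a'" | "v = w b'" | "v \<noteq> w a'" "v \<noteq> w b'" by blast
      then show "?z v = Z a' b' v"
      proof cases
        case 3
        then show ?thesis using v cong[of v] by simp
      qed (use ne in \<open>simp_all add: Z_def\<close>)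
    qed (use par in auto)
    ultimately have "path_step x y (Z a b) ?z" "path_step x y ?z (Z a' b')"
      using K z main by (auto simp: path_step_def)
    then have "(path_step x y ^^ 2) (Z a b) (Z a' b')"
      by (auto simp: numeral_2_eq_2 simp del: fun_upd_apply)
    then show ?thesis using 4 by (intro exI[of _ 2]) simp
  qed
qed

lemma w0_less: "0 < r \<Longrightarrow> r < L \<Longrightarrow> w 0 < w r"
  using D0_low[of "w r"] w_D0[of r] w_eq_iff[of 0 r] by (cases "w r" "w 0" rule: linorder_cases) auto

text \<open>While the gap of \<open>Z\<close> is missing, the path waits at an earlier valid cell,
  which has the same \<open>c\<close> and \<open>d\<close> because every hop since then left
  \<open>W\<close> alone. The strict \<open>l < i\<close> in that case is a spare step: it pays for
  catching up with two switches after a single further hop.\<close>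

lemma climb:
  assumes hops: "\<And>i. i < n \<Longrightarrow> hop w (\<lambda>t. w (L - t)) T (L - T) (p i) (p (Suc i))"
    and "p 0 = (0, 0)" "0 < T" "T < L" "i \<le> n" "p i = (s, t)"
  shows "s < T \<and> t < L - T \<and>
    (gap_z s t \<longrightarrow> main x y (Z (ai s) (bi t)) \<and> (\<exists>l\<le>i. (path_step x y ^^ l) (Z 1 L) (Z (ai s) (bi t)))) \<and>
    (\<not> gap_z s t \<longrightarrow> gap_w s t \<and> (\<exists>s' t' l. s' < T \<and> t' < L - T \<and> ci s' = ci s \<and> di t' = di t \<and> gap_z s' t' \<and>
      main x y (Z (ai s') (bi t')) \<and> l < i \<and> (path_step x y ^^ l) (Z 1 L) (Z (ai s') (bi t'))))"
  using assms(5,6)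
proof (induction i arbitrary: s t)
  case 0
  then have st: "s = 0" "t = 0" using assms(2) by auto
  have "A (w 1) (w L)" "A (w 0) (w (L - 1))"
    using A_edge[of 0] A_edge[of "L - 1"] w_L L A_sym by auto
  then have gaps: "gap_z s t" "gap_w s t"
    by (auto simp: gap_z_def gap_w_def st ai_def bi_def ci_def di_def)
  interpret cycle_link A V x y w L D0 "ai s" "bi t" "ci s" "di t"
    by (rule link[of _ T]) (use st assms in auto)
  have "main x y (Z (ai s) (bi t))"
    using link_main gaps unfolding gap_z_def gap_w_def .
  then show ?case
    using gaps st assms(3,4) by (auto simp: ai_def bi_def)
next
  case (Suc i s t)
  obtain s0 t0 where p: "p i = (s0, t0)" by fastforce
  have "i \<le> n" "i < n" using Suc.prems by simp_all
  note IH = Suc.IH[OF \<open>i \<le> n\<close> p]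
  have moves: "s0 < T" "t0 < L - T" "s < T" "t < L - T"
    "ai s = ai s0 \<and> bi t = bi t0 \<and> gap_z s0 t0 \<or>
     ci s = ci s0 \<and> di t = di t0 \<and> gap_w s0 t0 \<and> (s = s0 \<or> t = t0)"
    using hop_moves[of T s0 t0 s t] hops[OF \<open>i < n\<close>] p Suc.prems assms(4) by auto
  show ?case
  proof (cases "ai s = ai s0 \<and> bi t = bi t0 \<and> gap_z s0 t0")
    case True
    then have "gap_z s t" by (simp add: gap_z_def)
    \<comment> \<open>\<open>Z\<close> is the same matching as before, so \<open>main\<close>
      carries over from the complement of an earlier cell even if the gap of the present complement
      is no edge.\<close>
    then show ?thesis using IH True moves by (auto intro: le_SucI)
  next
    case False
    then have cd: "ci s = ci s0" "di t = di t0" "gap_w s0 t0" "s = s0 \<or> t = t0" using moves by auto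
    then have gw: "gap_w s t" by (simp add: gap_w_def)
    show ?thesis
    proof (cases "gap_z s t")
      case gz: True
      interpret cycle_link A V x y w L D0 "ai s" "bi t" "ci s" "di t"
        by (rule link[of _ T]) (use moves assms in auto)
      have main: "main x y (Z (ai s) (bi t))"
        using link_main gz gw unfolding gap_z_def gap_w_def .
      have reach: "\<exists>l\<le>k. (path_step x y ^^ l) (Z (ai s') (bi t')) (Z (ai s) (bi t))"
        if "s' < T" "t' < L - T" "ci s' = ci s" "di t' = di t" "gap_z s' t'" "main x y (Z (ai s') (bi t'))"
          "k = (if ai s' = ai s \<or> bi t' = bi t then 1 else 2)" for s' t' k
      proof -
        have "cycle_link A V x y w L D0 (ai s') (bi t') (ci s) (di t)"
          using link[of s' T t'] that assms by simp
        moreover have "ai s' \<le> T" "ai s \<le> T" "T \<le> bi t'" "T \<le> bi t"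
          using that(1,2) moves(3,4) by (simp_all only: ai_le bi_ge)
        ultimately show ?thesis
          using same_cell[of "ai s'" "bi t'" "ci s" "di t" "ai s" "bi t" T] cycle_link_axioms that gz gw main
          unfolding gap_z_def gap_w_def by blast
      qed
      show ?thesis
      proof (cases "gap_z s0 t0")
        case True
        then obtain l where l: "l \<le> i" "(path_step x y ^^ l) (Z 1 L) (Z (ai s0) (bi t0))" "main x y (Z (ai s0) (bi t0))"
          using IH by blast
        obtain l' where "l' \<le> 1" "(path_step x y ^^ l') (Z (ai s0) (bi t0)) (Z (ai s) (bi t))"
          using reach[of s0 t0 1] moves cd True l by auto
        then have "l + l' \<le> Suc i" "(path_step x y ^^ (l + l')) (Z 1 L) (Z (ai s) (bi t))"
          using l by (auto simp: relpowp_add)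
        then show ?thesis using main gz moves by blast
      next
        case False
        then obtain s' t' l where l: "s' < T" "t' < L - T" "ci s' = ci s0" "di t' = di t0" "gap_z s' t'"
          "main x y (Z (ai s') (bi t'))" "l < i" "(path_step x y ^^ l) (Z 1 L) (Z (ai s') (bi t'))"
          using IH by blast
        obtain l' where "l' \<le> (if ai s' = ai s \<or> bi t' = bi t then 1 else 2)"
          and l': "(path_step x y ^^ l') (Z (ai s') (bi t')) (Z (ai s) (bi t))"
          using reach[OF l(1,2) _ _ l(5,6) refl] l(3,4) cd(1,2) by metis
        then have "l' \<le> 2" by (simp split: if_splits)
        then have "l + l' \<le> Suc i" "(path_step x y ^^ (l + l')) (Z 1 L) (Z (ai s) (bi t))"
          using l l' by (auto simp: relpowp_add)
        then show ?thesis using main gz moves by blast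
      qed
    next
      case gz: False
      show ?thesis
      proof (cases "gap_z s0 t0")
        case True
        then obtain l where l: "l \<le> i" "(path_step x y ^^ l) (Z 1 L) (Z (ai s0) (bi t0))" "main x y (Z (ai s0) (bi t0))"
          using IH by blast
        then have "l < Suc i" by simp
        then show ?thesis using gz gw moves cd True l by metis
      next
        case False
        then obtain s' t' l where l: "s' < T" "t' < L - T" "ci s' = ci s0" "di t' = di t0" "gap_z s' t'"
          "main x y (Z (ai s') (bi t'))" "l < i" "(path_step x y ^^ l) (Z 1 L) (Z (ai s') (bi t'))"
          using IH by blast
        then have "l < Suc i" by simp
        then show ?thesis using gz gw moves cd l by metis
      qed
    qed
  qed
qed

lemma cycle_path:
  "\<exists>l. 4 * l \<le> L * L \<and>
    (path_step x y ^^ l) (\<lambda>v. if v \<in> D0 then y v else x v) (\<lambda>v. if v \<in> D0 \<union> cyc then y v else x v)"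
proof -
  obtain T where T: "T \<le> L" "\<And>r. r \<le> L \<Longrightarrow> w r \<le> w T"
  proof -
    have "Max cyc \<in> cyc" by (rule Max_in) auto
    then obtain T where "Max cyc = w T" "T \<in> {..L}" by (rule imageE)
    moreover have "w r \<le> Max cyc" if "r \<le> L" for r using that by simp
    ultimately show thesis using that[of T] by simp
  qed
  have "w 0 < w T" using w0_less[of 1] T(2)[of 1] L by simp
  then have T0: "0 < T" "T < L" using T(1) w_L by (auto intro: le_neq_implies_less gr0I)
  have lt: "w r < w T" if "r \<le> L" "r \<noteq> T" for r
    using T(2)[OF that(1)] w_eq_iff[of r T] that T0 by (simp add: le_less)
  obtain n p where p: "n < T * (L - T)" "p 0 = (0, 0)" "p n = (T - 1, L - T - 1)"
    "\<And>i. i < n \<Longrightarrow> hop w (\<lambda>t. w (L - t)) T (L - T) (p i) (p (Suc i))"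
  proof (rule mountain_climbing[of T "L - T" "\<lambda>t. w (L - t)" w])
    show "w (L - s) \<noteq> w (L - Suc s)" if "s < L - T" for s
      using w_eq_iff[of "L - s" "L - Suc s"] that L by auto
    show "w s \<noteq> w (Suc s)" if "s < T" for s
      using w_eq_iff[of s "Suc s"] that T0 L by auto
    show "w s \<noteq> w (L - t)" if "0 < s" "s < T" "0 < t" "t < L - T" for s t
      using w_eq_iff[of s "L - t"] that T0 by auto
    show "w 0 < w s \<and> w s < w T" if "0 < s" "s < T" for s
      using lt[of s] w0_less[of s] that T0 by auto
    show "w 0 < w (L - t) \<and> w (L - t) < w T" if "0 < t" "t < L - T" for t
      using lt[of "L - t"] w0_less[of "L - t"] that T0 by auto
  qed (use T0 w_L \<open>w 0 < w T\<close> in auto)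
  define s t where "s = T - 1" and "t = L - T - 1"
  have s: "Suc s = T" and t: "Suc t = L - T" "L - t = Suc T" "L - Suc t = T"
    using T0 by (auto simp: s_def t_def)
  have even_t: "even t \<longleftrightarrow> odd T"
  proof -
    have "even (Suc t) \<longleftrightarrow> even T" unfolding t(1) using T0 L by simp
    then show ?thesis by (cases "even t") auto
  qed
  have even_s: "even s \<longleftrightarrow> odd T" using s by auto
  \<comment> \<open>At the peak both walkers' edges contain position \<open>T\<close>. The gap has
    closed to a single cycle edge from an odd position upwards, an edge of \<open>y\<close>, so the
    whole cycle carries \<open>y\<close>.\<close>
  have ab: "bi t = Suc (ai s)" "odd (ai s)" "ai s < L"
    using even_s even_t s t T0 by (auto simp: ai_def bi_def)
  have "gap_z s t" unfolding gap_z_def ab by (rule A_edge) (fact ab)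
  moreover have "p n = (s, t)" using p(3) by (simp add: s_def t_def)
  note conjunct1[OF conjunct2[OF conjunct2[OF climb[OF p(4,2) T0 order_refl this]]]]
  ultimately obtain l where l: "l \<le> n" "(path_step x y ^^ l) (Z 1 L) (Z (ai s) (bi t))"
    by blast
  have "Z (ai s) (bi t) = (\<lambda>v. if v \<in> D0 \<union> cyc then y v else x v)"
  proof
    fix v
    have y: "y (w (ai s)) = w (bi t)" "y (w (bi t)) = w (ai s)"
      using w_y[of "ai s"] ab K_eq_iff[OF yK] by auto
    have "w (ai s) \<in> cyc" "w (bi t) \<in> cyc" using ab by auto
    moreover have "{ai s<..<bi t} = {}" using ab(1) by auto
    ultimately show "Z (ai s) (bi t) v = (if v \<in> D0 \<union> cyc then y v else x v)"
      using y by (auto simp: Z_def)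
  qed
  \<comment> \<open>At the start the gap is the edge \<open>{w 0, w 1}\<close> of \<open>x\<close>,
    written with position \<open>L\<close> for \<open>w 0\<close>.\<close>
  moreover have "Z 1 L = (\<lambda>v. if v \<in> D0 then y v else x v)"
  proof
    fix v
    show "Z 1 L v = (if v \<in> D0 then y v else x v)"
    proof (cases "v \<in> cyc")
      case False
      then show ?thesis using Z_out[of v 1 L] L by simp
    next
      case True
      then obtain i where i: "0 < i" "i \<le> L" "v = w i" by (rule cyc_pos)
      have x: "x (w 0) = w 1" "x (w 1) = w 0" using w_x[of 0] L K_eq_iff[OF xK] by auto
      have "v \<notin> D0" using w_D0 i by simp
      moreover have "Z 1 L v = x v"
      proof (cases "i = 1 \<or> i = L")
        case True
        then show ?thesis using x w_L i by (auto simp: Z_def)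
      next
        case False
        then have "v \<in> w ` {1<..<L}" using i by auto
        moreover have "v \<noteq> w 1" "v \<noteq> w L" using False i w_eq_iff[of i 1] w_eq_iff[of i L] L by auto
        ultimately show ?thesis by (simp add: Z_def)
      qed
      ultimately show ?thesis by simp
    qed
  qed
  moreover have "4 * l \<le> L * L"
  proof -
    have "4 * (T * (L - T)) \<le> L * L"
    proof -
      have "int (4 * (T * (L - T))) \<le> int (L * L)"
        using T0 sum_squares_ge_zero[of "2 * int T - int L" 0]
        by (simp add: of_nat_diff algebra_simps)
      then show ?thesis by linarith
    qed
    then show ?thesis using l(1) p(1) by linarith
  qed
  ultimately show ?thesis using l(2) by metis
qed

end

section \<open>Canonical paths and the Poincare inequality\<close>

context matching_space
begin

section \<open>Alternating cycles, treated in the order of their lowest vertices\<close>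

primrec walk :: "(nat \<Rightarrow> nat) \<Rightarrow> (nat \<Rightarrow> nat) \<Rightarrow> nat \<Rightarrow> nat \<Rightarrow> nat" where
  "walk x y m 0 = m"
| "walk x y m (Suc r) = (if even r then x else y) (walk x y m r)"

lemma K_agree_outside: "x \<in> K \<Longrightarrow> y \<in> K \<Longrightarrow> v \<notin> V \<Longrightarrow> x v = y v"
  using outside[of v "x v" "y v"] KD(3) by blast

text \<open>The walk can be run backwards, so its first repetition is a return to \<open>m\<close>.
  The length is even by parity, and length 2 would mean \<open>y (x m) = m\<close>, that is
  \<open>x m = y m\<close>.\<close>

lemma alternating_cycle:
  assumes x: "x \<in> K" and y: "y \<in> K" and m: "x m \<noteq> y m"
  obtains L where "even L" "4 \<le> L" "walk x y m L = m" "inj_on (walk x y m) {..<L}" "\<And>r. walk x y m r \<in> V"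
proof -
  let ?w = "walk x y m"
  have ne: "x (?w r) \<noteq> y (?w r)" for r
  proof (induction r)
    case (Suc r)
    then show ?case using K_eq_iff[OF x] K_eq_iff[OF y] by (cases "even r") (simp; metis)+
  qed (use m in simp)
  then have wV: "?w r \<in> V" for r using K_agree_outside[OF x y] by blast
  have par: "even (?w r) \<longleftrightarrow> (even m \<longleftrightarrow> even r)" for r
    by (induction r) (use KD(2)[OF x] KD(2)[OF y] in auto)
  have rewind: "?w j = m" if "?w (i + j) = ?w i" for i j
    using that
  proof (induction i)
    case (Suc i)
    have "even (i + j) = even i" using par[of "Suc i + j"] par[of "Suc i"] Suc.prems by auto
    then have "?w (i + j) = ?w i" using Suc.prems K_inj[OF x] K_inj[OF y] by (auto split: if_splits)
    then show ?case by (rule Suc.IH)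
  qed simp
  have "\<not> inj_on ?w UNIV"
  proof
    assume "inj_on ?w UNIV"
    moreover have "finite (range ?w)" by (rule finite_subset[OF _ fin_V]) (use wV in auto)
    ultimately show False using finite_imageD infinite_UNIV_nat by blast
  qed
  then obtain i j where "i < j" "?w i = ?w j" unfolding inj_on_def by (metis nat_neq_iff)
  then have ex: "0 < j - i \<and> ?w (j - i) = m" using rewind[of i "j - i"] by simp
  define L where "L = (LEAST r. 0 < r \<and> ?w r = m)"
  have L: "0 < L" "?w L = m" and least: "\<And>r. 0 < r \<Longrightarrow> ?w r = m \<Longrightarrow> L \<le> r"
    unfolding L_def using LeastI[of "\<lambda>r. 0 < r \<and> ?w r = m", OF ex] by (auto intro: Least_le)
  have "even L" using par[of L] L(2) by auto
  moreover have "L \<noteq> 2"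
  proof
    assume "L = 2"
    then have "y (x m) = m" using L(2) by (simp add: numeral_2_eq_2)
    then show False using m K_eq_iff[OF y] by metis
  qed
  ultimately have "4 \<le> L" using L(1) by presburger
  moreover have "inj_on ?w {..<L}"
  proof (rule linorder_inj_onI)
    fix i j assume "i < j" "j \<in> {..<L}"
    then show "?w i \<noteq> ?w j" using rewind[of i "j - i"] least[of "j - i"] by auto
  qed auto
  ultimately show thesis using that \<open>even L\<close> L(2) wV by blast
qed

inductive_set treated :: "(nat \<Rightarrow> nat) \<Rightarrow> (nat \<Rightarrow> nat) \<Rightarrow> nat \<Rightarrow> nat set" for x y m where
  low: "v < m \<Longrightarrow> v \<in> treated x y m"
| step_x: "v \<in> treated x y m \<Longrightarrow> x v \<in> treated x y m"
| step_y: "v \<in> treated x y m \<Longrightarrow> y v \<in> treated x y m"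

lemma treated_mono: "m \<le> m' \<Longrightarrow> treated x y m \<subseteq> treated x y m'"
proof
  fix v assume "m \<le> m'" "v \<in> treated x y m"
  from this(2,1) show "v \<in> treated x y m'"
    by induction (auto intro: treated.intros)
qed

lemma treated_least:
  assumes "\<And>v. v < m \<Longrightarrow> v \<in> S" "\<And>v. v \<in> S \<Longrightarrow> x v \<in> S" "\<And>v. v \<in> S \<Longrightarrow> y v \<in> S"
  shows "treated x y m \<subseteq> S"
proof
  fix v assume "v \<in> treated x y m"
  then show "v \<in> S" by induction (use assms in auto)
qed

text \<open>The vertex \<open>m\<close> opens a cycle only if it is untreated and
  \<open>x m \<noteq> y m\<close>. The bound is a quarter of a square so that it survives the union
  with a new cycle: the squares of two sizes add up to at most the square of their sum.\<close>

lemma treated_path: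
  assumes x: "x \<in> K" and y: "y \<in> K"
  shows "\<exists>l. 4 * l \<le> (card (treated x y m \<inter> V))\<^sup>2 \<and>
    (path_step x y ^^ l) x (\<lambda>v. if v \<in> treated x y m then y v else x v)"
proof (induction m)
  case 0
  have "treated x y 0 = {}" using treated_least[of 0 "{}"] by auto
  then show ?case by (intro exI[of _ 0]) simp
next
  case (Suc m)
  let ?T = "treated x y m" and ?T' = "treated x y (Suc m)"
  have sub: "?T \<subseteq> ?T'" by (rule treated_mono) simp
  obtain l where l: "4 * l \<le> (card (?T \<inter> V))\<^sup>2"
    "(path_step x y ^^ l) x (\<lambda>v. if v \<in> ?T then y v else x v)"
    using Suc by blast
  show ?case
  proof (cases "m \<in> ?T \<or> x m = y m")
    case True
    \<comment> \<open>At most a common edge of \<open>x\<close> and \<open>y\<close> is added, so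
      the current matching stays the same.\<close>
    have "?T' \<subseteq> ?T \<union> {m, x m}"
    proof (rule treated_least)
      show "v \<in> ?T \<union> {m, x m}" if "v < Suc m" for v
        using that treated.low[of v m x y] by (cases "v = m") auto
      show "x v \<in> ?T \<union> {m, x m}" if "v \<in> ?T \<union> {m, x m}" for v
        using that treated.step_x[of v x y m] KD(1)[OF x, of m] by auto
      show "y v \<in> ?T \<union> {m, x m}" if "v \<in> ?T \<union> {m, x m}" for v
      proof (cases "v \<in> ?T")
        case v: False
        then have "v = m \<or> v = x m" using that by blast
        then show ?thesis
        proof (cases "m \<in> ?T")
          case True
          then have "v \<in> ?T" using \<open>v = m \<or> v = x m\<close> treated.step_x by metis
          with v show ?thesis by blast
        next
          case False
          then have "x m = y m" using True by blast
          then show ?thesis using \<open>v = m \<or> v = x m\<close> KD(1)[OF y, of m] by auto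
        qed
      qed (use treated.step_y in blast)
    qed
    moreover have "x v = y v" if "v \<in> {m, x m}" "v \<notin> ?T" for v
    proof (cases "m \<in> ?T")
      case T: True
      then have "x m \<in> ?T" by (rule treated.step_x)
      then show ?thesis using that T by auto
    next
      case False
      then have "x m = y m" using True by blast
      moreover have "x (x m) = m" "y (y m) = m" using KD(1) x y by blast+
      ultimately show ?thesis using that(1) by auto
    qed
    ultimately have "(\<lambda>v. if v \<in> ?T' then y v else x v) = (\<lambda>v. if v \<in> ?T then y v else x v)"
      using sub by (intro ext) (metis (no_types, lifting) UnE subsetD)
    moreover have "card (?T \<inter> V) \<le> card (?T' \<inter> V)"
      using sub fin_V by (intro card_mono) auto
    then have "4 * l \<le> (card (?T' \<inter> V))\<^sup>2"
      using l(1) power_mono[of _ _ 2] order_trans by blast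
    ultimately show ?thesis using l(2) by metis
  next
    case False
    then have mT: "m \<notin> ?T" and "x m \<noteq> y m" by auto
    let ?w = "walk x y m"
    obtain L where L: "even L" "4 \<le> L" "?w L = m" "inj_on ?w {..<L}" "\<And>r. ?w r \<in> V"
      using alternating_cycle[OF x y \<open>x m \<noteq> y m\<close>] by blast
    note wV = L(5)
    have wT: "?w r \<notin> ?T" for r
    proof (induction r)
      case (Suc r)
      have "?w r = x (?w (Suc r)) \<or> ?w r = y (?w (Suc r))" using KD(1)[OF x] KD(1)[OF y] by auto
      then show ?case using Suc treated.step_x treated.step_y by metis
    qed (use mT in simp)
    interpret cycle_step A V x y ?w L ?T
      by unfold_locales (use x y L wT treated.intros treated_least in auto)
    have T': "?T' = ?T \<union> cyc"
    proof
      show "?T' \<subseteq> ?T \<union> cyc"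
      proof (rule treated_least)
        show "v \<in> ?T \<union> cyc" if "v < Suc m" for v
          using that treated.low[of v m x y] by (cases "v = m") (auto intro: rev_image_eqI[of 0])
        show "x v \<in> ?T \<union> cyc" if "v \<in> ?T \<union> cyc" for v
          using that treated.step_x[of v x y m] cyc_x[of v] by (elim UnE) simp_all
        show "y v \<in> ?T \<union> cyc" if "v \<in> ?T \<union> cyc" for v
          using that treated.step_y[of v x y m] cyc_y[of v] by (elim UnE) simp_all
      qed
      have "?w r \<in> ?T'" for r
        by (induction r) (auto intro: treated.intros)
      then show "?T \<union> cyc \<subseteq> ?T'" using sub by auto
    qed
    obtain l' where l': "4 * l' \<le> L * L"
      "(path_step x y ^^ l') (\<lambda>v. if v \<in> ?T then y v else x v) (\<lambda>v. if v \<in> ?T' then y v else x v)"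
      using cycle_path unfolding T' by blast
    have "card (?T \<inter> V) + L = card ((?T \<inter> V) \<union> ?w ` {..<L})"
      using fin_V wT card_image[OF w_inj] by (subst card_Un_disjoint) auto
    also have "\<dots> \<le> card (?T' \<inter> V)"
      using fin_V wV unfolding T' by (intro card_mono) auto
    finally have "(card (?T \<inter> V) + L)\<^sup>2 \<le> (card (?T' \<inter> V))\<^sup>2" by (rule power_mono) simp
    moreover have "(card (?T \<inter> V))\<^sup>2 + L * L \<le> (card (?T \<inter> V) + L)\<^sup>2"
      by (simp add: power2_eq_square algebra_simps)
    moreover have "4 * (l + l') \<le> (card (?T \<inter> V))\<^sup>2 + L * L"
      unfolding distrib_left using l(1) l'(1) by (rule add_mono)
    ultimately have "4 * (l + l') \<le> (card (?T' \<inter> V))\<^sup>2" by (meson order_trans)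
    moreover have "(path_step x y ^^ (l + l')) x (\<lambda>v. if v \<in> ?T' then y v else x v)"
      using l(2) l'(2) by (auto simp: relpowp_add)
    ultimately show ?thesis by blast
  qed
qed

theorem matching_path:
  assumes x: "x \<in> K" and y: "y \<in> K"
  shows "\<exists>l. 4 * l \<le> (card V)\<^sup>2 \<and> (path_step x y ^^ l) x y"
proof -
  obtain m where m: "\<forall>v\<in>V. v < m" using fin_V finite_nat_set_iff_bounded by blast
  have V: "V \<subseteq> treated x y m" using m treated.low by blast
  then have "(\<lambda>v. if v \<in> treated x y m then y v else x v) = y"
    using K_agree_outside[OF x y] by (intro ext) auto
  moreover have "treated x y m \<inter> V = V" using V by blast
  ultimately show ?thesis using treated_path[OF x y, of m] by simp
qed

section \<open>Congestion and the Poincare inequality for involutions\<close>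

lemma main_count:
  assumes "finite K" "z \<in> K"
  shows "card {u \<in> K \<times> K. main (fst u) (snd u) z} \<le> 4 * (card {v \<in> V. even v})\<^sup>2 * card K"
proof -
  let ?E = "{v \<in> V. even v}"
  let ?C = "K \<times> ?E \<times> ?E \<times> (UNIV :: (bool \<times> bool) set)"
  define g where "g = (\<lambda>(w, p, q, t1, t2). SOME (x, y). code x y z w p q t1 t2)"
  have fin: "finite ?C" using assms(1) fin_V by simp
  have sub: "{u \<in> K \<times> K. main (fst u) (snd u) z} \<subseteq> g ` ?C"
  proof clarify
    fix x y assume "main (fst (x, y)) (snd (x, y)) z"
    then obtain w p q t1 t2 where c: "w \<in> K" "p \<in> ?E" "q \<in> ?E" "code x y z w p q t1 t2"
      unfolding main_def by auto
    have "g (w, p, q, t1, t2) = (x, y)"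
      unfolding g_def prod.case
    proof (rule some_equality)
      show "case (x, y) of (x, y) \<Rightarrow> code x y z w p q t1 t2" using c(4) by simp
    next
      fix u assume "case u of (x', y') \<Rightarrow> code x' y' z w p q t1 t2"
      then show "u = (x, y)" using code_inj[OF assms(2) c(1) _ c(4)] by (cases u) auto
    qed
    then show "(x, y) \<in> g ` ?C" using c by (intro image_eqI[of _ _ "(w, p, q, t1, t2)"]) auto
  qed
  have "card {u \<in> K \<times> K. main (fst u) (snd u) z} \<le> card ?C"
    using card_mono[OF finite_imageI[OF fin] sub] card_image_le[OF fin, of g] by (rule order_trans)
  also have "\<dots> = 4 * (card ?E)\<^sup>2 * card K"
  proof -
    have "card (UNIV :: (bool \<times> bool) set) = 4" by (simp add: card_UNIV_bool flip: UNIV_Times_UNIV)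
    then show ?thesis by (simp add: card_cartesian_product power2_eq_square)
  qed
  finally show ?thesis .
qed

text \<open>Telescoping and the Cauchy-Schwarz inequality, with (2 n)^2 / 4 = n^2 for the length.
  The path repeats no matching, so its steps are distinct pairs and the sum over them is part of the
  sum over all pairs related by \<open>path_step\<close>.\<close>

lemma path_edges:
  fixes f :: "(nat \<Rightarrow> nat) \<Rightarrow> real"
  assumes fin: "finite K" and x: "x \<in> K" and y: "y \<in> K" and V: "card V = 2 * n"
  shows "(f x - f y)\<^sup>2 \<le> real (n\<^sup>2) * (\<Sum>(z, z') \<in> {e \<in> K \<times> K. path_step x y (fst e) (snd e)}. (f z - f z')\<^sup>2)"
proof -
  obtain l0 where "4 * l0 \<le> (2 * n)\<^sup>2" "(path_step x y ^^ l0) x y"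
    using matching_path[OF x y] V by auto
  then obtain l p where l: "l \<le> l0" and p: "p 0 = x" "p l = y" "inj_on p {..l}"
    and steps: "\<And>i. i < l \<Longrightarrow> path_step x y (p i) (p (Suc i))"
    using relpowp_shortest_path by metis
  have "4 * l0 \<le> 4 * n\<^sup>2" using \<open>4 * l0 \<le> (2 * n)\<^sup>2\<close> by (simp add: power2_eq_square)
  then have ln: "l \<le> n\<^sup>2" using l by simp
  let ?S = "{e \<in> K \<times> K. path_step x y (fst e) (snd e)}"
  have "f x - f y = (\<Sum>i<l. f (p i) - f (p (Suc i)))"
    using sum_lessThan_telescope'[of "\<lambda>i. f (p i)" l] p by simp
  then have "(f x - f y)\<^sup>2 \<le> (\<Sum>i<l. (f (p i) - f (p (Suc i)))\<^sup>2) * real l"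
    using sum_squared_le_sum_of_squares[of "\<lambda>i. f (p i) - f (p (Suc i))" "{..<l}"] by simp
  also have "(\<Sum>i<l. (f (p i) - f (p (Suc i)))\<^sup>2) =
      (\<Sum>(z, z')\<in>(\<lambda>i. (p i, p (Suc i))) ` {..<l}. (f z - f z')\<^sup>2)"
    by (subst sum.reindex) (use p(3) in \<open>auto simp: inj_on_def\<close>)
  also have "\<dots> \<le> (\<Sum>(z, z')\<in>?S. (f z - f z')\<^sup>2)"
  proof (rule sum_mono2)
    have "p i \<in> K \<and> p (Suc i) \<in> K" if "i < l" for i
      using steps[OF that] by (simp add: path_step_def)
    then show "(\<lambda>i. (p i, p (Suc i))) ` {..<l} \<subseteq> ?S" using steps by auto
  qed (use fin in auto)
  finally have "(f x - f y)\<^sup>2 \<le> (\<Sum>(z, z')\<in>?S. (f z - f z')\<^sup>2) * real l"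
    by (simp add: mult_right_mono)
  also have "\<dots> \<le> (\<Sum>(z, z')\<in>?S. (f z - f z')\<^sup>2) * real (n\<^sup>2)"
    using ln by (intro mult_left_mono sum_nonneg) (auto simp flip: of_nat_power)
  finally show ?thesis by (simp add: mult.commute)
qed

theorem poincare:
  fixes f :: "(nat \<Rightarrow> nat) \<Rightarrow> real"
  assumes fin: "finite K" and V: "card V = 2 * n" "card {v \<in> V. even v} = n"
  shows "(\<Sum>x\<in>K. \<Sum>y\<in>K. (f x - f y)\<^sup>2) \<le>
    8 * real n ^ 4 * real (card K) * (\<Sum>z\<in>K. \<Sum>z' | z' \<in> K \<and> adj z z'. (f z - f z')\<^sup>2)"
proof -
  let ?g = "\<lambda>e. (f (fst e) - f (snd e))\<^sup>2"
  let ?P = "\<lambda>u e. path_step (fst u) (snd u) (fst e) (snd e)"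
  have "(\<Sum>x\<in>K. \<Sum>y\<in>K. (f x - f y)\<^sup>2) = (\<Sum>u\<in>K \<times> K. ?g u)"
    by (simp add: sum.cartesian_product case_prod_beta)
  also have "\<dots> \<le> (\<Sum>u\<in>K \<times> K. real (n\<^sup>2) * (\<Sum>e\<in>{e \<in> K \<times> K. ?P u e}. ?g e))"
    using path_edges[OF fin _ _ V(1), of _ _ f] by (intro sum_mono) (auto simp: case_prod_beta)
  also have "\<dots> = real (n\<^sup>2) * (\<Sum>e\<in>K \<times> K. \<Sum>u\<in>{u \<in> K \<times> K. ?P u e}. ?g e)"
    using fin by (subst sum.swap_restrict) (simp_all add: sum_distrib_left)
  also have "\<dots> = real (n\<^sup>2) * (\<Sum>e\<in>K \<times> K. real (card {u \<in> K \<times> K. ?P u e}) * ?g e)"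
    by simp
  also have "\<dots> \<le> real (n\<^sup>2) * (\<Sum>e\<in>K \<times> K. (if adj (fst e) (snd e) then 8 * real n ^ 2 * real (card K) * ?g e else 0))"
  proof (intro mult_left_mono sum_mono)
    fix e assume e: "e \<in> K \<times> K"
    show "real (card {u \<in> K \<times> K. ?P u e}) * ?g e \<le>
      (if adj (fst e) (snd e) then 8 * real n ^ 2 * real (card K) * ?g e else 0)"
    proof (cases "adj (fst e) (snd e)")
      case False
      then have "{u \<in> K \<times> K. ?P u e} = {}" by (auto simp: path_step_def)
      then have "card {u \<in> K \<times> K. ?P u e} = 0" by (simp only: card.empty)
      then show ?thesis using False by (simp only: if_False)
    next
      case True
      \<comment> \<open>The step \<open>e\<close> is used only by pairs for which one of its two
        ends is encoded; each end accounts for \<open>4 * n ^ 2 * card K\<close> pairs at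
        most.\<close>
      have "card {u \<in> K \<times> K. ?P u e} \<le> card ({u \<in> K \<times> K. main (fst u) (snd u) (fst e)} \<union> {u \<in> K \<times> K. main (fst u) (snd u) (snd e)})"
        using fin by (intro card_mono) (auto simp: path_step_def)
      also have "\<dots> \<le> card {u \<in> K \<times> K. main (fst u) (snd u) (fst e)} + card {u \<in> K \<times> K. main (fst u) (snd u) (snd e)}"
        by (rule card_Un_le)
      also have "\<dots> \<le> 4 * n\<^sup>2 * card K + 4 * n\<^sup>2 * card K"
      proof (rule add_mono)
        have *: "card {u \<in> K \<times> K. main (fst u) (snd u) z} \<le> 4 * n\<^sup>2 * card K" if "z \<in> K" for z
          using main_count[OF fin that] V(2) by simp
        show "card {u \<in> K \<times> K. main (fst u) (snd u) (fst e)} \<le> 4 * n\<^sup>2 * card K"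
          "card {u \<in> K \<times> K. main (fst u) (snd u) (snd e)} \<le> 4 * n\<^sup>2 * card K"
          using * e by auto
      qed
      finally have "card {u \<in> K \<times> K. ?P u e} \<le> 8 * n\<^sup>2 * card K" by (simp add: ac_simps)
      then have "real (card {u \<in> K \<times> K. ?P u e}) \<le> real (8 * n\<^sup>2 * card K)" by (rule of_nat_mono)
      then have "real (card {u \<in> K \<times> K. ?P u e}) * ?g e \<le> real (8 * n\<^sup>2 * card K) * ?g e"
        by (rule mult_right_mono) simp
      then show ?thesis using True by simp
    qed
  qed simp
  also have "(\<Sum>e\<in>K \<times> K. (if adj (fst e) (snd e) then 8 * real n ^ 2 * real (card K) * ?g e else 0)) =
      8 * real n ^ 2 * real (card K) * (\<Sum>z\<in>K. \<Sum>z' | z' \<in> K \<and> adj z z'. (f z - f z')\<^sup>2)"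
  proof -
    have "(\<Sum>e\<in>K \<times> K. (if adj (fst e) (snd e) then 8 * real n ^ 2 * real (card K) * ?g e else 0)) =
      (\<Sum>z\<in>K. \<Sum>z'\<in>K. (if adj z z' then 8 * real n ^ 2 * real (card K) * (f z - f z')\<^sup>2 else 0))"
      by (simp add: sum.cartesian_product case_prod_beta)
    also have "\<dots> = (\<Sum>z\<in>K. \<Sum>z' | z' \<in> K \<and> adj z z'. 8 * real n ^ 2 * real (card K) * (f z - f z')\<^sup>2)"
      using fin by (simp add: sum.inter_filter)
    finally show ?thesis by (simp add: sum_distrib_left)
  qed
  finally show ?thesis
    by (simp add: power2_eq_square power4_eq_xxxx mult.assoc)
qed

end

section \<open>Monotone graphs\<close>

text \<open>Pigeonhole: \<open>{1..i}\<close> has no injection into \<open>{1..<i}\<close>, and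
  \<open>{i..n}\<close> none into \<open>{i<..n}\<close>.\<close>

lemma permutation_interval_diagonal:
  fixes \<pi> :: "nat \<Rightarrow> nat"
  assumes \<pi>: "\<pi> permutes {1..n}" and i: "i \<in> {1..n}"
  obtains j k where "j \<in> {1..i}" "i \<le> \<pi> j" "k \<in> {i..n}" "\<pi> k \<le> i"
proof -
  have inj: "inj_on \<pi> B" for B using permutes_inj_on[OF \<pi>] .
  have mem: "\<pi> j \<in> {1..n}" if "j \<in> {1..n}" for j using permutes_in_image[OF \<pi>] that by blast
  have "\<exists>j\<in>{1..i}. i \<le> \<pi> j"
  proof (rule ccontr)
    assume neg: "\<not> ?thesis"
    have "\<pi> ` {1..i} \<subseteq> {1..<i}"
    proof (rule image_subsetI)
      fix j assume j: "j \<in> {1..i}"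
      then have "\<pi> j \<in> {1..n}" using mem i by simp
      then show "\<pi> j \<in> {1..<i}" using neg j by force
    qed
    then have "card {1..i} \<le> card {1..<i}" by (rule card_inj_on_le[OF inj]) simp
    then show False using i by (cases i) auto
  qed
  moreover have "\<exists>k\<in>{i..n}. \<pi> k \<le> i"
  proof (rule ccontr)
    assume neg: "\<not> ?thesis"
    have "\<pi> ` {i..n} \<subseteq> {i<..n}"
    proof (rule image_subsetI)
      fix j assume j: "j \<in> {i..n}"
      then have "\<pi> j \<in> {1..n}" using mem i by simp
      then show "\<pi> j \<in> {i<..n}" using neg j by force
    qed
    then have "card {i..n} \<le> card {i<..n}" by (rule card_inj_on_le[OF inj]) simp
    then show False using i by (simp add: Suc_diff_le)
  qed
  ultimately show thesis using that by blast
qed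

locale monotone_matching =
  fixes n :: nat and E :: "(nat \<times> nat) set" and \<sigma> \<tau> \<alpha> \<beta> :: "nat \<Rightarrow> nat"
  assumes \<sigma>: "\<sigma> permutes {1..n}" and \<tau>: "\<tau> permutes {1..n}"
    and intervals: "\<And>i. i \<in> {1..n} \<Longrightarrow> {j\<in>{1..n}. \<tau> j \<in> neighbours E (\<sigma> i)} = {\<alpha> i..\<beta> i}"
    and mono: "\<And>i j. i \<in> {1..n} \<Longrightarrow> j \<in> {1..n} \<Longrightarrow> i \<le> j \<Longrightarrow> \<alpha> i \<le> \<alpha> j \<and> \<beta> i \<le> \<beta> j"
    and matching: "perfect_matchings n E \<noteq> {}"
begin

abbreviation "\<Omega> \<equiv> perfect_matchings n E"

definition F where "F i j \<longleftrightarrow> i \<in> {1..n} \<and> j \<in> {1..n} \<and> (\<sigma> i, \<tau> j) \<in> E"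

lemma F_iff: "F i j \<longleftrightarrow> i \<in> {1..n} \<and> \<alpha> i \<le> j \<and> j \<le> \<beta> i"
proof (cases "i \<in> {1..n}")
  case True
  have "j \<in> {j\<in>{1..n}. \<tau> j \<in> neighbours E (\<sigma> i)} \<longleftrightarrow> j \<in> {\<alpha> i..\<beta> i}"
    using intervals[OF True] by simp
  then show ?thesis using True by (simp add: F_def neighbours_def)
qed (auto simp: F_def)

text \<open>In sorted order the identity is a matching. A row \<open>j \<le> i\<close> whose partner
  is at least \<open>i\<close> gives \<open>i \<le> \<beta> j \<le> \<beta> i\<close>, and a row
  \<open>k \<ge> i\<close> whose partner is at most \<open>i\<close> gives
  \<open>\<alpha> i \<le> \<alpha> k \<le> i\<close>.\<close>

lemma diagonal: assumes i: "i \<in> {1..n}" shows "\<alpha> i \<le> i" "i \<le> \<beta> i"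
proof -
  obtain \<pi> where \<pi>: "\<pi> \<in> \<Omega>" using matching by blast
  define \<rho> where "\<rho> = inv \<tau> \<circ> (\<pi> \<circ> \<sigma>)"
  have per: "\<pi> permutes {1..n}" using \<pi> by (simp add: perfect_matchings_def)
  have \<rho>: "\<rho> permutes {1..n}"
    unfolding \<rho>_def by (intro permutes_compose permutes_inv \<sigma> \<tau> per)
  have F: "F j (\<rho> j)" if "j \<in> {1..n}" for j
  proof -
    have "\<sigma> j \<in> {1..n}" using that permutes_in_image[OF \<sigma>] by blast
    moreover have "\<rho> j \<in> {1..n}" using that permutes_in_image[OF \<rho>] by blast
    moreover have "\<tau> (\<rho> j) = \<pi> (\<sigma> j)" by (simp add: \<rho>_def permutes_inverses(1)[OF \<tau>])
    ultimately show ?thesis using \<pi> that by (simp add: F_def perfect_matchings_def)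
  qed
  obtain j k where jk: "j \<in> {1..i}" "i \<le> \<rho> j" "k \<in> {i..n}" "\<rho> k \<le> i"
    using permutation_interval_diagonal[OF \<rho> i] by blast
  then have j: "j \<in> {1..n}" "j \<le> i" and k: "k \<in> {1..n}" "i \<le> k" using i by auto
  have "\<rho> j \<le> \<beta> j" "\<alpha> k \<le> \<rho> k" using F[OF j(1)] F[OF k(1)] F_iff by blast+
  moreover have "\<beta> j \<le> \<beta> i" using mono[OF j(1) i j(2)] by simp
  moreover have "\<alpha> i \<le> \<alpha> k" using mono[OF i k(1) k(2)] by simp
  ultimately show "\<alpha> i \<le> i" "i \<le> \<beta> i" using jk by linarith+
qed

text \<open>Outside \<open>{1..n}\<close> the identity is the only choice; this makes matchings
  total involutions.\<close>

definition B where "B i j \<longleftrightarrow> F i j \<or> i = j \<and> i \<notin> {1..n}"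

text \<open>The vertices at position \<open>i\<close> of the two parts get the heights
  \<open>2 * i\<close> and \<open>2 * i + 1\<close>, so the parts interleave and the vertices of the
  graph are 2, ..., 2 n + 1.\<close>

definition A :: "nat \<Rightarrow> nat \<Rightarrow> bool" where
  "A p q \<longleftrightarrow> even p \<noteq> even q \<and> (if even p then B (p div 2) (q div 2) else B (q div 2) (p div 2))"

definition V :: "nat set" where "V = {2..2 * n + 1}"

text \<open>The diagonal and monotonicity combine:
  \<open>\<alpha> i \<le> i \<le> k \<le> j \<le> \<beta> i\<close> gives the edge
  \<open>(i, k)\<close>, and
  \<open>\<alpha> k \<le> k \<le> j \<le> \<beta> i \<le> \<beta> k\<close> gives
  \<open>(k, j)\<close>.\<close>

lemma B_up: "B i j \<Longrightarrow> i \<le> k \<Longrightarrow> k \<le> j \<Longrightarrow> B i k \<and> B k j"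
proof -
  assume B: "B i j" and k: "i \<le> k" "k \<le> j"
  show "B i k \<and> B k j"
  proof (cases "F i j")
    case True
    then have i: "i \<in> {1..n}" "j \<in> {1..n}" "j \<le> \<beta> i" using F_iff F_def by blast+
    then have k': "k \<in> {1..n}" using k by simp
    then show ?thesis
      using i k diagonal[of i] diagonal[of k] mono[OF i(1) k' k(1)] by (auto simp: B_def F_iff)
  next
    case False
    then show ?thesis using B k by (auto simp: B_def)
  qed
qed

lemma B_down: "B i j \<Longrightarrow> j \<le> k \<Longrightarrow> k \<le> i \<Longrightarrow> B i k \<and> B k j"
proof -
  assume B: "B i j" and k: "j \<le> k" "k \<le> i"
  show "B i k \<and> B k j"
  proof (cases "F i j")
    case True
    then have i: "i \<in> {1..n}" "j \<in> {1..n}" "\<alpha> i \<le> j" using F_iff F_def by blast+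
    then have k': "k \<in> {1..n}" using k by simp
    then show ?thesis
      using i k diagonal[of i] diagonal[of k] mono[OF k' i(1) k(2)] by (auto simp: B_def F_iff)
  next
    case False
    then show ?thesis using B k by (auto simp: B_def)
  qed
qed

sublocale matching_space A V
proof
  show "A q p" if "A p q" for p q using that by (auto simp: A_def split: if_splits)
  show "finite V" by (simp add: V_def)
  show "A p r" if "A p q" "even r = even q" "between p r q" for p q r
  proof -
    have "p div 2 \<le> r div 2 \<and> r div 2 \<le> q div 2 \<or> q div 2 \<le> r div 2 \<and> r div 2 \<le> p div 2"
      using that(3) by (auto simp: between_def intro: div_le_mono)
    then have "B (p div 2) (q div 2) \<Longrightarrow> B (p div 2) (r div 2)" "B (q div 2) (p div 2) \<Longrightarrow> B (r div 2) (p div 2)"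
      using B_up B_down by blast+
    then show ?thesis
      using that(1,2) unfolding A_def by (cases "even p") simp_all
  qed
  show "q = q'" if "A p q" "A p q'" "p \<notin> V" for p q q'
  proof -
    have "p div 2 \<notin> {1..n}" using that(3) by (auto simp: V_def)
    then have "q div 2 = p div 2" "q' div 2 = p div 2" "even q = even q'"
      using that(1,2) by (auto simp: A_def B_def F_def split: if_splits)
    then show ?thesis by (metis div_mod_decomp mod2_eq_if)
  qed
qed

lemma card_V: "card V = 2 * n" "card {v \<in> V. even v} = n"
proof -
  show "card V = 2 * n" by (simp add: V_def)
  have "{v \<in> V. even v} = (\<lambda>i. 2 * i) ` {1..n}"
    by (auto simp: V_def elim!: evenE)
  then show "card {v \<in> V. even v} = n" by (simp add: card_image inj_on_def)
qed

section \<open>Transfer from involutions back to permutations\<close>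

definition emb :: "(nat \<Rightarrow> nat) \<Rightarrow> nat \<Rightarrow> nat" where
  "emb \<pi> v = (if even v then Suc (2 * inv \<tau> (\<pi> (\<sigma> (v div 2)))) else 2 * inv \<sigma> (inv \<pi> (\<tau> (v div 2))))"

lemmas inv_simps = permutes_inverses[OF \<sigma>] permutes_inverses[OF \<tau>]

lemma permutes_outside: "p permutes S \<Longrightarrow> i \<notin> S \<Longrightarrow> p i = i"
  by (simp add: permutes_def)

lemma emb_in_K: assumes "\<pi> \<in> \<Omega>" shows "emb \<pi> \<in> K"
proof -
  have per: "\<pi> permutes {1..n}" and edges: "\<And>i. i \<in> {1..n} \<Longrightarrow> (i, \<pi> i) \<in> E"
    using assms by (auto simp: perfect_matchings_def)
  note ip = permutes_inverses[OF per]
  have B: "B i (inv \<tau> (\<pi> (\<sigma> i)))" for i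
  proof (cases "i \<in> {1..n}")
    case True
    then have 1: "\<sigma> i \<in> {1..n}" using permutes_in_image[OF \<sigma>] by blast
    then have "\<pi> (\<sigma> i) \<in> {1..n}" using permutes_in_image[OF per] by blast
    then have "inv \<tau> (\<pi> (\<sigma> i)) \<in> {1..n}" using permutes_in_image[OF permutes_inv[OF \<tau>]] by blast
    then show ?thesis using True edges[OF 1] by (simp add: B_def F_def inv_simps)
  next
    case False
    then have "inv \<tau> (\<pi> (\<sigma> i)) = i"
      using permutes_outside[OF \<sigma>] permutes_outside[OF per] permutes_outside[OF permutes_inv[OF \<tau>]] by metis
    then show ?thesis using False by (simp add: B_def)
  qed
  have "emb \<pi> (emb \<pi> v) = v \<and> even (emb \<pi> v) \<noteq> even v \<and> A v (emb \<pi> v)" for v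
  proof (cases "even v")
    case True
    then show ?thesis
      using B[of "v div 2"] by (simp add: emb_def A_def inv_simps ip)
  next
    case False
    then show ?thesis
      using B[of "inv \<sigma> (inv \<pi> (\<tau> (v div 2)))"] by (simp add: emb_def A_def inv_simps ip)
  qed
  then show ?thesis by (simp add: K_def)
qed

lemma emb_eq_iff: "emb \<pi> (2 * inv \<sigma> i) = emb \<pi>' (2 * inv \<sigma> i) \<longleftrightarrow> \<pi> i = \<pi>' i"
  by (simp add: emb_def inv_simps inj_eq[OF permutes_inj[OF permutes_inv[OF \<tau>]]])

lemma emb_bij: "bij_betw emb \<Omega> K"
  unfolding bij_betw_def
proof
  show "inj_on emb \<Omega>"
    by (rule inj_onI, rule ext) (metis emb_eq_iff)
  show "emb ` \<Omega> = K"
  proof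
    show "emb ` \<Omega> \<subseteq> K" using emb_in_K by blast
    show "K \<subseteq> emb ` \<Omega>"
    proof
      fix f assume f: "f \<in> K"
      define h where "h i = f (2 * i) div 2" for i
      define h' where "h' i = f (Suc (2 * i)) div 2" for i
      have fh: "f (2 * i) = Suc (2 * h i)" for i
        using KD(2)[OF f, of "2 * i"] by (simp add: h_def)
      have fh': "f (Suc (2 * i)) = 2 * h' i" for i
        using KD(2)[OF f, of "Suc (2 * i)"] by (simp add: h'_def)
      have hh: "h' (h i) = i" for i
        using KD(1)[OF f, of "2 * i"] by (simp add: fh fh')
      have hh': "h (h' i) = i" for i
        using KD(1)[OF f, of "Suc (2 * i)"] by (simp add: fh fh')
      have B: "B i (h i)" for i
        using KD(3)[OF f, of "2 * i"] by (simp add: fh A_def)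
      have h: "h permutes {1..n}"
        unfolding permutes_def
      proof (intro conjI allI impI)
        show "h i = i" if "i \<notin> {1..n}" for i using B[of i] that by (auto simp: B_def F_def)
        show "\<exists>!i. h i = j" for j using hh hh' by metis
      qed
      define \<pi> where "\<pi> = \<tau> \<circ> (h \<circ> inv \<sigma>)"
      have per: "\<pi> permutes {1..n}"
        unfolding \<pi>_def by (intro permutes_compose permutes_inv \<sigma> \<tau> h)
      have "(i, \<pi> i) \<in> E" if "i \<in> {1..n}" for i
      proof -
        have "inv \<sigma> i \<in> {1..n}" using that permutes_in_image[OF permutes_inv[OF \<sigma>]] by blast
        then show ?thesis using B[of "inv \<sigma> i"] by (simp add: B_def F_def \<pi>_def inv_simps)
      qed
      then have \<pi>: "\<pi> \<in> \<Omega>" using per by (simp add: perfect_matchings_def)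
      have ev: "emb \<pi> (2 * i) = f (2 * i)" for i
        by (simp add: emb_def \<pi>_def inv_simps fh)
      have "emb \<pi> v = f v" for v
      proof (cases "even v")
        case True
        then show ?thesis using ev[of "v div 2"] by simp
      next
        case False
        then have "even (f v)" using KD(2)[OF f] by simp
        then have "emb \<pi> (f v) = f (f v)" using ev[of "f v div 2"] by simp
        then show ?thesis using KD(1)[OF f] K_eq_iff[OF emb_in_K[OF \<pi>]] by metis
      qed
      then have "f = emb \<pi>" by (intro ext) simp
      then show "f \<in> emb ` \<Omega>" using \<pi> by blast
    qed
  qed
qed

lemma finite_\<Omega>: "finite \<Omega>"
  by (rule finite_subset[OF _ finite_permutations[of "{1..n}"]]) (auto simp: perfect_matchings_def)

lemma finite_K: "finite K"
  using emb_bij finite_\<Omega> bij_betw_finite by blast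

lemma permutations_differ_by_swap:
  fixes \<pi> :: "nat \<Rightarrow> nat"
  assumes "\<pi> permutes S" "\<pi>' permutes S" "\<pi> \<noteq> \<pi>'" and eq: "\<And>i. i \<notin> {a, b} \<Longrightarrow> \<pi> i = \<pi>' i"
  shows "a \<noteq> b \<and> a \<in> S \<and> b \<in> S \<and> \<pi>' a = \<pi> b \<and> \<pi>' b = \<pi> a"
proof -
  have inj: "\<pi> i = \<pi> j \<longleftrightarrow> i = j" "\<pi>' i = \<pi>' j \<longleftrightarrow> i = j" for i j
    using permutes_inj assms(1,2) by (blast dest: injD)+
  have val: "\<pi>' i \<in> {\<pi> a, \<pi> b}" if "i \<in> {a, b}" for i
  proof -
    obtain c where c: "\<pi> c = \<pi>' i" using permutes_surj[OF assms(1)] by (metis surjD)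
    then have "c \<in> {a, b}" using eq[of c] inj that by auto
    then show ?thesis using c by auto
  qed
  have "\<not> (\<pi> a = \<pi>' a \<and> \<pi> b = \<pi>' b)"
  proof
    assume "\<pi> a = \<pi>' a \<and> \<pi> b = \<pi>' b"
    then have "\<pi> i = \<pi>' i" for i using eq by (cases "i \<in> {a, b}") auto
    then show False using assms(3) by blast
  qed
  moreover from this have "a \<noteq> b" using val[of a] by auto
  moreover from this have "\<pi>' a \<noteq> \<pi>' b" by (simp add: inj)
  ultimately have *: "a \<noteq> b" "\<pi>' a = \<pi> b" "\<pi>' b = \<pi> a"
    using val[of a] val[of b] by auto
  then have "\<pi> a \<noteq> \<pi>' a" "\<pi> b \<noteq> \<pi>' b" using inj by auto
  then have "a \<in> S" "b \<in> S" using assms(1,2) by (metis permutes_outside)+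
  with * show ?thesis by blast
qed

text \<open>Two permutations that differ in two rows at most, and are distinct, exchange the
  partners of these rows. The new edges belong to the graph because \<open>\<pi>'\<close> is a
  matching, so the chain accepts the switch.\<close>

lemma adj_switch:
  assumes \<pi>: "\<pi> \<in> \<Omega>" "\<pi>' \<in> \<Omega>" "\<pi> \<noteq> \<pi>'" and "adj (emb \<pi>) (emb \<pi>')"
  shows "\<exists>u\<in>{1..n} \<times> {1..n}. \<pi>' = switch E (fst u) (snd u) \<pi>"
proof -
  obtain p q where pq: "\<And>v. even v \<Longrightarrow> v \<notin> {p, q} \<Longrightarrow> emb \<pi> v = emb \<pi>' v"
    using assms(4) unfolding adj_def by blast
  define a b where "a = \<sigma> (p div 2)" and "b = \<sigma> (q div 2)"
  have eq: "\<pi> i = \<pi>' i" if "i \<notin> {a, b}" for i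
  proof -
    have "2 * inv \<sigma> i \<notin> {p, q}"
    proof
      assume "2 * inv \<sigma> i \<in> {p, q}"
      then have "inv \<sigma> i = p div 2 \<or> inv \<sigma> i = q div 2" by auto
      then have "\<sigma> (inv \<sigma> i) \<in> {a, b}" by (auto simp: a_def b_def)
      then show False using that by (simp add: inv_simps)
    qed
    then show ?thesis using pq[of "2 * inv \<sigma> i"] emb_eq_iff by simp
  qed
  have per: "\<pi> permutes {1..n}" "\<pi>' permutes {1..n}"
    using \<pi>(1,2) by (simp_all add: perfect_matchings_def)
  have ab: "a \<noteq> b" "a \<in> {1..n}" "b \<in> {1..n}" "\<pi>' a = \<pi> b" "\<pi>' b = \<pi> a"
    using permutations_differ_by_swap[OF per \<pi>(3) eq] by blast+
  have "(a, \<pi> b) \<in> E" "(b, \<pi> a) \<in> E"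
    using \<pi>(2) ab unfolding perfect_matchings_def by (metis (mono_tags, lifting) mem_Collect_eq)+
  moreover have "\<pi>' = \<pi>(a := \<pi> b, b := \<pi> a)"
    using eq ab by (intro ext) auto
  ultimately have "\<pi>' = switch E a b \<pi>" using ab(1) by (simp add: switch_def)
  then show ?thesis using ab by (intro bexI[of _ "(a, b)"]) auto
qed

theorem graph_poincare:
  fixes f :: "(nat \<Rightarrow> nat) \<Rightarrow> real"
  shows "(\<Sum>x\<in>\<Omega>. \<Sum>y\<in>\<Omega>. (f x - f y)\<^sup>2) \<le> 8 * real n ^ 4 * real (card \<Omega>) *
    (\<Sum>z\<in>\<Omega>. \<Sum>u\<in>{1..n} \<times> {1..n}. (f z - f (switch E (fst u) (snd u) z))\<^sup>2)"
proof -
  define g where "g = f \<circ> inv_into \<Omega> emb"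
  have g: "g (emb z) = f z" if "z \<in> \<Omega>" for z
    using that emb_bij by (simp add: g_def bij_betw_def)
  note reindex = sum.reindex_bij_betw[OF emb_bij, symmetric]
  have "(\<Sum>x\<in>\<Omega>. \<Sum>y\<in>\<Omega>. (f x - f y)\<^sup>2) = (\<Sum>x\<in>K. \<Sum>y\<in>K. (g x - g y)\<^sup>2)"
    by (simp add: reindex g)
  also have "\<dots> \<le> 8 * real n ^ 4 * real (card K) * (\<Sum>z\<in>K. \<Sum>z' | z' \<in> K \<and> adj z z'. (g z - g z')\<^sup>2)"
    by (rule poincare[OF finite_K card_V])
  also have "card K = card \<Omega>" using bij_betw_same_card[OF emb_bij] by simp
  also have "(\<Sum>z\<in>K. \<Sum>z' | z' \<in> K \<and> adj z z'. (g z - g z')\<^sup>2) =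
      (\<Sum>z\<in>\<Omega>. \<Sum>z' | z' \<in> \<Omega> \<and> adj (emb z) (emb z'). (f z - f z')\<^sup>2)"
  proof -
    have "(\<Sum>z\<in>K. \<Sum>z' | z' \<in> K \<and> adj z z'. (g z - g z')\<^sup>2) =
        (\<Sum>z\<in>K. \<Sum>z'\<in>K. if adj z z' then (g z - g z')\<^sup>2 else 0)"
      using finite_K by (simp add: sum.inter_filter)
    also have "\<dots> = (\<Sum>z\<in>\<Omega>. \<Sum>z'\<in>\<Omega>. if adj (emb z) (emb z') then (f z - f z')\<^sup>2 else 0)"
      by (simp add: reindex g cong: if_cong)
    finally show ?thesis using finite_\<Omega> by (simp add: sum.inter_filter)
  qed
  also have "\<dots> \<le> (\<Sum>z\<in>\<Omega>. \<Sum>u\<in>{1..n} \<times> {1..n}. (f z - f (switch E (fst u) (snd u) z))\<^sup>2)"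
  proof (rule sum_mono)
    fix z assume z: "z \<in> \<Omega>"
    let ?U = "{1..n} \<times> {1..n}" and ?s = "\<lambda>u. switch E (fst u) (snd u) z"
    have "(\<Sum>z' | z' \<in> \<Omega> \<and> adj (emb z) (emb z'). (f z - f z')\<^sup>2) =
        (\<Sum>z' | z' \<in> \<Omega> \<and> adj (emb z) (emb z') \<and> z \<noteq> z'. (f z - f z')\<^sup>2)"
      by (rule sum.mono_neutral_right) (use finite_\<Omega> in auto)
    also have "\<dots> \<le> (\<Sum>z'\<in>?s ` ?U. (f z - f z')\<^sup>2)"
    proof (rule sum_mono2)
      show "{z'. z' \<in> \<Omega> \<and> adj (emb z) (emb z') \<and> z \<noteq> z'} \<subseteq> ?s ` ?U"
      proof
        fix z' assume "z' \<in> {z'. z' \<in> \<Omega> \<and> adj (emb z) (emb z') \<and> z \<noteq> z'}"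
        then obtain u where "u \<in> ?U" "z' = ?s u" using adj_switch[OF z, of z'] by blast
        then show "z' \<in> ?s ` ?U" by blast
      qed
    qed simp_all
    \<comment> \<open>Several pairs may lead to the same state; all terms are nonnegative.\<close>
    also have "\<dots> \<le> (\<Sum>u\<in>?U. (f z - f (?s u))\<^sup>2)"
      by (rule sum_image_le[where g = "\<lambda>z'. (f z - f z')\<^sup>2", unfolded comp_def]) auto
    finally show "(\<Sum>z' | z' \<in> \<Omega> \<and> adj (emb z) (emb z'). (f z - f z')\<^sup>2) \<le> (\<Sum>u\<in>?U. (f z - f (?s u))\<^sup>2)" .
  qed
  finally show ?thesis by (simp add: mult_left_mono)
qed

end

section \<open>The switch chain\<close>

context monotone_matching
begin

abbreviation "U \<equiv> {1..n} \<times> {1..n}"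
abbreviation "sw \<equiv> (\<lambda>u. switch E (fst u) (snd u))"

lemma switch_permutes: "\<pi> permutes S \<Longrightarrow> i \<in> S \<Longrightarrow> j \<in> S \<Longrightarrow> \<pi>(i := \<pi> j, j := \<pi> i) permutes S"
proof -
  assume \<pi>: "\<pi> permutes S" and "i \<in> S" "j \<in> S"
  have "\<pi>(i := \<pi> j, j := \<pi> i) = \<pi> \<circ> Transposition.transpose i j"
    by (auto simp: Transposition.transpose_def)
  then show ?thesis
    using permutes_compose[OF permutes_swap_id[OF \<open>i \<in> S\<close> \<open>j \<in> S\<close>] \<pi>] by simp
qed

lemma sw_mem:
  assumes "\<pi> \<in> \<Omega>" "u \<in> U"
  shows "sw u \<pi> \<in> \<Omega>"
proof -
  obtain i j where u: "u = (i, j)" "i \<in> {1..n}" "j \<in> {1..n}" using assms(2) by auto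
  have \<pi>: "\<pi> permutes {1..n}" "\<And>i. i \<in> {1..n} \<Longrightarrow> (i, \<pi> i) \<in> E"
    using assms(1) by (auto simp: perfect_matchings_def)
  show ?thesis
  proof (cases "i \<noteq> j \<and> (i, \<pi> j) \<in> E \<and> (j, \<pi> i) \<in> E")
    case True
    have "(k, (\<pi>(i := \<pi> j, j := \<pi> i)) k) \<in> E" if "k \<in> {1..n}" for k
      using True \<pi>(2)[OF that] by simp
    then show ?thesis
      using True switch_permutes[OF \<pi>(1) u(2,3)] unfolding perfect_matchings_def u(1) switch_def
      by simp
  next
    case False
    then show ?thesis unfolding u(1) switch_def using assms(1) by auto
  qed
qed

lemma sw_sw:
  assumes "\<pi> \<in> \<Omega>" "u \<in> U"
  shows "sw u (sw u \<pi>) = \<pi>"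
proof -
  obtain i j where u: "u = (i, j)" "i \<in> {1..n}" "j \<in> {1..n}" using assms(2) by auto
  have E: "(i, \<pi> i) \<in> E" "(j, \<pi> j) \<in> E" using assms(1) u by (auto simp: perfect_matchings_def)
  show ?thesis
  proof (cases "i \<noteq> j \<and> (i, \<pi> j) \<in> E \<and> (j, \<pi> i) \<in> E")
    case True
    then show ?thesis using E by (auto simp: u(1) switch_def)
  next
    case False
    then show ?thesis unfolding u(1) switch_def by auto
  qed
qed

lemma sum_sw:
  fixes f :: "(nat \<Rightarrow> nat) \<Rightarrow> real"
  assumes "u \<in> U"
  shows "(\<Sum>z\<in>\<Omega>. f (sw u z)) = (\<Sum>z\<in>\<Omega>. f z)"
  by (rule sum.reindex_bij_witness[of _ "sw u" "sw u"]) (use sw_sw sw_mem assms in auto)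

section \<open>Spectral bounds for the transition operator\<close>

definition ip :: "((nat \<Rightarrow> nat) \<Rightarrow> real) \<Rightarrow> ((nat \<Rightarrow> nat) \<Rightarrow> real) \<Rightarrow> real" where
  "ip f g = (\<Sum>z\<in>\<Omega>. f z * g z)"

definition P :: "((nat \<Rightarrow> nat) \<Rightarrow> real) \<Rightarrow> (nat \<Rightarrow> nat) \<Rightarrow> real" where
  "P f z = (\<Sum>u\<in>U. f (sw u z)) / real n ^ 2"

lemma ip_commute: "ip f g = ip g f"
  by (simp add: ip_def mult.commute)

lemma ip_add: "ip (\<lambda>z. f z + g z) h = ip f h + ip g h"
  by (simp add: ip_def algebra_simps sum.distrib)

lemma ip_diff: "ip (\<lambda>z. f z - g z) h = ip f h - ip g h"
  by (simp add: ip_def algebra_simps sum_subtractf)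

lemma ip_scale: "ip (\<lambda>z. c * f z) h = c * ip f h"
  by (simp add: ip_def sum_distrib_left mult.assoc)

lemma ip_add_right: "ip h (\<lambda>z. f z + g z) = ip h f + ip h g"
  by (simp add: ip_def algebra_simps sum.distrib)

lemma ip_diff_right: "ip h (\<lambda>z. f z - g z) = ip h f - ip h g"
  by (simp add: ip_def algebra_simps sum_subtractf)

lemma ip_scale_right: "ip h (\<lambda>z. c * f z) = c * ip h f"
  by (simp add: ip_def sum_distrib_left mult.left_commute)

lemmas ip_simps = ip_add ip_diff ip_scale ip_add_right ip_diff_right ip_scale_right

lemma ip_nonneg: "0 \<le> ip f f"
  by (simp add: ip_def sum_nonneg)

lemma P_add: "P (\<lambda>z. f z + g z) = (\<lambda>z. P f z + P g z)"
  by (intro ext) (simp add: P_def sum.distrib add_divide_distrib)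

lemma P_diff: "P (\<lambda>z. f z - g z) = (\<lambda>z. P f z - P g z)"
  by (intro ext) (simp add: P_def sum_subtractf diff_divide_distrib)

lemma P_scale: "P (\<lambda>z. c * f z) = (\<lambda>z. c * P f z)"
  by (intro ext) (simp add: P_def flip: sum_distrib_left)

lemma ip_P: "ip f (P g) = (\<Sum>u\<in>U. ip f (\<lambda>z. g (sw u z))) / real n ^ 2"
proof -
  have "ip f (P g) = (\<Sum>z\<in>\<Omega>. \<Sum>u\<in>U. f z * g (sw u z)) / real n ^ 2"
    by (simp add: ip_def P_def sum_distrib_left sum_divide_distrib)
  also have "(\<Sum>z\<in>\<Omega>. \<Sum>u\<in>U. f z * g (sw u z)) = (\<Sum>u\<in>U. \<Sum>z\<in>\<Omega>. f z * g (sw u z))"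
    by (rule sum.swap)
  finally show ?thesis by (simp add: ip_def)
qed

text \<open>Every \<open>sw u\<close> is an involution of \<Omega>, so the substitution
  \<open>z := sw u z\<close> moves it from one factor to the other.\<close>

lemma P_self_adjoint: "ip f (P g) = ip (P f) g"
proof -
  have "ip f (\<lambda>z. g (sw u z)) = ip g (\<lambda>z. f (sw u z))" if u: "u \<in> U" for u
  proof -
    have "ip f (\<lambda>z. g (sw u z)) = (\<Sum>z\<in>\<Omega>. f (sw u z) * g (sw u (sw u z)))"
      unfolding ip_def using sum_sw[OF u, of "\<lambda>z. f z * g (sw u z)"] by simp
    also have "\<dots> = (\<Sum>z\<in>\<Omega>. g z * f (sw u z))"
      using sw_sw[OF _ u] by (intro sum.cong) auto
    finally show ?thesis by (simp add: ip_def)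
  qed
  then have "ip f (P g) = ip g (P f)" by (simp add: ip_P cong: sum.cong)
  then show ?thesis by (simp add: ip_commute)
qed

lemma sum_P:
  assumes "n > 0"
  shows "(\<Sum>z\<in>\<Omega>. P f z) = (\<Sum>z\<in>\<Omega>. f z)"
proof -
  have "(\<Sum>z\<in>\<Omega>. P f z) = (\<Sum>z\<in>\<Omega>. \<Sum>u\<in>U. f (sw u z)) / real n ^ 2"
    by (simp add: P_def sum_divide_distrib)
  also have "(\<Sum>z\<in>\<Omega>. \<Sum>u\<in>U. f (sw u z)) = (\<Sum>u\<in>U. \<Sum>z\<in>\<Omega>. f (sw u z))"
    by (rule sum.swap)
  also have "\<dots> = (\<Sum>u\<in>U. \<Sum>z\<in>\<Omega>. f z)"
    by (rule sum.cong) (use sum_sw in auto)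
  finally show ?thesis using assms by (simp add: power2_eq_square card_cartesian_product)
qed

lemma ip_sw_sw: "u \<in> U \<Longrightarrow> ip (\<lambda>z. f (sw u z)) (\<lambda>z. f (sw u z)) = ip f f"
  unfolding ip_def using sum_sw[of u "\<lambda>z. f z * f z"] by simp

text \<open>For mean zero, the left side of \<open>graph_poincare\<close> is
  \<open>2 * card \<Omega> * ip f f\<close>. Its sum over the switches is 2 n^2 times the Dirichlet
  form, which raises n^4 to n^6.\<close>

lemma P_gap_above:
  assumes n: "n > 0" and mean: "(\<Sum>z\<in>\<Omega>. f z) = 0"
  shows "ip f f \<le> 8 * real n ^ 6 * (ip f f - ip f (P f))"
proof -
  have N: "card \<Omega> > 0" using finite_\<Omega> matching by (simp add: card_gt_0_iff)
  have "(\<Sum>x\<in>\<Omega>. \<Sum>y\<in>\<Omega>. (f x - f y)\<^sup>2) = 2 * real (card \<Omega>) * ip f f"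
  proof -
    have "(\<Sum>y\<in>\<Omega>. (f x - f y)\<^sup>2) = real (card \<Omega>) * (f x * f x) + ip f f" for x
    proof -
      have "(\<Sum>y\<in>\<Omega>. (f x - f y)\<^sup>2) = (\<Sum>y\<in>\<Omega>. f x * f x - 2 * f x * f y + f y * f y)"
        by (simp add: power2_eq_square algebra_simps)
      also have "\<dots> = real (card \<Omega>) * (f x * f x) - 2 * f x * (\<Sum>y\<in>\<Omega>. f y) + ip f f"
        by (simp add: sum.distrib sum_subtractf sum_distrib_left ip_def)
      finally show ?thesis using mean by simp
    qed
    then show ?thesis by (simp add: sum.distrib ip_def flip: sum_distrib_left)
  qed
  moreover have "(\<Sum>z\<in>\<Omega>. \<Sum>u\<in>U. (f z - f (sw u z))\<^sup>2) = 2 * real n ^ 2 * (ip f f - ip f (P f))"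
  proof -
    have "(\<Sum>z\<in>\<Omega>. \<Sum>u\<in>U. (f z - f (sw u z))\<^sup>2) = (\<Sum>u\<in>U. \<Sum>z\<in>\<Omega>. (f z - f (sw u z))\<^sup>2)"
      by (rule sum.swap)
    also have "\<dots> = (\<Sum>u\<in>U. 2 * ip f f - 2 * ip f (\<lambda>z. f (sw u z)))"
    proof (rule sum.cong[OF refl])
      fix u assume u: "u \<in> U"
      have "(\<Sum>z\<in>\<Omega>. (f z - f (sw u z))\<^sup>2) = ip (\<lambda>z. f z - f (sw u z)) (\<lambda>z. f z - f (sw u z))"
        by (simp add: ip_def power2_eq_square)
      also have "\<dots> = 2 * ip f f - 2 * ip f (\<lambda>z. f (sw u z))"
        using ip_sw_sw[OF u, of f] ip_commute[of f "\<lambda>z. f (sw u z)"]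
        by (simp add: ip_simps)
      finally show "(\<Sum>z\<in>\<Omega>. (f z - f (sw u z))\<^sup>2) = 2 * ip f f - 2 * ip f (\<lambda>z. f (sw u z))" .
    qed
    also have "\<dots> = 2 * real n ^ 2 * ip f f - 2 * (\<Sum>u\<in>U. ip f (\<lambda>z. f (sw u z)))"
      by (simp add: sum_subtractf power2_eq_square card_cartesian_product sum_distrib_left)
    finally show ?thesis using n by (simp add: ip_P algebra_simps)
  qed
  ultimately have "2 * real (card \<Omega>) * ip f f \<le>
      8 * real n ^ 4 * real (card \<Omega>) * (2 * real n ^ 2 * (ip f f - ip f (P f)))"
    using graph_poincare[of f] by simp
  also have "\<dots> = 2 * real (card \<Omega>) * (8 * real n ^ 6 * (ip f f - ip f (P f)))"
    by (simp add: algebra_simps power_numeral_reduce)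
  finally show ?thesis using N by simp
qed

text \<open>The n pairs \<open>(i, i)\<close> act as the identity and contribute
  \<open>ip f f\<close> each; the other n^2 - n pairs contribute at least \<open>- ip f f\<close>
  each.\<close>

lemma P_gap_below:
  assumes n: "n > 0"
  shows "ip f (P f) \<ge> - (1 - 2 / real n) * ip f f"
proof -
  let ?d = "\<lambda>u. (if fst u = snd u then 2 * ip f f else 0) - ip f f"
  have "ip f (\<lambda>z. f (sw u z)) \<ge> ?d u" if u: "u \<in> U" for u
  proof (cases "fst u = snd u")
    case True
    then show ?thesis by (simp add: switch_def)
  next
    case False
    have "0 \<le> ip (\<lambda>z. f z + f (sw u z)) (\<lambda>z. f z + f (sw u z))" by (rule ip_nonneg)
    also have "\<dots> = 2 * ip f f + 2 * ip f (\<lambda>z. f (sw u z))"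
      using ip_sw_sw[OF u, of f] ip_commute[of f "\<lambda>z. f (sw u z)"]
      by (simp add: ip_simps)
    finally show ?thesis using False by simp
  qed
  then have "(\<Sum>u\<in>U. ?d u) \<le> (\<Sum>u\<in>U. ip f (\<lambda>z. f (sw u z)))" by (rule sum_mono)
  also have "(\<Sum>u\<in>U. ?d u) = (2 * real n - real n ^ 2) * ip f f"
  proof -
    have "(\<Sum>u\<in>U. if fst u = snd u then 2 * ip f f else 0) = (\<Sum>i\<in>{1..n}. \<Sum>j\<in>{1..n}. if i = j then 2 * ip f f else 0)"
      by (simp only: sum.cartesian_product split_def)
    also have "\<dots> = 2 * real n * ip f f" by simp
    finally show ?thesis by (simp add: sum_subtractf power2_eq_square card_cartesian_product algebra_simps)
  qed
  finally have "(2 * real n - real n ^ 2) * ip f f / real n ^ 2 \<le> ip f (P f)"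
    unfolding ip_P by (rule divide_right_mono) simp
  moreover have "(2 * real n - real n ^ 2) * ip f f / real n ^ 2 = - (1 - 2 / real n) * ip f f"
    using n by (simp add: field_simps power2_eq_square)
  ultimately show ?thesis by simp
qed

definition lam :: real where "lam = 1 - 1 / (8 * real n ^ 6)"

text \<open>By the third bound \<open>- lam\<close> lies below the spectrum as well, so one constant
  controls both sides.\<close>

lemma lam_bounds: assumes "n > 0" shows "0 < lam" "lam < 1" "1 - 2 / real n \<le> lam"
proof -
  have n: "1 \<le> real n" using assms by simp
  have n6: "real n \<le> real n ^ 6" using self_le_power[of "real n" 6] n by simp
  then have "1 < 8 * real n ^ 6" using n by linarith
  then show "0 < lam" unfolding lam_def using n by (simp add: divide_less_eq)
  show "lam < 1" using n unfolding lam_def by simp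
  have "real n \<le> 16 * real n ^ 6" using n n6 by linarith
  then have "1 / (8 * real n ^ 6) \<le> 2 / real n"
    using n by (simp add: field_simps)
  then show "1 - 2 / real n \<le> lam" unfolding lam_def by simp
qed

text \<open>
  With \<open>B = lam - P\<close> and \<open>C = lam + P\<close>, both positive semidefinite on functions of mean zero,
  \<open>2 lam (lam\<^sup>2 - P\<^sup>2) = (B + C) B C = B C B + C B C\<close> is positive semidefinite.
\<close>

lemma P_contraction:
  assumes n: "n > 0" and mean: "(\<Sum>z\<in>\<Omega>. f z) = 0"
  shows "ip (P f) (P f) \<le> lam ^ 2 * ip f f"
proof -
  have above: "ip g (P g) \<le> lam * ip g g" if "(\<Sum>z\<in>\<Omega>. g z) = 0" for g
  proof -
    have "ip g g / (8 * real n ^ 6) \<le> ip g g - ip g (P g)"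
      using P_gap_above[OF n that] n by (simp add: field_simps)
    then show ?thesis by (simp add: lam_def algebra_simps)
  qed
  have below: "ip g (P g) \<ge> - lam * ip g g" for g
  proof -
    have "(1 - 2 / real n) * ip g g \<le> lam * ip g g"
      using lam_bounds(3)[OF n] ip_nonneg by (rule mult_right_mono)
    then show ?thesis using P_gap_below[OF n, of g] unfolding mult_minus_left by linarith
  qed
  define u v where "u = (\<lambda>z. lam * f z - P f z)" and "v = (\<lambda>z. lam * f z + P f z)"
  have mean_v: "(\<Sum>z\<in>\<Omega>. v z) = 0"
    using mean sum_P[OF n, of f] by (simp add: v_def sum.distrib flip: sum_distrib_left)
  define a b c d where "a = ip f f" and "b = ip (P f) (P f)" and "c = ip f (P f)" and "d = ip (P f) (P (P f))"
  have c': "ip (P f) f = c" and b': "ip f (P (P f)) = b"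
    using ip_commute P_self_adjoint by (simp_all add: c_def b_def)
  have Pu: "P u = (\<lambda>z. lam * P f z - P (P f) z)" and Pv: "P v = (\<lambda>z. lam * P f z + P (P f) z)"
    by (simp_all add: u_def v_def P_diff P_add P_scale)
  have uu: "ip u u = lam ^ 2 * a - 2 * lam * c + b" and vv: "ip v v = lam ^ 2 * a + 2 * lam * c + b"
    unfolding u_def v_def
    by (simp_all add: ip_simps c' flip: a_def b_def c_def) (simp_all add: algebra_simps power2_eq_square)
  have uPu: "ip u (P u) = lam ^ 2 * c - 2 * lam * b + d" and vPv: "ip v (P v) = lam ^ 2 * c + 2 * lam * b + d"
    unfolding Pu Pv unfolding u_def v_def
    by (simp_all add: ip_simps b' flip: b_def c_def d_def) (simp_all add: algebra_simps power2_eq_square)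
  have "0 \<le> (lam * ip u u + ip u (P u)) + (lam * ip v v - ip v (P v))"
    using below[of u] above[OF mean_v] by simp
  also have "\<dots> = 2 * lam * (lam ^ 2 * a - b)"
    unfolding uu vv uPu vPv by (simp add: algebra_simps)
  finally show ?thesis
    using lam_bounds(1)[OF n] by (simp add: zero_le_mult_iff a_def b_def)
qed

section \<open>From the contraction to the mixing time\<close>

lemma set_switch_steps: "x \<in> \<Omega> \<Longrightarrow> n > 0 \<Longrightarrow> set_pmf (switch_steps n E t x) \<subseteq> \<Omega>"
proof (induction t)
  case (Suc t)
  have U: "finite U" "U \<noteq> {}" using Suc.prems by auto
  show ?case
  proof
    fix y assume "y \<in> set_pmf (switch_steps n E (Suc t) x)"
    then obtain z u where "z \<in> set_pmf (switch_steps n E t x)" "u \<in> U" "y = sw u z"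
      using U by (auto simp: switch_step_def set_pmf_of_set)
    then show "y \<in> \<Omega>" using sw_mem[of z u] Suc by auto
  qed
qed simp

text \<open>As \<open>sw u\<close> is its own inverse, arriving at \<open>y\<close> by the choice
  \<open>u\<close> means coming from \<open>sw u y\<close>. Hence distributions evolve by the same
  operator \<open>P\<close> as functions.\<close>

lemma pmf_switch_steps_Suc:
  assumes "n > 0" "x \<in> \<Omega>" "y \<in> \<Omega>"
  shows "pmf (switch_steps n E (Suc t) x) y = P (pmf (switch_steps n E t x)) y"
proof -
  let ?p = "switch_steps n E t x"
  have U: "finite U" "U \<noteq> {}" using assms(1) by auto
  have "switch_steps n E (Suc t) x = bind_pmf ?p (\<lambda>z. bind_pmf (pmf_of_set U) (\<lambda>u. return_pmf (sw u z)))"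
  proof -
    have "switch_step n E = (\<lambda>z. bind_pmf (pmf_of_set U) (\<lambda>u. return_pmf (sw u z)))"
      by (intro ext) (simp add: switch_step_def map_pmf_def case_prod_beta)
    then show ?thesis by simp
  qed
  also have "\<dots> = bind_pmf (pmf_of_set U) (\<lambda>u. map_pmf (sw u) ?p)"
    by (subst bind_commute_pmf) (simp add: map_pmf_def)
  finally have "pmf (switch_steps n E (Suc t) x) y = (\<Sum>u\<in>U. pmf (map_pmf (sw u) ?p) y) / real (card U)"
    by (simp only: pmf_bind_pmf_of_set[OF U(2,1)])
  also have "(\<Sum>u\<in>U. pmf (map_pmf (sw u) ?p) y) = (\<Sum>u\<in>U. pmf ?p (sw u y))"
  proof (rule sum.cong[OF refl])
    fix u assume u: "u \<in> U"
    have supp: "set_pmf ?p \<subseteq> \<Omega>" using set_switch_steps assms by blast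
    have sw: "sw u y \<in> \<Omega>" "sw u (sw u y) = y" using sw_mem[OF assms(3) u] sw_sw[OF assms(3) u] by auto
    have "pmf (map_pmf (sw u) ?p) y = measure ?p (sw u -` {y})"
      by (simp add: pmf_map)
    also have "\<dots> = measure ?p ((sw u -` {y}) \<inter> set_pmf ?p)"
      by (simp add: measure_Int_set_pmf)
    also have "(sw u -` {y}) \<inter> set_pmf ?p = {sw u y} \<inter> set_pmf ?p"
      using supp sw sw_sw[OF _ u] by auto
    also have "measure ?p \<dots> = pmf ?p (sw u y)"
      by (simp only: measure_Int_set_pmf measure_pmf_single)
    finally show "pmf (map_pmf (sw u) ?p) y = pmf ?p (sw u y)" .
  qed
  finally show ?thesis by (simp add: P_def card_cartesian_product power2_eq_square)
qed

definition dev :: "(nat \<Rightarrow> nat) \<Rightarrow> nat \<Rightarrow> (nat \<Rightarrow> nat) \<Rightarrow> real" where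
  "dev x t z = pmf (switch_steps n E t x) z - 1 / real (card \<Omega>)"

lemma card_\<Omega>_pos: "0 < card \<Omega>"
  using finite_\<Omega> matching by (simp add: card_gt_0_iff)

lemma sum_dev:
  assumes "n > 0" "x \<in> \<Omega>"
  shows "(\<Sum>z\<in>\<Omega>. dev x t z) = 0"
proof -
  have "(\<Sum>z\<in>\<Omega>. pmf (switch_steps n E t x) z) = 1"
    using sum_pmf_eq_1[OF finite_\<Omega> set_switch_steps] assms by blast
  then show ?thesis using card_\<Omega>_pos by (simp add: dev_def sum_subtractf)
qed

lemma dev_Suc:
  assumes "n > 0" "x \<in> \<Omega>" "z \<in> \<Omega>"
  shows "dev x (Suc t) z = P (dev x t) z"
proof -
  have "P (dev x t) z = P (pmf (switch_steps n E t x)) z - 1 / real (card \<Omega>)"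
    using assms(1) by (simp add: P_def dev_def sum_subtractf diff_divide_distrib card_cartesian_product power2_eq_square)
  then show ?thesis using pmf_switch_steps_Suc[OF assms] by (simp add: dev_def)
qed

lemma dev_norm:
  assumes "n > 0" "x \<in> \<Omega>"
  shows "ip (dev x t) (dev x t) \<le> (lam ^ t) ^ 2 * (1 - 1 / real (card \<Omega>))"
proof (induction t)
  case 0
  have "ip (dev x 0) (dev x 0) = (\<Sum>z\<in>\<Omega>. of_bool (z = x) * (1 - 2 / real (card \<Omega>)) + 1 / real (card \<Omega>) ^ 2)"
    unfolding ip_def dev_def
    by (rule sum.cong[OF refl]) (simp add: pmf_return indicator_def algebra_simps power2_eq_square)
  also have "\<dots> = 1 - 2 / real (card \<Omega>) + real (card \<Omega>) * (1 / real (card \<Omega>) ^ 2)"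
    using finite_\<Omega> assms(2) by (simp add: sum.distrib flip: sum_distrib_right)
  also have "\<dots> = 1 - 1 / real (card \<Omega>)"
    using card_\<Omega>_pos by (simp add: field_simps power2_eq_square)
  finally show ?case by simp
next
  case (Suc t)
  have "ip (dev x (Suc t)) (dev x (Suc t)) = ip (P (dev x t)) (P (dev x t))"
    unfolding ip_def using dev_Suc[OF assms] by (intro sum.cong) auto
  also have "\<dots> \<le> lam ^ 2 * ip (dev x t) (dev x t)"
    by (rule P_contraction[OF assms(1) sum_dev[OF assms]])
  also have "\<dots> \<le> lam ^ 2 * ((lam ^ t) ^ 2 * (1 - 1 / real (card \<Omega>)))"
    using Suc by (intro mult_left_mono) auto
  finally show ?case by (simp add: power_mult_distrib mult.assoc)
qed

text \<open>Cauchy-Schwarz over \<open>S\<close>. The factor \<open>1 - 1 / card \<Omega>\<close>,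
  inherited from the norm of \<open>dev x 0\<close>, makes the bound vanish if there is only one
  matching; the case n = 1 relies on this at time 0.\<close>

lemma switch_distance_le:
  assumes "n > 0" "x \<in> \<Omega>"
  shows "switch_distance n E t x \<le> sqrt (real (card \<Omega>) * (1 - 1 / real (card \<Omega>))) * lam ^ t"
proof -
  have "\<bar>measure_pmf.prob (switch_steps n E t x) S - measure_pmf.prob (switch_stationary n E) S\<bar> \<le>
      sqrt (real (card \<Omega>) * (1 - 1 / real (card \<Omega>))) * lam ^ t" if S: "S \<subseteq> \<Omega>" for S
  proof -
    have fin: "finite S" using S finite_\<Omega> finite_subset by blast
    have "measure_pmf.prob (switch_stationary n E) S = real (card S) / real (card \<Omega>)"
      using S matching finite_\<Omega> by (simp add: switch_stationary_def measure_pmf_of_set Int_absorb1)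
    then have eq: "measure_pmf.prob (switch_steps n E t x) S - measure_pmf.prob (switch_stationary n E) S =
        (\<Sum>z\<in>S. dev x t z)"
      using fin by (simp add: measure_measure_pmf_finite dev_def sum_subtractf)
    have "(\<Sum>z\<in>S. dev x t z)\<^sup>2 \<le> (\<Sum>z\<in>S. (dev x t z)\<^sup>2) * real (card S)"
      by (rule sum_squared_le_sum_of_squares)
    also have "\<dots> \<le> (\<Sum>z\<in>\<Omega>. (dev x t z)\<^sup>2) * real (card \<Omega>)"
      using S finite_\<Omega> by (intro mult_mono sum_mono2 of_nat_mono card_mono sum_nonneg) auto
    also have "(\<Sum>z\<in>\<Omega>. (dev x t z)\<^sup>2) = ip (dev x t) (dev x t)" by (simp add: ip_def power2_eq_square)
    also have "ip (dev x t) (dev x t) * real (card \<Omega>) \<le> (lam ^ t) ^ 2 * (1 - 1 / real (card \<Omega>)) * real (card \<Omega>)"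
      using dev_norm[OF assms] by (rule mult_right_mono) simp
    also have "\<dots> = (sqrt (real (card \<Omega>) * (1 - 1 / real (card \<Omega>))) * lam ^ t)\<^sup>2"
      using card_\<Omega>_pos by (simp add: power_mult_distrib)
    finally show ?thesis
      unfolding eq by (rule abs_le_square_iff[THEN iffD2, THEN order_trans]) (use lam_bounds[OF assms(1)] card_\<Omega>_pos in simp)
  qed
  then show ?thesis
    unfolding switch_distance_def using finite_\<Omega> by (subst Max_le_iff) auto
qed

text \<open>The square root halves the logarithm of \<open>card \<Omega>\<close>; this turns 8 n^6
  into 4 n^6.\<close>

lemma switch_distance_small:
  assumes n: "n > 0" and x: "x \<in> \<Omega>" and "\<epsilon> > 0"
    and t: "4 * real n ^ 6 * (ln (real (card \<Omega>)) + 2 * ln (inverse \<epsilon>)) \<le> real t"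
  shows "switch_distance n E t x \<le> \<epsilon>"
proof -
  let ?N = "real (card \<Omega>)"
  have N: "?N > 0" using card_\<Omega>_pos by simp
  have n6: "real n ^ 6 > 0" using n by simp
  have "lam ^ t \<le> exp (- 1 / (8 * real n ^ 6)) ^ t"
    using lam_bounds[OF n] exp_ge_add_one_self[of "- 1 / (8 * real n ^ 6)"]
    by (intro power_mono) (simp_all add: lam_def)
  also have "\<dots> = exp (- real t / (8 * real n ^ 6))"
    by (simp flip: exp_of_nat_mult)
  finally have lam: "lam ^ t \<le> exp (- real t / (8 * real n ^ 6))" .
  have "switch_distance n E t x \<le> sqrt (?N * (1 - 1 / ?N)) * lam ^ t"
    by (rule switch_distance_le[OF n x])
  also have "\<dots> \<le> sqrt ?N * exp (- real t / (8 * real n ^ 6))"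
    using lam lam_bounds[OF n] N by (intro mult_mono real_sqrt_le_mono) (simp_all add: field_simps)
  also have "sqrt ?N = exp (ln ?N / 2)"
    using N by (simp add: ln_sqrt exp_ln flip: ln_sqrt)
  also have "exp (ln ?N / 2) * exp (- real t / (8 * real n ^ 6)) = exp (ln ?N / 2 - real t / (8 * real n ^ 6))"
    by (simp flip: exp_add)
  also have "\<dots> \<le> exp (ln \<epsilon>)"
  proof -
    have "(ln ?N + 2 * ln (inverse \<epsilon>)) / 2 \<le> real t / (8 * real n ^ 6)"
      using t n6 by (simp add: field_simps)
    then have "ln ?N / 2 - real t / (8 * real n ^ 6) \<le> ln \<epsilon>"
      using \<open>\<epsilon> > 0\<close> by (simp add: ln_inverse add_divide_distrib diff_divide_distrib)
    then show ?thesis by (simp only: exp_le_cancel_iff)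
  qed
  finally show ?thesis using \<open>\<epsilon> > 0\<close> by simp
qed

lemma mixing_time_le:
  assumes "\<And>x. x \<in> \<Omega> \<Longrightarrow> switch_distance n E t x \<le> \<epsilon>"
  shows "mixing_time n E \<epsilon> \<le> enat t"
  unfolding mixing_time_def
  using finite_\<Omega> matching assms by (subst Max_le_iff) (auto intro!: INF_lower)

lemma card_\<Omega>_le: "card \<Omega> \<le> n ^ n"
proof -
  have "card \<Omega> \<le> card {\<pi>. \<pi> permutes {1..n}}"
    by (intro card_mono finite_permutations) (auto simp: perfect_matchings_def)
  also have "\<dots> = fact n" by (simp add: card_permutations)
  also have "(fact n :: nat) \<le> n ^ n" using fact_le_power[where 'a = nat, of n] by simp
  finally show ?thesis .
qed

text \<open>Half of the claimed bound suffices for the distance. The other half is at least 1 for n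
  \<ge> 2, because n ln n \<ge> 1, and absorbs the rounding of \<open>t\<close> to an integer. For n
  = 1 the claimed bound is 16 ln (1 / \<epsilon>), which may be below 1, so \<open>t\<close> has to
  be 0.\<close>

lemma mixing_time_bound:
  assumes n: "1 \<le> n" and \<epsilon>: "0 < \<epsilon>" "\<epsilon> < 1"
  obtains t where "mixing_time n E \<epsilon> \<le> enat t"
    "real t < 8 * real n ^ 6 * (real n * ln (real n) + 2 * ln (inverse \<epsilon>))"
proof (cases "n = 1")
  case True
  have eps: "0 < ln (inverse \<epsilon>)" using \<epsilon> by (simp add: one_less_inverse)
  have "card \<Omega> = 1" using card_\<Omega>_le card_\<Omega>_pos True by simp
  then have "switch_distance n E 0 x \<le> \<epsilon>" if "x \<in> \<Omega>" for x
    using switch_distance_le[of x 0] that n \<epsilon> by simp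
  then have "mixing_time n E \<epsilon> \<le> enat 0" by (rule mixing_time_le)
  then show thesis using True eps by (intro that[of 0]) simp_all
next
  case False
  then have n2: "2 \<le> n" using n by simp
  have eps: "0 < ln (inverse \<epsilon>)" using \<epsilon> by (simp add: one_less_inverse)
  let ?b = "4 * real n ^ 6 * (ln (real (card \<Omega>)) + 2 * ln (inverse \<epsilon>))"
  define t where "t = nat \<lceil>?b\<rceil>"
  have N: "1 \<le> real (card \<Omega>)" using card_\<Omega>_pos by simp
  have n6: "1 \<le> real n ^ 6" using n by simp
  have b: "0 \<le> ?b" using N eps by simp
  have t: "?b \<le> real t" "real t < ?b + 1" using b unfolding t_def by linarith+
  have "mixing_time n E \<epsilon> \<le> enat t"
    by (rule mixing_time_le, rule switch_distance_small) (use n \<epsilon> t in auto)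
  moreover have "ln (real (card \<Omega>)) \<le> ln (real (n ^ n))"
    using card_\<Omega>_le N by (subst ln_le_cancel_iff) (use n in \<open>auto simp del: of_nat_power\<close>)
  then have lnN: "ln (real (card \<Omega>)) \<le> real n * ln (real n)" using n by (simp add: ln_realpow)
  have "1 \<le> real n * ln (real n)"
  proof -
    have "1 / 2 \<le> ln (2::real)" using ln2_ge_two_thirds by simp
    also have "ln 2 \<le> ln (real n)" using n2 by simp
    finally have "2 * (1 / 2) \<le> real n * ln (real n)" using n2 by (intro mult_mono) auto
    then show ?thesis by simp
  qed
  then have "1 \<le> 4 * real n ^ 6 * (real n * ln (real n))"
    using n6 mult_mono[of 1 "real n ^ 6" 1 "real n * ln (real n)"] by simp
  moreover have "?b \<le> 4 * real n ^ 6 * (real n * ln (real n) + 2 * ln (inverse \<epsilon>))"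
    using lnN n6 by (intro mult_left_mono) auto
  moreover have "0 \<le> 4 * real n ^ 6 * (2 * ln (inverse \<epsilon>))" using eps by simp
  ultimately show thesis
    using t(2) by (intro that[of t]) (simp_all add: algebra_simps)
qed

end

lemma monotone_mixing_time_bound:
  assumes "1 \<le> n" "monotone_graph n E" "perfect_matchings n E \<noteq> {}" "0 < \<epsilon>" "\<epsilon> < 1"
  obtains t where "mixing_time n E \<epsilon> \<le> enat t"
    "real t < 8 * real n ^ 6 * (real n * ln (real n) + 2 * ln (inverse \<epsilon>))"
proof -
  obtain \<sigma> \<tau> \<alpha> \<beta> where g: "\<sigma> permutes {1..n}" "\<tau> permutes {1..n}"
    "\<forall>i\<in>{1..n}. {j\<in>{1..n}. \<tau> j \<in> neighbours E (\<sigma> i)} = {\<alpha> i..\<beta> i}"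
    "\<forall>i\<in>{1..n}. \<forall>j\<in>{1..n}. i < j \<longrightarrow> \<alpha> i \<le> \<alpha> j \<and> \<beta> i \<le> \<beta> j"
    using assms(2) unfolding monotone_graph_def by (elim conjE exE) (rule that)
  interpret monotone_matching n E \<sigma> \<tau> \<alpha> \<beta>
  proof
    show "\<alpha> i \<le> \<alpha> j \<and> \<beta> i \<le> \<beta> j" if "i \<in> {1..n}" "j \<in> {1..n}" "i \<le> j" for i j
      using g(4) that by (cases "i = j") auto
  qed (use g assms(3) in blast)+
  show thesis using mixing_time_bound assms(1,4,5) that by blast
qed

theorem theorem19:
  "(\<forall>(n::nat) E (\<epsilon>::real).
      1 \<le> n \<and> monotone_graph n E \<and> perfect_matchings n E \<noteq> {} \<and> 0 < \<epsilon> \<and> \<epsilon> < 1 \<longrightarrow>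
      ereal_of_enat (mixing_time n E \<epsilon>)
        < ereal (8 * real n ^ 6 * (real n * ln (real n) + 2 * ln (inverse \<epsilon>)))) \<and>
   (\<forall>(E :: nat \<Rightarrow> (nat \<times> nat) set) (\<epsilon> :: nat \<Rightarrow> real).
      (\<forall>n\<ge>1. monotone_graph n (E n) \<and> perfect_matchings n (E n) \<noteq> {} \<and> 0 < \<epsilon> n \<and> \<epsilon> n < 1) \<and>
      (\<lambda>n. ln (inverse (\<epsilon> n))) \<in> O(\<lambda>n. real n * ln (real n)) \<longrightarrow>
      (\<lambda>n. 8 * real n ^ 6 * (real n * ln (real n) + 2 * ln (inverse (\<epsilon> n))))
        \<in> O(\<lambda>n. real n ^ 7 * ln (real n)) \<and>
      (\<lambda>n. real (the_enat (mixing_time n (E n) (\<epsilon> n)))) \<in> O(\<lambda>n. real n ^ 7 * ln (real n)))"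
proof (intro conjI allI impI; elim conjE)
  fix n E and \<epsilon> :: real
  assume "1 \<le> n" "monotone_graph n E" "perfect_matchings n E \<noteq> {}" "0 < \<epsilon>" "\<epsilon> < 1"
  then obtain t where t: "mixing_time n E \<epsilon> \<le> enat t"
    "real t < 8 * real n ^ 6 * (real n * ln (real n) + 2 * ln (inverse \<epsilon>))"
    by (rule monotone_mixing_time_bound)
  have "ereal_of_enat (mixing_time n E \<epsilon>) \<le> ereal_of_enat (enat t)"
    using t(1) by (simp only: ereal_of_enat_le_iff)
  also have "\<dots> < ereal (8 * real n ^ 6 * (real n * ln (real n) + 2 * ln (inverse \<epsilon>)))"
    using t(2) by simp
  finally show "ereal_of_enat (mixing_time n E \<epsilon>) <
    ereal (8 * real n ^ 6 * (real n * ln (real n) + 2 * ln (inverse \<epsilon>)))" .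
next
  fix E :: "nat \<Rightarrow> (nat \<times> nat) set" and \<epsilon> :: "nat \<Rightarrow> real"
  let ?b = "\<lambda>n. 8 * real n ^ 6 * (real n * ln (real n) + 2 * ln (inverse (\<epsilon> n)))"
  assume E: "\<forall>n\<ge>1. monotone_graph n (E n) \<and> perfect_matchings n (E n) \<noteq> {} \<and> 0 < \<epsilon> n \<and> \<epsilon> n < 1"
    and \<epsilon>: "(\<lambda>n. ln (inverse (\<epsilon> n))) \<in> O(\<lambda>n. real n * ln (real n))"
  have "(\<lambda>n. real n * ln (real n) + 2 * ln (inverse (\<epsilon> n))) \<in> O(\<lambda>n. real n * ln (real n))"
    using \<epsilon> by (intro sum_in_bigo) simp_all
  then have "?b \<in> O(\<lambda>n. real n ^ 6 * (real n * ln (real n)))"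
    by (intro landau_o.big.mult) simp_all
  then show b: "?b \<in> O(\<lambda>n. real n ^ 7 * ln (real n))"
    by (simp add: power_numeral_reduce mult.assoc)
  have "norm (real (the_enat (mixing_time n (E n) (\<epsilon> n)))) \<le> norm (?b n)" if "n \<ge> 1" for n
  proof -
    have conds: "1 \<le> n" "monotone_graph n (E n)" "perfect_matchings n (E n) \<noteq> {}" "0 < \<epsilon> n" "\<epsilon> n < 1"
      using E that by blast+
    obtain t where t: "mixing_time n (E n) (\<epsilon> n) \<le> enat t" "real t < ?b n"
      by (rule monotone_mixing_time_bound[OF conds])
    \<comment> \<open>The finite bound excludes \<infinity>, so \<open>the_enat\<close> returns the
      actual mixing time.\<close>
    then obtain k where "mixing_time n (E n) (\<epsilon> n) = enat k" "k \<le> t" by (cases "mixing_time n (E n) (\<epsilon> n)") auto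
    then show ?thesis using t(2) by simp
  qed
  then have "(\<lambda>n. real (the_enat (mixing_time n (E n) (\<epsilon> n)))) \<in> O(?b)"
    by (intro landau_o.big_mono eventually_at_top_linorderI[of 1])
  then show "(\<lambda>n. real (the_enat (mixing_time n (E n) (\<epsilon> n)))) \<in> O(\<lambda>n. real n ^ 7 * ln (real n))"
    using b by (rule landau_o.big_trans)
qed

end
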